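(* Let $d\ge1$ and let $\Phi,\Psi$ be two Young functions such that the associated maximal functions $M_\Phi$ and $M_\Psi$ (over dyadic tents) are bounded on $L^2(\mathbb{B}^d,d\nu)$. Then there is a constant $C>0$ such that for every pair of weights $\sigma,w$ on $\mathbb{B}^d$ the Bergman projection $P$ satisfies $$\lVert P(\sigma\,\cdot)\rVert_{L^2(\sigma)\to L^2(w)}\le C\,[w,\sigma]_{\Phi,\Psi},$$ that is, $\lVert P(\sigma f)\rVert_{L^2(w)}\le C\,[w,\sigma]_{\Phi,\Psi}\lVert f\rVert_{L^2(\sigma)}$ for all $f\in L^2(\sigma)$. The constant $C$ is independent of $\sigma$ and $w$.
   Context: $\mathbb{B}^d$ is the open unit ball of $\mathbb{C}^d$, $\nu$ is the normalised Lebesgue (volume) measure on $\mathbb{B}^d$, $|E|:=\nu(E)$, $\langle f\rangle_E:=\frac1{|E|}\int_E f\,d\nu$. A weight is a positive function in $L^1_{\mathrm{loc}}(\mathbb{B}^d)$; $L^2(w):=L^2(\mathbb{B}^d,w\,d\nu)$. The Bergman projection is $$Pf(z)=\int_{\mathbb{B}^d}\frac{f(\zeta)}{(1-z\bar\zeta)^{d+1}}\,d\nu(\zeta),\qquad z\bar\zeta:=\langle z,\zeta\rangle=\sum_j z_j\overline{\zeta_j}.$$ Dyadic tents. Let $\varphi_z$ be the biholomorphic involution of $\mathbb{B}^d$ exchanging $z$ and $0$, and $\beta(z,w)=\frac12\log\frac{1+|\varphi_z(w)|}{1-|\varphi_z(w)|}$ the Bergman metric. $B(z_0,r)$ is the ball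 in the metric $\beta$, $\mathbb{S}_r=\partial B(0,r)$ (with $\mathbb{S}_0=\{0\}$), and $\pi_{r}$ is the radial projection onto $\mathbb{S}_{r}$. Fix parameters $R,\delta>0$. For each $n\in\mathbb{N}$ choose points $\{z_j^n\}_{j=1}^{J_n}\subset\mathbb{S}_{nR}$ and a partition of $\mathbb{S}_{nR}$ into Borel sets $\Omega_j^n$, $1\le j\le J_n$, with $B(z_j^n,\delta)\cap\mathbb{S}_{nR}\subseteq\Omega_j^n\subseteq B(z_j^n,C_0\delta)\cap\mathbb{S}_{nR}$ for some constant $C_0>0$. The kubes are $K_1^0=B(0,R)$ and, for $n\ge1$, $K_j^n=\{\zeta\in B(0,(n+1)R)\setminus B(0,nR):\pi_{nR}(\zeta)\in\Omega_j^n\}$, with centre $c_j^n=\pi_{(n+\frac12)R}(z_j^n)$. The centre $c_i^{n+1}$ is a child of $c_k^n$ if $\pi_{nR}(c_i^{n+1})\in\Omega_k^n$ (all centres of generation $1$ are children of the root, the centre of $K_1^0$). The centres so ordered form a tree, called a Bergman tree; for $\alpha$ in the tree $K_\alpha$ is the kube with centre $\alpha$, and the dyadic tent is $\hat K_\alpha=\bigcup_{\beta\ge\alpha}K_\beta$, the union over $\alpha$ and all its descendants $\beta$. For $z\in\mathbb{B}^d\setminus\{0\}$ the Carleson tent is $T_z=\{\zeta\in\mathbb{B}^d:|1-\langle\zeta,z/|z|\rangle|\le1-|z|\}$, and $T_0=\mathbb{B}^d$. Throughout, one fixes a finite collection of Bergman trees $\mathcal{T}_1,\dots,\mathcal{T}_N$,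 depending only on $d$, such that every Carleson tent $T_z$ is contained in some dyadic tent $\hat K_\alpha$ with $\alpha\in\mathcal{T}_\ell$ for some $\ell$ and $|\hat K_\alpha|$ comparable to $|T_z|$ with constants independent of $z$ (such a collection exists). $\mathscr{T}$ denotes the collection of all dyadic tents $\hat K_\alpha$, $\alpha\in\mathcal{T}_\ell$, $1\le\ell\le N$. Orlicz bumps. A Young function is a continuous, convex, strictly increasing $\Phi:[0,\infty)\to[0,\infty)$ with $\Phi(0)=0$ and $\lim_{t\to\infty}\Phi(t)/t=\infty$. For a set $Q$ and non-negative $f$, $\langle f\rangle_{\Phi,Q}=\inf\{\lambda>0:\langle\Phi(f/\lambda)\rangle_Q\le1\}$. The associated maximal function is $M_\Phi f=\sup_{\hat K\in\mathscr{T}}\langle|f|\rangle_{\Phi,\hat K}\mathbf{1}_{\hat K}$. The joint Orlicz bump of two weights is $$[w,\sigma]_{\Phi,\Psi}=\sup_{\hat K\in\mathscr{T}}\frac{\langle w\rangle_{\hat K}}{\langle w^{1/2}\rangle_{\Phi,\hat K}}\,\frac{\langle\sigma\rangle_{\hat K}}{\langle\sigma^{1/2}\rangle_{\Psi,\hat K}},$$ where a quotient of the form $\infty/\infty$ is read as $\infty$. *)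

theory Defs
  imports "HOL-Analysis.Analysis"
begin

section \<open>The unit ball of complex \<open>d\<close>-space\<close>

text \<open>The space is \<open>complex ^ 'd\<close> with \<open>d = CARD('d)\<close>, and the unit ball is \<open>ball 0 1\<close>. The library's
  \<open>inner\<close> on this type is the real inner product, so the Hermitian one is introduced here.\<close>

definition cinner :: "complex ^ 'd \<Rightarrow> complex ^ 'd \<Rightarrow> complex" where
  "cinner z w = (\<Sum>j\<in>UNIV. z $ j * cnj (w $ j))"

text \<open>The underlying \<open>\<sigma>\<close>-algebra consists of the Lebesgue measurable subsets of the ball;
  in particular values of functions outside the ball are irrelevant.\<close>

definition ball_measure :: "(complex ^ 'd) measure" where
  "ball_measure = uniform_measure (lebesgue_on (ball 0 1)) (ball 0 1)"

text \<open>The standard formula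
  \<open>\<phi>\<^sub>z(w) = (z - P\<^sub>z w - sqrt (1 - \<bar>z\<bar>\<^sup>2) Q\<^sub>z w) / (1 - \<langle>w, z\<rangle>)\<close> for the involution of the ball
  exchanging \<open>z\<close> and \<open>0\<close>, where \<open>P\<^sub>z\<close> is the orthogonal projection onto the complex line
  spanned by \<open>z\<close> and \<open>Q\<^sub>z = I - P\<^sub>z\<close>. For \<open>z = 0\<close>, division by zero yields \<open>P\<^sub>0 = 0\<close>, as required.\<close>

definition line_proj :: "complex ^ 'd \<Rightarrow> complex ^ 'd \<Rightarrow> complex ^ 'd" where
  "line_proj z w = (cinner w z / cinner z z) *s z"

definition ball_involution :: "complex ^ 'd \<Rightarrow> complex ^ 'd \<Rightarrow> complex ^ 'd" where
  "ball_involution z w =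
     (1 / (1 - cinner w z)) *s
       (z - line_proj z w - sqrt (1 - (norm z)\<^sup>2) *\<^sub>R (w - line_proj z w))"

definition bergman_dist :: "complex ^ 'd \<Rightarrow> complex ^ 'd \<Rightarrow> real" where
  "bergman_dist z w =
     1 / 2 * ln ((1 + norm (ball_involution z w)) / (1 - norm (ball_involution z w)))"

definition bergman_ball :: "complex ^ 'd \<Rightarrow> real \<Rightarrow> (complex ^ 'd) set" where
  "bergman_ball z r = {w \<in> ball 0 1. bergman_dist z w < r}"

definition bergman_sphere :: "real \<Rightarrow> (complex ^ 'd) set" where
  "bergman_sphere r = (if r = 0 then {0} else frontier (bergman_ball 0 r))"

text \<open>The Bergman sphere of radius \<open>r\<close> about \<open>0\<close> is the Euclidean sphere of radius \<open>tanh r\<close>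
  (see \<open>bergman_sphere_eq\<close> below), hence the formula for the radial projection onto it.\<close>

definition radial_proj :: "real \<Rightarrow> complex ^ 'd \<Rightarrow> complex ^ 'd" where
  "radial_proj r z = (tanh r / norm z) *\<^sub>R z"

lemma cinner_self: "cinner z z = complex_of_real ((norm z)\<^sup>2)"
proof -
  have "(norm z)\<^sup>2 = (\<Sum>j\<in>UNIV. (cmod (z $ j))\<^sup>2)"
    by (simp add: norm_vec_def L2_set_def sum_nonneg)
  then show ?thesis
    by (simp add: cinner_def flip: complex_norm_square)
qed

lemma ball_involution_swap:
  assumes "norm z < 1"
  shows "ball_involution z 0 = z" and "ball_involution z z = 0"
  by (auto simp: ball_involution_def line_proj_def cinner_def vec_eq_iff cinner_self[unfolded cinner_def])

lemma ball_involution_0: "ball_involution 0 w = - w"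
  by (simp add: ball_involution_def line_proj_def cinner_def vec_eq_iff)

lemma bergman_dist_0: "norm w < 1 \<Longrightarrow> bergman_dist 0 w = artanh (norm w)"
  by (simp add: bergman_dist_def ball_involution_0 artanh_def)

lemma bergman_ball_0: "bergman_ball 0 r = ball 0 (tanh r)"
proof -
  have tanh_artanh: "tanh (artanh x) = x" if "0 \<le> x" "x < 1" for x :: real
  proof -
    have "exp (- 2 * artanh x) = inverse (exp (ln ((1 + x) / (1 - x))))"
      by (simp add: artanh_def exp_minus)
    also have "\<dots> = (1 - x) / (1 + x)"
      using that by (subst exp_ln) (auto simp: field_simps)
    finally show ?thesis
      using that by (simp only: tanh_real_altdef) (simp add: field_simps)
  qed
  have *: "artanh (norm w) < r \<longleftrightarrow> norm w < tanh r" if "norm w < 1" for w :: "complex ^ 'a"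
    using tanh_artanh[OF norm_ge_zero that] tanh_real_less_iff[of "artanh (norm w)" r] by simp
  have "tanh r < (1::real)" by (rule tanh_real_lt_1)
  then show ?thesis
    unfolding bergman_ball_def by (auto simp: bergman_dist_0 *)
qed

lemma bergman_sphere_eq:
  assumes "r \<ge> 0"
  shows "bergman_sphere r = (sphere 0 (tanh r) :: (complex ^ 'd) set)"
  using assms by (auto simp: bergman_sphere_def bergman_ball_0 frontier_ball)


section \<open>Bergman trees and dyadic tents\<close>

text \<open>For each generation \<open>n\<close>: the number of points, the points \<open>z\<^sub>j\<^sup>n\<close> and the Borel cells \<open>\<Omega>\<^sub>j\<^sup>n\<close>,
  where only indices \<open>j \<in> {1..num_points n}\<close> are relevant.\<close>

record 'd tree_data =
  num_points :: "nat \<Rightarrow> nat"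
  pt :: "nat \<Rightarrow> nat \<Rightarrow> complex ^ 'd"
  cell :: "nat \<Rightarrow> nat \<Rightarrow> (complex ^ 'd) set"

definition bergman_tree :: "real \<Rightarrow> real \<Rightarrow> 'd::finite tree_data \<Rightarrow> bool" where
  "bergman_tree R \<delta> T \<longleftrightarrow>
     (\<exists>C\<^sub>0>0. \<forall>n.
        disjoint_family_on (cell T n) {1..num_points T n} \<and>
        (\<Union>j\<in>{1..num_points T n}. cell T n j) = bergman_sphere (real n * R) \<and>
        (\<forall>j\<in>{1..num_points T n}.
           pt T n j \<in> bergman_sphere (real n * R) \<and>
           cell T n j \<in> sets borel \<and>
           bergman_ball (pt T n j) \<delta> \<inter> bergman_sphere (real n * R) \<subseteq> cell T n j \<and>
           cell T n j \<subseteq> bergman_ball (pt T n j) (C\<^sub>0 * \<delta>) \<inter> bergman_sphere (real n * R)))"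

text \<open>A vertex of the tree is represented by its index \<open>(n, j)\<close> instead of the centre \<open>c\<^sub>j\<^sup>n\<close>;
  distinct indices have distinct centres. Generation \<open>0\<close> consists of the root \<open>(0, 1)\<close> only,
  since its cells partition \<open>{0}\<close>.\<close>

definition vertices :: "'d::finite tree_data \<Rightarrow> (nat \<times> nat) set" where
  "vertices T = {(n, j). j \<in> {1..num_points T n}}"

definition kube :: "real \<Rightarrow> 'd::finite tree_data \<Rightarrow> nat \<times> nat \<Rightarrow> (complex ^ 'd) set" where
  "kube R T = (\<lambda>(n, j).
     if n = 0 then bergman_ball 0 R
     else {\<zeta> \<in> bergman_ball 0 (real (n + 1) * R) - bergman_ball 0 (real n * R).
             radial_proj (real n * R) \<zeta> \<in> cell T n j})"

definition center :: "real \<Rightarrow> 'd::finite tree_data \<Rightarrow> nat \<times> nat \<Rightarrow> complex ^ 'd" where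
  "center R T = (\<lambda>(n, j). if n = 0 then 0 else radial_proj ((real n + 1 / 2) * R) (pt T n j))"

definition child_rel :: "real \<Rightarrow> 'd::finite tree_data \<Rightarrow> ((nat \<times> nat) \<times> (nat \<times> nat)) set" where
  "child_rel R T =
     {((n, k), (Suc n, i)) | n k i.
        (n, k) \<in> vertices T \<and> (Suc n, i) \<in> vertices T \<and>
        (n = 0 \<or> radial_proj (real n * R) (center R T (Suc n, i)) \<in> cell T n k)}"

definition dyadic_tent :: "real \<Rightarrow> 'd::finite tree_data \<Rightarrow> nat \<times> nat \<Rightarrow> (complex ^ 'd) set" where
  "dyadic_tent R T \<alpha> = (\<Union>\<beta>\<in>{\<beta>. (\<alpha>, \<beta>) \<in> (child_rel R T)\<^sup>*}. kube R T \<beta>)"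

definition dyadic_tents :: "real \<Rightarrow> nat \<Rightarrow> (nat \<Rightarrow> 'd::finite tree_data) \<Rightarrow> (complex ^ 'd) set set" where
  "dyadic_tents R N T = (\<Union>l\<in>{1..N}. dyadic_tent R (T l) ` vertices (T l))"

definition carleson_tent :: "complex ^ 'd \<Rightarrow> (complex ^ 'd) set" where
  "carleson_tent z =
     (if z = 0 then ball 0 1
      else {\<zeta> \<in> ball 0 1. cmod (1 - cinner \<zeta> ((1 / norm z) *\<^sub>R z)) \<le> 1 - norm z})"

definition covers_carleson_tents :: "(complex ^ 'd) set set \<Rightarrow> bool" where
  "covers_carleson_tents \<T> \<longleftrightarrow>
     (\<exists>a>0. \<exists>b>0. \<forall>z\<in>ball 0 1. \<exists>K\<in>\<T>.
        carleson_tent z \<subseteq> K \<and>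
        a * measure ball_measure (carleson_tent z) \<le> measure ball_measure K \<and>
        measure ball_measure K \<le> b * measure ball_measure (carleson_tent z))"


section \<open>Weighted Lebesgue spaces and the Bergman projection\<close>

text \<open>Positivity is required almost everywhere, as elements of \<open>L\<^sup>1\<^sub>l\<^sub>o\<^sub>c\<close> are only determined
  almost everywhere.\<close>

definition weight :: "(complex ^ 'd \<Rightarrow> real) \<Rightarrow> bool" where
  "weight w \<longleftrightarrow>
     w \<in> borel_measurable ball_measure \<and>
     (AE z in ball_measure. 0 < w z) \<and>
     (\<forall>K. compact K \<and> K \<subseteq> ball 0 1 \<longrightarrow> set_integrable ball_measure K w)"

definition weighted :: "(complex ^ 'd \<Rightarrow> real) \<Rightarrow> (complex ^ 'd) measure" where
  "weighted w = density ball_measure (\<lambda>z. ennreal (w z))"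

definition ennreal_sqrt :: "ennreal \<Rightarrow> ennreal" where
  "ennreal_sqrt x = (if x = \<infinity> then \<infinity> else ennreal (sqrt (enn2real x)))"

text \<open>Stated for extended non-negative functions, so that it applies both to \<open>\<bar>f\<bar>\<close> and to
  maximal functions, which may take the value \<open>\<infinity>\<close>.\<close>

definition L2_norm :: "'a measure \<Rightarrow> ('a \<Rightarrow> ennreal) \<Rightarrow> ennreal" where
  "L2_norm M g = ennreal_sqrt (\<integral>\<^sup>+x. (g x)\<^sup>2 \<partial>M)"

definition L2_space :: "'a measure \<Rightarrow> ('a \<Rightarrow> complex) set" where
  "L2_space M = {f \<in> borel_measurable M. L2_norm M (\<lambda>x. ennreal (cmod (f x))) < \<infinity>}"

definition bergman_kernel :: "complex ^ 'd \<Rightarrow> complex ^ 'd \<Rightarrow> complex" where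
  "bergman_kernel z \<zeta> = 1 / (1 - cinner z \<zeta>) ^ (CARD('d) + 1)"

definition bergman_projection :: "(complex ^ 'd \<Rightarrow> complex) \<Rightarrow> complex ^ 'd \<Rightarrow> complex" where
  "bergman_projection f z = (LINT \<zeta>|ball_measure. f \<zeta> * bergman_kernel z \<zeta>)"


section \<open>Orlicz bumps\<close>

definition young_function :: "(real \<Rightarrow> real) \<Rightarrow> bool" where
  "young_function \<Phi> \<longleftrightarrow>
     (\<forall>t\<ge>0. 0 \<le> \<Phi> t) \<and> continuous_on {0..} \<Phi> \<and> convex_on {0..} \<Phi> \<and>
     strict_mono_on {0..} \<Phi> \<and> \<Phi> 0 = 0 \<and> filterlim (\<lambda>t. \<Phi> t / t) at_top at_top"

text \<open>Averages take values in \<open>[0, \<infinity>]\<close>, since a weight need not be integrable on a tent.\<close>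

definition average :: "(complex ^ 'd) set \<Rightarrow> (complex ^ 'd \<Rightarrow> ennreal) \<Rightarrow> ennreal" where
  "average E g = (\<integral>\<^sup>+z\<in>E. g z \<partial>ball_measure) / emeasure ball_measure E"

text \<open>The infimum of the empty set is \<open>\<infinity>\<close>.\<close>

definition orlicz_average ::
    "(real \<Rightarrow> real) \<Rightarrow> (complex ^ 'd) set \<Rightarrow> (complex ^ 'd \<Rightarrow> real) \<Rightarrow> ennreal" where
  "orlicz_average \<Phi> Q f =
     Inf {ennreal s | s. 0 < s \<and> average Q (\<lambda>z. ennreal (\<Phi> (f z / s))) \<le> 1}"

definition orlicz_maximal ::
    "(complex ^ 'd) set set \<Rightarrow> (real \<Rightarrow> real) \<Rightarrow> (complex ^ 'd \<Rightarrow> complex) \<Rightarrow> complex ^ 'd \<Rightarrow> ennreal"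
  where
  "orlicz_maximal \<T> \<Phi> f z = (SUP K\<in>\<T>. orlicz_average \<Phi> K (\<lambda>\<zeta>. cmod (f \<zeta>)) * indicator K z)"

definition maximal_bounded_L2 :: "(complex ^ 'd) set set \<Rightarrow> (real \<Rightarrow> real) \<Rightarrow> bool" where
  "maximal_bounded_L2 \<T> \<Phi> \<longleftrightarrow>
     (\<exists>A::real. \<forall>f\<in>L2_space ball_measure.
        L2_norm ball_measure (orlicz_maximal \<T> \<Phi> f)
          \<le> ennreal A * L2_norm ball_measure (\<lambda>z. ennreal (cmod (f z))))"

text \<open>In \<open>ennreal\<close> the library has \<open>\<infinity> / \<infinity> = 0\<close>; here it has to be \<open>\<infinity>\<close>.\<close>

definition bump_quotient :: "ennreal \<Rightarrow> ennreal \<Rightarrow> ennreal" where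
  "bump_quotient a b = (if a = \<infinity> \<and> b = \<infinity> then \<infinity> else a / b)"

definition orlicz_bump ::
    "(complex ^ 'd) set set \<Rightarrow> (real \<Rightarrow> real) \<Rightarrow> (real \<Rightarrow> real)
      \<Rightarrow> (complex ^ 'd \<Rightarrow> real) \<Rightarrow> (complex ^ 'd \<Rightarrow> real) \<Rightarrow> ennreal" where
  "orlicz_bump \<T> \<Phi> \<Psi> w \<sigma> =
     (SUP K\<in>\<T>.
        bump_quotient (average K (\<lambda>z. ennreal (w z))) (orlicz_average \<Phi> K (\<lambda>z. sqrt (w z))) *
        bump_quotient (average K (\<lambda>z. ennreal (\<sigma> z))) (orlicz_average \<Psi> K (\<lambda>z. sqrt (\<sigma> z))))"

end

theory Submission
  imports Defs
begin

text \<open>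
  Two points \<open>z, \<zeta>\<close> of the ball lie in a common Carleson tent of measure comparable to
  \<open>\<bar>1 - \<langle>z, \<zeta>\<rangle>\<bar>\<close> to the power \<open>d + 1\<close>, hence in a dyadic tent of comparable measure. So the Bergman
  kernel is dominated by the sum of \<open>1\<^sub>K(z) 1\<^sub>K(\<zeta>) / \<bar>K\<bar>\<close> over those dyadic tents \<open>K\<close> that are comparable
  to their top kube; for each tree these form a nested family with disjoint top kubes. Testing
  against \<open>g\<close>, each summand is the product of the averages of \<open>\<bar>f\<bar>\<close> and \<open>g\<close> with respect to \<open>\<sigma>\<close> and \<open>w\<close>,
  times \<open>\<langle>\<sigma>\<rangle>\<^sub>K \<langle>w\<rangle>\<^sub>K \<bar>K\<bar>\<close>, and the bump condition replaces \<open>\<langle>\<sigma>\<rangle>\<^sub>K \<langle>w\<rangle>\<^sub>K\<close> by the two Orlicz averages. After the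
  Cauchy-Schwarz inequality it remains to apply the Carleson embedding theorem with respect to \<open>\<sigma>\<close>
  and to \<open>w\<close>, whose packing condition is the boundedness of the maximal function on
  \<open>\<sigma>\<^sup>1\<^sup>/\<^sup>2 1\<^sub>K\<close> and \<open>w\<^sup>1\<^sup>/\<^sup>2 1\<^sub>K\<close>, integrated over the disjoint top kubes.
\<close>

section \<open>Hermitian geometry and invariance of Lebesgue measure\<close>

text \<open>Weights are only locally integrable, so averages over tents can be infinite. Testing the
  maximal operators on a single tent shows that a finite average of a weight forces a finite Orlicz
  average of its square root; hence neither bump quotient can be 0, and a finite bump makes both of
  them finite. As the ball itself is a dyadic tent, both weighted measures are then finite, square
  integrable functions are integrable, and P(\<sigma> f) converges absolutely at every point of the
  ball. For an infinite bump only \<open>f\<close> of norm 0 asks for an argument. No regularity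
  such as doubling is available for the weights, so the embedding theorem has to hold for general
  measures on a laminar family. Moreover, P(\<sigma> f) is not known in advance to be square
  integrable against \<open>w\<close>; therefore the bilinear form is tested against truncations of
  its modulus.\<close>

lemma cinner_add_left: "cinner (x + y) z = cinner x z + cinner y z"
  by (simp add: cinner_def algebra_simps sum.distrib)

lemma cinner_diff_left: "cinner (x - y) z = cinner x z - cinner y z"
  by (simp add: cinner_def algebra_simps sum_subtractf)

lemma cinner_diff_right: "cinner z (x - y) = cinner z x - cinner z y"
  by (simp add: cinner_def algebra_simps sum_subtractf)

lemma cinner_scale_left: "cinner (c *s x) z = c * cinner x z"
  by (simp add: cinner_def sum_distrib_left mult.assoc)

lemma cinner_scale_right: "cinner x (c *s z) = cnj c * cinner x z"
  by (simp add: cinner_def sum_distrib_left algebra_simps)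

lemma scaleR_eq_scale: "r *\<^sub>R x = complex_of_real r *s (x :: complex ^ 'd)"
  by (simp add: vec_eq_iff complex_eq_iff)

lemma cinner_scaleR_left: "cinner (r *\<^sub>R x) z = of_real r * cinner x z"
  by (simp add: scaleR_eq_scale cinner_scale_left)

lemma cinner_scaleR_right: "cinner x (r *\<^sub>R z) = of_real r * cinner x z"
  by (simp add: scaleR_eq_scale cinner_scale_right)

lemma cinner_commute: "cinner y x = cnj (cinner x y)"
  by (simp add: cinner_def mult.commute)

lemma cinner_axis: "cinner x (axis k 1) = x $ k"
proof -
  have "cinner x (axis k 1) = (\<Sum>j\<in>UNIV. if j = k then x $ j else 0)"
    unfolding cinner_def axis_def by (intro sum.cong) auto
  then show ?thesis by simp
qed

lemma cinner_0_right [simp]: "cinner x 0 = 0"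
  by (simp add: cinner_def)

lemma norm_vector_scale: "norm (c *s x) = cmod c * norm (x :: complex ^ 'd)"
  by (simp add: norm_vec_def norm_mult L2_set_right_distrib)

text \<open>Pythagoras for the complex line spanned by \<open>e\<close>. It gives the Cauchy-Schwarz
  inequality that follows and, in \<open>bergman_dist_sphere_less\<close>, the size of the component
  orthogonal to \<open>e\<close>.\<close>

lemma norm_diff_proj_sq:
  fixes x e :: "complex ^ 'd"
  assumes "norm e = 1"
  shows "(norm (x - cinner x e *s e))\<^sup>2 = (norm x)\<^sup>2 - (cmod (cinner x e))\<^sup>2"
proof -
  have e: "cinner e e = 1" using assms by (simp add: cinner_self)
  have "complex_of_real ((norm (x - cinner x e *s e))\<^sup>2) =
      cinner x x - cinner x e * cnj (cinner x e)"
    unfolding cinner_self[symmetric]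
    by (simp add: cinner_diff_left cinner_diff_right cinner_scale_left cinner_scale_right e
        cinner_commute[of x e] algebra_simps)
  also have "\<dots> = complex_of_real ((norm x)\<^sup>2 - (cmod (cinner x e))\<^sup>2)"
    by (simp only: cinner_self complex_norm_square[symmetric] of_real_diff)
  finally show ?thesis by (simp only: of_real_eq_iff)
qed

lemma cmod_cinner_le:
  fixes x e :: "complex ^ 'd"
  shows "cmod (cinner x e) \<le> norm x * norm e"
proof (cases "e = 0")
  case False
  define u where "u = (1 / norm e) *\<^sub>R e"
  have u: "norm u = 1" using False by (simp add: u_def)
  have "(cmod (cinner x u))\<^sup>2 \<le> (norm x)\<^sup>2"
    using norm_diff_proj_sq[OF u, of x] zero_le_power2[of "norm (x - cinner x u *s u)"] by linarith
  then have "cmod (cinner x u) \<le> norm x" by (rule power2_le_imp_le) simp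
  moreover have "cmod (cinner x u) = cmod (cinner x e) / norm e"
    by (simp add: u_def cinner_scaleR_right norm_mult norm_divide)
  ultimately show ?thesis using False by (simp add: field_simps)
qed simp

text \<open>The map is a complex Householder reflection followed by a rotation of the phase.\<close>

lemma orthogonal_transformation_to_axis:
  fixes e :: "complex ^ 'd::finite" and k :: 'd
  assumes e: "norm e = 1"
  obtains W where "orthogonal_transformation W" "\<And>x. cinner x e = W x $ k"
proof -
  define a :: "complex ^ 'd" where "a = axis k 1"
  \<comment> \<open>This phase makes \<open>cinner a (\<omega> *s e)\<close> real. A complex
    reflection exchanges two unit vectors only if their Hermitian product is real.\<close>
  define \<omega> where "\<omega> = (if cinner a e = 0 then 1 else cinner a e / of_real (cmod (cinner a e)))"
  have \<omega>: "cmod \<omega> = 1" by (simp add: \<omega>_def norm_divide)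
  then have \<omega>c: "cnj \<omega> * \<omega> = 1"
    by (metis complex_norm_square mult.commute of_real_1 power_one)
  have "cnj \<omega> * cinner a e = of_real (cmod (cinner a e))"
  proof (cases "cinner a e = 0")
    case False
    then have "cnj \<omega> * cinner a e = (cinner a e * cnj (cinner a e)) / of_real (cmod (cinner a e))"
      by (simp add: \<omega>_def)
    also have "\<dots> = of_real (cmod (cinner a e))"
      using False by (simp add: complex_norm_square[symmetric] power2_eq_square)
    finally show ?thesis .
  qed simp
  then have ab: "cinner a (\<omega> *s e) = of_real (cmod (cinner a e))"
    by (simp add: cinner_scale_right)
  define b where "b = \<omega> *s e"
  define v where "v = a - b"
  have aa: "cinner a a = 1" by (simp add: a_def cinner_axis)
  have bb: "cinner b b = 1"
    by (simp add: b_def cinner_self norm_vector_scale \<omega> e)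
  have ba: "cinner b a = cinner a b"
    using ab by (subst cinner_commute) (simp add: b_def)
  define q where "q = cinner v v"
  have q: "q = 2 - 2 * cinner a b"
    by (simp add: q_def v_def cinner_diff_left cinner_diff_right aa bb ba)
  have qr: "cnj q = q" unfolding q_def by (metis cinner_commute)
  have q0: "v = 0" if "q = 0"
    using that by (simp add: q_def cinner_self)
  \<comment> \<open>Reflection in the complex hyperplane orthogonal to \<open>v = a - b\<close>,
    which exchanges \<open>a\<close> and \<open>b\<close>. For \<open>a = b\<close> the vector
    \<open>v\<close> is 0 and \<open>H\<close> is the identity.\<close>
  define H where "H x = x - (2 * cinner x v / q) *s v" for x
  have Hb: "cinner (H x) b = x $ k" for x
  proof (cases "q = 0")
    case True
    then have "b = a" using q0 v_def by simp
    then show ?thesis using q0[OF True] by (simp add: H_def a_def cinner_axis)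
  next
    case False
    have "cinner v b = - q / 2" by (simp add: v_def cinner_diff_left bb q)
    then have "cinner (H x) b = cinner x b + cinner x v"
      using False by (simp add: H_def cinner_diff_left cinner_scale_left)
    also have "\<dots> = x $ k"
      by (simp add: v_def cinner_diff_right a_def cinner_axis)
    finally show ?thesis .
  qed
  have Hn: "norm (H x) = norm x" for x
  proof (cases "q = 0")
    case True
    then show ?thesis using q0 by (simp add: H_def)
  next
    case False
    have "cinner (H x) (H x) = cinner x x"
      using False qr
      by (simp add: H_def cinner_diff_left cinner_diff_right cinner_scale_left cinner_scale_right
          q_def[symmetric] cinner_commute[of v x] field_simps)
    then have "(norm (H x))\<^sup>2 = (norm x)\<^sup>2" by (simp only: cinner_self of_real_eq_iff)
    then show ?thesis by simp
  qed
  define U where "U x = cnj \<omega> *s H x" for x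
  have "U (x + y) = U x + U y" for x y
    by (simp add: U_def H_def vec_eq_iff cinner_add_left algebra_simps add_divide_distrib)
  moreover have "U (c *s x) = c *s U x" for c x
    by (simp add: U_def H_def vec_eq_iff cinner_scale_left algebra_simps)
  ultimately have "linear U"
    by (intro linearI) (simp_all add: scaleR_eq_scale)
  moreover have "norm (U x) = norm x" for x
    by (simp add: U_def norm_vector_scale Hn \<omega>)
  ultimately have U: "orthogonal_transformation U" by (simp add: orthogonal_transformation)
  have "cinner (U x) e = x $ k" for x
    using Hb[of x] by (simp add: U_def b_def cinner_scale_left cinner_scale_right)
  \<comment> \<open>\<open>U\<close> turns the \<open>k\<close>-th coordinate into the component
    along \<open>e\<close>; the map sought goes the other way.\<close>
  then have "cinner x e = inv U x $ k" for x
    by (metis U orthogonal_transformation_surj surj_f_inv_f)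
  with orthogonal_transformation_inv[OF U] show ?thesis by (rule that)
qed

text \<open>By Fubini's theorem, a translation-invariant measure that agrees with Lebesgue measure on
  one symmetric set of positive finite measure, here the unit ball, is Lebesgue measure.\<close>

lemma emeasure_lborel_orthogonal_vimage:
  fixes U :: "'a::euclidean_space \<Rightarrow> 'a"
  assumes U: "orthogonal_transformation U" and A[measurable]: "A \<in> sets borel"
  shows "emeasure lborel (U -` A) = emeasure lborel A"
proof -
  have lin: "linear U" using U by (simp add: orthogonal_transformation)
  have [measurable]: "U \<in> borel_measurable borel"
    using lin by (intro borel_measurable_continuous_onI linear_continuous_on)
      (simp add: linear_conv_bounded_linear)
  have [measurable]: "U -` A \<in> sets borel"
    by (rule measurable_sets_borel[OF _ A]) measurable
  let ?B = "ball (0::'a) 1"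
  have m[measurable]: "?B \<in> sets borel" by simp
  have tr: "(\<integral>\<^sup>+x. g (x + c) \<partial>lborel) = (\<integral>\<^sup>+x. g x \<partial>lborel)"
    if [measurable]: "g \<in> borel_measurable borel" for g :: "'a \<Rightarrow> ennreal" and c
    by (subst (2) lborel_distr_plus[symmetric, of c])
      (simp add: nn_integral_distr add.commute)
  \<comment> \<open>The integral of \<open>indicator ?B y * indicator A (U x + y)\<close> is
    evaluated in both orders. With \<open>y\<close> fixed, a translation in \<open>x\<close> by
    \<open>c\<close> with \<open>U c = y\<close> removes \<open>y\<close>; with \<open>x\<close>
    fixed, a translation in \<open>y\<close> moves \<open>U x\<close> into the ball, whose preimage
    is again a unit ball because \<open>U\<close> is isometric.\<close>
  have "emeasure lborel (U -` A) * emeasure lborel ?B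
      = (\<integral>\<^sup>+y. indicator ?B y * (\<integral>\<^sup>+x. indicator A (U x) \<partial>lborel) \<partial>lborel)"
  proof -
    have "(\<integral>\<^sup>+x. indicator A (U x) \<partial>lborel) = emeasure lborel (U -` A)"
      using nn_integral_indicator[of "U -` A" lborel] by (simp add: indicator_def)
    then show ?thesis
      by (simp add: nn_integral_multc mult.commute)
  qed
  also have "\<dots> = (\<integral>\<^sup>+y. \<integral>\<^sup>+x. indicator ?B y * indicator A (U x + y) \<partial>lborel \<partial>lborel)"
  proof (rule nn_integral_cong)
    fix y
    obtain c where c: "y = U c"
      using orthogonal_transformation_surj[OF U] by (metis surjD)
    have "(\<integral>\<^sup>+x. indicator A (U x + y) \<partial>lborel) = (\<integral>\<^sup>+x. indicator A (U (x + c)) \<partial>lborel)"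
      by (simp add: c linear_add[OF lin])
    also have "\<dots> = (\<integral>\<^sup>+x. indicator A (U x) \<partial>lborel)"
      by (rule tr[of "\<lambda>x. indicator A (U x)"]) measurable
    finally show "indicator ?B y * (\<integral>\<^sup>+x. indicator A (U x) \<partial>lborel) =
        (\<integral>\<^sup>+x. indicator ?B y * indicator A (U x + y) \<partial>lborel)"
      by (subst nn_integral_cmult) (auto simp: )
  qed
  also have "\<dots> = (\<integral>\<^sup>+x. \<integral>\<^sup>+y. indicator ?B y * indicator A (U x + y) \<partial>lborel \<partial>lborel)"
    by (rule lborel_pair.Fubini'[symmetric]) measurable
  also have "\<dots> = (\<integral>\<^sup>+x. \<integral>\<^sup>+y. indicator ?B (y - U x) * indicator A y \<partial>lborel \<partial>lborel)"
  proof (rule nn_integral_cong)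
    fix x
    show "(\<integral>\<^sup>+y. indicator ?B y * indicator A (U x + y) \<partial>lborel) =
        (\<integral>\<^sup>+y. indicator ?B (y - U x) * indicator A y \<partial>lborel)"
      using tr[of "\<lambda>y. indicator ?B (y - U x) * indicator A y" "U x"]
      by (simp add: add.commute)
  qed
  also have "\<dots> = (\<integral>\<^sup>+y. \<integral>\<^sup>+x. indicator ?B (y - U x) * indicator A y \<partial>lborel \<partial>lborel)"
    by (rule lborel_pair.Fubini') measurable
  also have "\<dots> = (\<integral>\<^sup>+y. emeasure lborel ?B * indicator A y \<partial>lborel)"
  proof (rule nn_integral_cong)
    fix y
    obtain c where c: "y = U c"
      using orthogonal_transformation_surj[OF U] by (metis surjD)
    have "indicator ?B (y - U x) = (indicator (ball c 1) x :: ennreal)" for x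
      using orthogonal_transformation_norm[OF U, of "c - x"]
      by (simp add: indicator_def c linear_diff[OF lin] dist_norm norm_minus_commute)
    then have "(\<integral>\<^sup>+x. indicator ?B (y - U x) \<partial>lborel) = emeasure lborel (ball c 1)"
      by simp
    also have "\<dots> = emeasure lborel ?B"
      using emeasure_ball[of 1 c] emeasure_ball[of 1 "0::'a"] by simp
    finally show "(\<integral>\<^sup>+x. indicator ?B (y - U x) * indicator A y \<partial>lborel) =
        emeasure lborel ?B * indicator A y"
      by (simp add: nn_integral_multc)
  qed
  also have "\<dots> = emeasure lborel A * emeasure lborel ?B"
    by (subst nn_integral_cmult) (simp_all add: mult.commute)
  finally have *: "emeasure lborel (U -` A) * emeasure lborel ?B = emeasure lborel A * emeasure lborel ?B" .
  have "emeasure lborel ?B \<noteq> 0" "emeasure lborel ?B \<noteq> \<infinity>"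
    using emeasure_lborel_ball_finite[of "0::'a" 1]
    by (simp_all add: emeasure_ball unit_ball_vol_pos[THEN less_imp_neq, symmetric] less_top)
  with * show ?thesis
    by (simp add: mult.commute[of _ "emeasure lborel ?B"] ennreal_mult_cancel_left)
qed

text \<open>Half side lengths of a box in the underlying real space. The direction \<open>k\<close>
  is singled out because a tent of height \<open>s\<close> has extent \<open>s\<close> in one
  complex direction and about \<open>sqrt s\<close> in the others.\<close>

definition box_radii :: "'d::finite \<Rightarrow> real \<Rightarrow> real \<Rightarrow> complex ^ 'd" where
  "box_radii k p q = (\<chi> j. if j = k then Complex p p else Complex q q)"

lemma mem_box_radii:
  "x \<in> cbox (c - box_radii k p q) (c + box_radii k p q) \<longleftrightarrow>
    \<bar>Re (x $ k - c $ k)\<bar> \<le> p \<and> \<bar>Im (x $ k - c $ k)\<bar> \<le> p \<and>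
    (\<forall>j. j \<noteq> k \<longrightarrow> \<bar>Re (x $ j - c $ j)\<bar> \<le> q \<and> \<bar>Im (x $ j - c $ j)\<bar> \<le> q)"
  by (auto simp: mem_box Basis_vec_def inner_axis box_radii_def Basis_complex_def abs_le_iff
      all_conj_distrib algebra_simps split: if_splits)

lemma emeasure_box_radii:
  assumes "p \<ge> 0" "q \<ge> 0"
  shows "emeasure lborel (cbox (c - box_radii k p q) (c + box_radii k p q) :: (complex ^ 'd) set)
    = ennreal ((2 * p)\<^sup>2 * ((2 * q)\<^sup>2) ^ (CARD('d::finite) - 1))"
proof -
  let ?L = "box_radii k p q :: complex ^ 'd"
  have le: "(c - ?L) \<bullet> b \<le> (c + ?L) \<bullet> b" if "b \<in> Basis" for b
    using that assms
    by (auto simp: Basis_vec_def Basis_complex_def inner_axis box_radii_def inner_add_left inner_diff_left)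
  have "(\<Prod>b\<in>Basis. ((c + ?L) - (c - ?L)) \<bullet> b) = (\<Prod>b\<in>Basis. 2 * (?L \<bullet> b))"
    by (intro prod.cong refl, subst inner_diff_left, subst inner_diff_left, subst inner_add_left) simp
  also have "\<dots> = (\<Prod>j\<in>UNIV. \<Prod>u\<in>Basis. 2 * (?L \<bullet> axis j u))"
    unfolding Basis_vec_def
    by (subst prod.UNION_disjoint) (auto simp: axis_eq_axis UNION_singleton_eq_range prod.reindex inj_on_def intro!: prod.cong)
  also have "\<dots> = (\<Prod>j\<in>UNIV. if j = k then (2 * p)\<^sup>2 else (2 * q)\<^sup>2)"
    by (intro prod.cong) (auto simp: Basis_complex_def inner_axis box_radii_def power2_eq_square)
  also have "\<dots> = (2 * p)\<^sup>2 * ((2 * q)\<^sup>2) ^ (CARD('d) - 1)"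
    by (subst prod.remove[of _ k]) auto
  finally show ?thesis using le by (subst emeasure_lborel_cbox) auto
qed


section \<open>Carleson tents\<close>

lemma space_ball_measure [simp]: "space ball_measure = ball 0 1"
  by (simp add: ball_measure_def)

lemma sets_ball_measure: "sets ball_measure = sets (lebesgue_on (ball 0 1))"
  by (simp add: ball_measure_def)

lemma borel_sets_ball_measure:
  assumes "A \<in> sets borel" "A \<subseteq> ball 0 1"
  shows "A \<in> sets ball_measure"
  using assms by (auto simp: sets_ball_measure sets_restrict_space_iff)

lemma unit_ball_measure_pos: "0 < measure lborel (ball (0 :: 'a::euclidean_space) 1)"
  by (simp add: content_ball unit_ball_vol_pos)

lemma emeasure_ball_measure:
  fixes A :: "(complex ^ 'd) set"
  assumes "A \<in> sets borel" "A \<subseteq> ball 0 1"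
  shows "emeasure ball_measure A =
    ennreal (measure lborel A / measure lborel (ball (0 :: complex ^ 'd) 1))"
proof -
  have fin: "emeasure lborel B = ennreal (measure lborel B)"
    if "B \<subseteq> ball 0 1" for B :: "(complex ^ 'd) set"
    using emeasure_mono[OF that, of lborel] emeasure_lborel_ball_finite[of "0 :: complex ^ 'd" 1]
    by (intro emeasure_eq_ennreal_measure) (auto simp: less_top top.not_eq_extremum)
  have *: "emeasure (lebesgue_on (ball 0 1)) B = emeasure lborel B"
    if "B \<in> sets borel" "B \<subseteq> ball 0 1" for B :: "(complex ^ 'd) set"
    using that by (simp add: emeasure_restrict_space)
  have "emeasure ball_measure A = emeasure lborel A / emeasure lborel (ball (0 :: complex ^ 'd) 1)"
    unfolding ball_measure_def using assms
    by (subst emeasure_uniform_measure) (auto simp: * sets_restrict_space_iff Int_absorb1)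
  then show ?thesis
    using unit_ball_measure_pos[where 'a = "complex ^ 'd"]
    by (simp add: fin[OF assms(2)] fin[OF subset_refl] divide_ennreal)
qed

lemma measure_ball_measure:
  fixes A :: "(complex ^ 'd) set"
  assumes "A \<in> sets borel" "A \<subseteq> ball 0 1"
  shows "measure ball_measure A = measure lborel A / measure lborel (ball (0 :: complex ^ 'd) 1)"
  using emeasure_ball_measure[OF assms] by (simp add: measure_def)

lemma emeasure_unit_ball [simp]: "emeasure ball_measure (ball (0 :: complex ^ 'd) 1) = 1"
  using unit_ball_measure_pos[where 'a = "complex ^ 'd"] by (simp add: emeasure_ball_measure)

lemma finite_measure_ball_measure: "finite_measure ball_measure"
  by (rule finite_measureI) simp

lemma measure_lborel_box_vimage:
  fixes W :: "complex ^ 'd::finite \<Rightarrow> complex ^ 'd"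
  assumes "orthogonal_transformation W" "p \<ge> 0" "q \<ge> 0"
  shows "measure lborel (W -` cbox (c - box_radii k p q) (c + box_radii k p q))
    = (2 * p)\<^sup>2 * ((2 * q)\<^sup>2) ^ (CARD('d) - 1)"
  using assms
  by (simp add: measure_def emeasure_lborel_orthogonal_vimage emeasure_box_radii)

lemma borel_orthogonal_vimage:
  fixes W :: "'a::euclidean_space \<Rightarrow> 'a"
  assumes "orthogonal_transformation W" "A \<in> sets borel"
  shows "W -` A \<in> sets borel"
proof (rule measurable_sets_borel[OF _ assms(2)])
  show "W \<in> borel_measurable borel"
    using assms by (intro borel_measurable_continuous_onI linear_continuous_on)
      (simp add: linear_conv_bounded_linear[symmetric] orthogonal_transformation)
qed

text \<open>Origin of the exponent \<open>d + 1\<close>: the distinguished complex direction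
  contributes \<open>s\<^sup>2\<close> to the volume, each of the other \<open>d - 1\<close>
  contributes \<open>s\<close>.\<close>

lemma power_card_Suc: 
  fixes s :: real
  shows "s\<^sup>2 * s ^ (CARD('d::finite) - 1) = s ^ (CARD('d) + 1)"
proof -
  have "CARD('d) > 0" by simp
  then have "CARD('d) + 1 = 2 + (CARD('d) - 1)" by linarith
  then show ?thesis by (metis power_add)
qed

lemma borel_carleson_tent: "carleson_tent u \<in> sets borel"
proof -
  have "(\<lambda>\<zeta>. cinner \<zeta> v) \<in> borel_measurable borel" for v :: "complex ^ 'a"
    unfolding cinner_def by (intro borel_measurable_continuous_onI continuous_intros)
  then have [measurable]: "(\<lambda>\<zeta>. cmod (1 - cinner \<zeta> v)) \<in> borel_measurable borel" for v :: "complex ^ 'a"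
    by measurable
  have "carleson_tent u = (if u = 0 then ball 0 1 else ball 0 1 \<inter>
      {\<zeta> \<in> space borel. cmod (1 - cinner \<zeta> ((1 / norm u) *\<^sub>R u)) \<le> 1 - norm u})"
    by (auto simp: carleson_tent_def)
  also have "\<dots> \<in> sets borel" by simp
  finally show ?thesis .
qed

lemma carleson_tent_subset: "carleson_tent u \<subseteq> ball 0 1"
  by (auto simp: carleson_tent_def)

text \<open>Rotate the axis of the tent to the coordinate \<open>k\<close>. A point with
  \<open>cmod (x $ k - 1) \<le> s\<close> has \<open>cmod (x $ k) \<ge> 1 - s\<close>, so inside the
  unit ball every other coordinate has squared modulus at most
  \<open>1 - (1 - s)\<^sup>2 \<le> 2 * s\<close>. The tent therefore fits into a box of half sides
  \<open>s\<close> and \<open>sqrt (2 * s)\<close>.\<close>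

lemma measure_carleson_tent_le:
  obtains C where "C > 0" "\<And>u :: complex ^ 'd::finite. norm u < 1 \<Longrightarrow>
    measure ball_measure (carleson_tent u) \<le> C * (1 - norm u) ^ (CARD('d) + 1)"
proof -
  define V where "V = measure lborel (ball (0 :: complex ^ 'd) 1)"
  have V: "V > 0" unfolding V_def by (rule unit_ball_measure_pos)
  define c where "c = 4 * 8 ^ (CARD('d) - 1) / V"
  have "c > 0" using V by (simp add: c_def)
  \<comment> \<open>The maximum with 1 covers \<open>u = 0\<close>, where the tent is the whole
    ball, of measure 1.\<close>
  have "measure ball_measure (carleson_tent u) \<le> max 1 c * (1 - norm u) ^ (CARD('d) + 1)"
    if u1: "norm u < 1" for u :: "complex ^ 'd"
  proof (cases "u = 0")
    case True
    then show ?thesis by (simp add: carleson_tent_def measure_def)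
  next
    case False
    define e where "e = (1 / norm u) *\<^sub>R u"
    have e: "norm e = 1" using False by (simp add: e_def)
    define s where "s = 1 - norm u"
    have s: "0 < s" "s < 1" using u1 False by (auto simp: s_def)
    define k :: 'd where "k = undefined"
    obtain W where W: "orthogonal_transformation W" and We: "\<And>x. cinner x e = W x $ k"
      using orthogonal_transformation_to_axis[OF e] by blast
    define B where "B = cbox (axis k 1 - box_radii k s (sqrt (2 * s))) (axis k 1 + box_radii k s (sqrt (2 * s)))"
    have sub: "carleson_tent u \<subseteq> W -` B"
    proof
      fix \<zeta> assume "\<zeta> \<in> carleson_tent u"
      then have z1: "norm \<zeta> < 1" and z: "cmod (1 - cinner \<zeta> e) \<le> s"
        using False by (auto simp: carleson_tent_def e_def s_def)
      define x where "x = W \<zeta>"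
      have xk: "cmod (x $ k - 1) \<le> s" using z We by (simp add: x_def norm_minus_commute)
      have nx: "norm x = norm \<zeta>" using W by (simp add: x_def orthogonal_transformation)
      have "1 \<le> cmod (x $ k) + cmod (x $ k - 1)"
        by (metis norm_minus_commute norm_one norm_triangle_sub)
      then have "1 - s \<le> cmod (x $ k)" using xk by linarith
      then have "(1 - s)\<^sup>2 \<le> (cmod (x $ k))\<^sup>2" using s by (intro power_mono) auto
      have j: "cmod (x $ j) \<le> sqrt (2 * s)" if "j \<noteq> k" for j
      proof -
        have "(cmod (x $ k))\<^sup>2 + (cmod (x $ j))\<^sup>2 = (\<Sum>i\<in>{k,j}. (cmod (x $ i))\<^sup>2)"
          using that by simp
        also have "\<dots> \<le> (\<Sum>i\<in>UNIV. (cmod (x $ i))\<^sup>2)"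
          by (rule sum_mono2) auto
        also have "\<dots> = (norm x)\<^sup>2" by (simp add: norm_vec_def L2_set_def sum_nonneg)
        also have "\<dots> \<le> 1" using z1 nx by (simp add: power_le_one)
        finally have "(cmod (x $ j))\<^sup>2 \<le> 1 - (1 - s)\<^sup>2" using \<open>(1 - s)\<^sup>2 \<le> _\<close> by linarith
        also have "\<dots> \<le> 2 * s" by (simp add: power2_eq_square algebra_simps)
        finally show ?thesis by (simp add: real_le_rsqrt)
      qed
      show "\<zeta> \<in> W -` B"
        using xk j abs_Re_le_cmod[of "x $ k - 1"] abs_Im_le_cmod[of "x $ k - 1"]
          order_trans[OF abs_Re_le_cmod j] order_trans[OF abs_Im_le_cmod j]
        unfolding B_def vimage_def mem_Collect_eq mem_box_radii x_def[symmetric]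
        by (auto simp: axis_def)
    qed
    have "measure lborel (carleson_tent u) \<le> measure lborel (W -` B)"
    proof (rule measure_mono_fmeasurable[OF sub])
      show "W -` B \<in> fmeasurable lborel"
        using s unfolding B_def
        by (intro fmeasurableI)
          (auto simp: borel_orthogonal_vimage[OF W] emeasure_lborel_orthogonal_vimage[OF W] emeasure_box_radii)
    qed (simp add: borel_carleson_tent)
    also have "\<dots> = (2 * s)\<^sup>2 * ((2 * sqrt (2 * s))\<^sup>2) ^ (CARD('d) - 1)"
      unfolding B_def using s by (intro measure_lborel_box_vimage W) auto
    also have "\<dots> = 4 * 8 ^ (CARD('d) - 1) * (s\<^sup>2 * s ^ (CARD('d) - 1))"
      using s by (simp add: power_mult_distrib)
    finally have "measure lborel (carleson_tent u) \<le> 4 * 8 ^ (CARD('d) - 1) * s ^ (CARD('d) + 1)"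
      by (simp only: power_card_Suc)
    then have "measure ball_measure (carleson_tent u) \<le> c * s ^ (CARD('d) + 1)"
      using V by (simp add: measure_ball_measure borel_carleson_tent carleson_tent_subset c_def
          V_def[symmetric] divide_right_mono)
    also have "\<dots> \<le> max 1 c * s ^ (CARD('d) + 1)"
      using s by (intro mult_right_mono) auto
    finally show ?thesis by (simp add: s_def)
  qed
  then show ?thesis using that[of "max 1 c"] by simp
qed

text \<open>With \<open>r = cmod (1 - cinner z \<zeta>)\<close>, choose \<open>u\<close> on the ray
  through \<open>z\<close> with \<open>norm u = 1 - 2 * r\<close>. Then \<open>z\<close> lies in the
  tent since \<open>1 - norm z \<le> r\<close>, and \<open>\<zeta>\<close> does since replacing
  \<open>z\<close> by its direction changes the Hermitian product by at most
  \<open>1 - norm z\<close>.\<close>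

lemma common_carleson_tent:
  fixes z \<zeta> :: "complex ^ 'd"
  assumes "norm z < 1" "norm \<zeta> < 1"
  obtains u where "norm u < 1" "z \<in> carleson_tent u" "\<zeta> \<in> carleson_tent u"
    "1 - norm u \<le> 2 * cmod (1 - cinner z \<zeta>)"
proof -
  define r where "r = cmod (1 - cinner z \<zeta>)"
  have 1: "1 - norm z * norm \<zeta> \<le> r"
    using norm_triangle_ineq2[of 1 "cinner z \<zeta>"] cmod_cinner_le[of z \<zeta>] by (simp add: r_def)
  have "norm z * norm \<zeta> \<le> norm z" using assms by (simp add: mult_left_le)
  then have r: "1 - norm z \<le> r" "0 < r" using 1 assms by linarith+
  show ?thesis
  proof (cases "2 * r < 1 \<and> z \<noteq> 0")
    case True
    define e where "e = (1 / norm z) *\<^sub>R z"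
    have e: "norm e = 1" using True by (simp add: e_def)
    have ze: "z = norm z *\<^sub>R e" using True by (simp add: e_def)
    define a where "a = cinner \<zeta> e"
    have a: "cmod a \<le> 1" using cmod_cinner_le[of \<zeta> e] e assms by (simp add: a_def)
    have "cinner z \<zeta> = cnj (norm z * a)"
      by (subst ze, subst cinner_commute) (simp add: cinner_scaleR_right a_def)
    then have ra: "r = cmod (1 - norm z * a)"
      unfolding r_def by (metis complex_cnj_diff complex_cnj_one complex_mod_cnj)
    have "1 - a = (1 - norm z * a) - of_real (1 - norm z) * a" by (simp add: algebra_simps)
    then have "cmod (1 - a) \<le> r + cmod (of_real (1 - norm z) * a)"
      unfolding ra by (metis norm_triangle_ineq4)
    also have "cmod (of_real (1 - norm z) * a) = (1 - norm z) * cmod a"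
      using assms by (simp add: norm_mult del: of_real_diff)
    also have "\<dots> \<le> 1 - norm z" using a assms by (simp add: mult_left_le)
    finally have a2: "cmod (1 - a) \<le> 2 * r" using r by linarith
    define u where "u = (1 - 2 * r) *\<^sub>R e"
    have nu: "norm u = 1 - 2 * r" using True e by (simp add: u_def)
    have ue: "(1 / norm u) *\<^sub>R u = e" using True by (simp add: nu) (simp add: u_def)
    have u0: "u \<noteq> 0" using nu True by auto
    have "cinner z e = of_real (norm z)"
      by (subst ze) (simp add: cinner_scaleR_left cinner_self e)
    then have "cmod (1 - cinner z e) = 1 - norm z"
      using assms by (metis norm_of_real of_real_1 of_real_diff abs_of_pos diff_gt_0_iff_gt)
    then have "z \<in> carleson_tent u" "\<zeta> \<in> carleson_tent u"
      using assms r a2 u0 unfolding carleson_tent_def ue by (auto simp: nu a_def)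
    then show ?thesis using r nu by (intro that[of u]) (auto simp: r_def)
  next
    case False
    \<comment> \<open>If \<open>z = 0\<close> then \<open>r = 1\<close>. In either case the tent of
      0, the whole ball, meets the required size bound.\<close>
    then have "1 / 2 \<le> r" using r by (auto simp: r_def)
    then show ?thesis using assms by (intro that[of 0]) (auto simp: carleson_tent_def r_def)
  qed
qed


section \<open>Lower bounds for kubes\<close>

text \<open>The lower counterpart of \<open>measure_carleson_tent_le\<close>: a rotated box fits
  into the part of a shell near the direction \<open>e\<close>. Relative thickness
  \<open>\<tau>\<close> and aperture \<open>\<kappa>\<close> are fixed later so that this part lies
  in a kube. The bound \<open>\<tau> \<le> r\<close> keeps the radius away from 0, so that
  \<open>norm x - Re t\<close> can be estimated by dividing by \<open>norm x + Re t\<close>.\<close>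

lemma shell_region_measure:
  fixes \<tau> \<kappa> :: real
  assumes \<tau>: "0 < \<tau>" "\<tau> < 1" and \<kappa>: "0 < \<kappa>"
  obtains c where "c > 0"
    "\<And>(e :: complex ^ 'd::finite) r. norm e = 1 \<Longrightarrow> \<tau> \<le> r \<Longrightarrow> r < 1 \<Longrightarrow> \<exists>A \<in> sets borel.
      A \<subseteq> {\<zeta>. r \<le> norm \<zeta> \<and> norm \<zeta> < r + \<tau> * (1 - r) \<and>
        cmod (1 - cinner \<zeta> e / norm \<zeta>) \<le> \<kappa> * (1 - r)} \<and>
      measure lborel A = c * (1 - r) ^ (CARD('d) + 1)"
proof -
  let ?d = "real CARD('d)"
  \<comment> \<open>The three bounds serve \<open>p \<le> 1\<close>, the outer radius (with an extra
    factor 2 for a strict inequality) and the aperture.\<close>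
  define \<epsilon> where "\<epsilon> = min (1 / 2) (min (\<tau> / (2 * (2 + 1 / \<tau>))) (\<kappa> * \<tau> / (1 / \<tau> + 1)))"
  have pos: "0 < 2 + 1 / \<tau>" "0 < 1 / \<tau> + 1" using \<tau> by (auto intro: add_pos_pos)
  have \<epsilon>: "0 < \<epsilon>" "\<epsilon> \<le> 1"
    using \<tau> \<kappa> pos by (auto simp: \<epsilon>_def)
  have "\<epsilon> \<le> \<tau> / (2 * (2 + 1 / \<tau>))" by (simp add: \<epsilon>_def)
  also have "\<dots> < \<tau> / (2 + 1 / \<tau>)" using \<tau> pos by (intro divide_strict_left_mono) auto
  finally have \<epsilon>2: "\<epsilon> * (2 + 1 / \<tau>) < \<tau>" using pos by (simp add: pos_less_divide_eq)
  have "\<epsilon> \<le> \<kappa> * \<tau> / (1 / \<tau> + 1)" by (simp add: \<epsilon>_def)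
  then have \<epsilon>3: "\<epsilon> * (1 / \<tau> + 1) \<le> \<kappa> * \<tau>" using pos by (simp add: pos_le_divide_eq)
  define c where "c = 4 * \<epsilon>\<^sup>2 * (4 * (\<epsilon> / (2 * ?d))) ^ (CARD('d) - 1)"
  have "c > 0" using \<epsilon> by (simp add: c_def)
  moreover have "\<exists>A \<in> sets borel.
      A \<subseteq> {\<zeta>. r \<le> norm \<zeta> \<and> norm \<zeta> < r + \<tau> * (1 - r) \<and>
        cmod (1 - cinner \<zeta> e / norm \<zeta>) \<le> \<kappa> * (1 - r)} \<and>
      measure lborel A = c * (1 - r) ^ (CARD('d) + 1)"
    if e: "norm e = 1" and r: "\<tau> \<le> r" "r < 1" for e :: "complex ^ 'd" and r :: real
  proof -
    define h where "h = 1 - r"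
    have h: "0 < h" "h \<le> 1" using r \<tau> by (auto simp: h_def)
    have r0: "0 < r" using r \<tau> by simp
    define p where "p = \<epsilon> * h"
    \<comment> \<open>With this choice the other coordinates together contribute at most
      \<open>d * (2 * q\<^sup>2) = p\<close> to the squared norm.\<close>
    define q where "q = sqrt (\<epsilon> * h / (2 * ?d))"
    have p: "0 < p" "p \<le> 1" using \<epsilon> h by (auto simp: p_def mult_le_one)
    have q2: "q\<^sup>2 = p / (2 * ?d)" using \<epsilon> h by (simp add: q_def p_def)
    have q: "0 \<le> q" using \<epsilon> h by (simp add: q_def)
    define k :: 'd where "k = undefined"
    obtain W where W: "orthogonal_transformation W" and We: "\<And>x. cinner x e = W x $ k"
      using orthogonal_transformation_to_axis[OF e] by blast
    \<comment> \<open>Centred at \<open>r + p\<close> rather than at \<open>r\<close>: then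
      \<open>Re t \<ge> r\<close> on the whole box, which keeps it out of the open ball of radius
      \<open>r\<close>.\<close>
    define m :: "complex ^ 'd" where "m = axis k (of_real (r + p))"
    define B where "B = cbox (m - box_radii k p q) (m + box_radii k p q)"
    have "W -` B \<subseteq> {\<zeta>. r \<le> norm \<zeta> \<and> norm \<zeta> < r + \<tau> * (1 - r) \<and>
        cmod (1 - cinner \<zeta> e / norm \<zeta>) \<le> \<kappa> * (1 - r)}"
    proof
      fix \<zeta> assume "\<zeta> \<in> W -` B"
      define x where "x = W \<zeta>"
      define t where "t = x $ k"
      have nx: "norm x = norm \<zeta>" using W by (simp add: x_def orthogonal_transformation)
      have x: "\<bar>Re t - (r + p)\<bar> \<le> p" "\<bar>Im t\<bar> \<le> p"
        "\<And>j. j \<noteq> k \<Longrightarrow> \<bar>Re (x $ j)\<bar> \<le> q \<and> \<bar>Im (x $ j)\<bar> \<le> q"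
        using \<open>\<zeta> \<in> W -` B\<close>
        unfolding B_def vimage_def mem_Collect_eq mem_box_radii x_def[symmetric] t_def
        by (auto simp: m_def axis_def)
      have Ret: "r \<le> Re t" "Re t \<le> r + 2 * p" using x(1) by (auto simp: abs_le_iff)
      have "r \<le> cmod t" using Ret complex_Re_le_cmod[of t] by linarith
      also have "cmod t \<le> norm x" unfolding t_def by (rule Finite_Cartesian_Product.norm_nth_le)
      finally have rl: "r \<le> norm x" .
      have "(norm x)\<^sup>2 = (\<Sum>i\<in>UNIV. (cmod (x $ i))\<^sup>2)" by (simp add: norm_vec_def L2_set_def sum_nonneg)
      also have "\<dots> = (cmod t)\<^sup>2 + (\<Sum>i\<in>UNIV - {k}. (cmod (x $ i))\<^sup>2)"
        by (subst sum.remove[of _ k]) (auto simp: t_def)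
      also have "(\<Sum>i\<in>UNIV - {k}. (cmod (x $ i))\<^sup>2) \<le> (\<Sum>i\<in>UNIV - {k}. 2 * q\<^sup>2)"
      proof (rule sum_mono)
        fix i assume "i \<in> UNIV - {k}"
        then have "(Re (x $ i))\<^sup>2 \<le> q\<^sup>2" "(Im (x $ i))\<^sup>2 \<le> q\<^sup>2"
          using x(3)[of i] q by (auto simp: abs_le_square_iff[symmetric])
        then show "(cmod (x $ i))\<^sup>2 \<le> 2 * q\<^sup>2" by (simp add: cmod_power2)
      qed
      also have "(\<Sum>i\<in>UNIV - {k}. 2 * q\<^sup>2) \<le> ?d * (2 * q\<^sup>2)"
        by (simp add: card_Diff_singleton mult_right_mono)
      also have "?d * (2 * q\<^sup>2) = p" by (simp add: q2)
      also have "(cmod t)\<^sup>2 = (Re t)\<^sup>2 + (Im t)\<^sup>2" by (rule cmod_power2)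
      also have "(Im t)\<^sup>2 \<le> p\<^sup>2" using x(2) p by (auto simp: abs_le_square_iff[symmetric])
      also have "p\<^sup>2 \<le> p" using p by (simp add: power2_eq_square mult_left_le)
      \<comment> \<open>One \<open>p\<close> comes from the other coordinates, the second from
        \<open>(Im t)\<^sup>2 \<le> p\<^sup>2 \<le> p\<close>.\<close>
      finally have "(norm x)\<^sup>2 \<le> (Re t)\<^sup>2 + 2 * p" by simp
      then have "(norm x - Re t) * (norm x + Re t) \<le> 2 * p"
        by (simp add: power2_eq_square algebra_simps)
      moreover have "(norm x - Re t) * (2 * r) \<le> (norm x - Re t) * (norm x + Re t)"
        using rl Ret complex_Re_le_cmod[of t] \<open>cmod t \<le> norm x\<close> by (intro mult_left_mono) auto
      ultimately have "norm x - Re t \<le> p / r" using r0 by (simp add: field_simps)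
      also have "\<dots> \<le> p / \<tau>" using r \<tau> p by (intro divide_left_mono) auto
      finally have nR: "norm x - Re t \<le> p / \<tau>" .
      have "norm x \<le> r + p * (2 + 1 / \<tau>)" using nR Ret by (simp add: algebra_simps)
      also have "p * (2 + 1 / \<tau>) = \<epsilon> * (2 + 1 / \<tau>) * h" by (simp add: p_def algebra_simps)
      also have "\<dots> < \<tau> * h" using \<epsilon>2 h by (intro mult_strict_right_mono) auto
      finally have ub: "norm x < r + \<tau> * h" by simp
      have n0: "norm x > 0" using rl r0 by linarith
      have "cmod (of_real (norm x) - t) \<le> \<bar>norm x - Re t\<bar> + \<bar>Im t\<bar>"
        using cmod_le[of "of_real (norm x) - t"] by simp
      also have "\<dots> \<le> p / \<tau> + p"
        using nR x(2) complex_Re_le_cmod[of t] \<open>cmod t \<le> norm x\<close> by simp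
      also have "\<dots> = \<epsilon> * (1 / \<tau> + 1) * h" by (simp add: p_def algebra_simps)
      also have "\<dots> \<le> \<kappa> * \<tau> * h" using \<epsilon>3 h by (intro mult_right_mono) auto
      also have "\<dots> \<le> \<kappa> * norm x * h" using \<kappa> rl r h by (intro mult_right_mono mult_left_mono) auto
      finally have "cmod (of_real (norm x) - t) / norm x \<le> \<kappa> * h"
        using n0 by (simp add: field_simps)
      moreover have "1 - t / norm x = (of_real (norm x) - t) / of_real (norm x)"
        using n0 by (simp add: field_simps)
      ultimately have "cmod (1 - t / norm x) \<le> \<kappa> * h" by (simp add: norm_divide)
      then show "\<zeta> \<in> {\<zeta>. r \<le> norm \<zeta> \<and> norm \<zeta> < r + \<tau> * (1 - r) \<and>
        cmod (1 - cinner \<zeta> e / norm \<zeta>) \<le> \<kappa> * (1 - r)}"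
        using rl ub by (simp add: We nx h_def t_def x_def[symmetric])
    qed
    moreover have "measure lborel (W -` B) = c * h ^ (CARD('d) + 1)"
    proof -
      have "measure lborel (W -` B) = (2 * p)\<^sup>2 * ((2 * q)\<^sup>2) ^ (CARD('d) - 1)"
        unfolding B_def using p q by (intro measure_lborel_box_vimage W) auto
      also have "(2 * q)\<^sup>2 = 4 * (\<epsilon> / (2 * ?d)) * h"
        by (simp add: power_mult_distrib q2 p_def)
      also have "(2 * p)\<^sup>2 * (4 * (\<epsilon> / (2 * ?d)) * h) ^ (CARD('d) - 1) = c * (h\<^sup>2 * h ^ (CARD('d) - 1))"
        unfolding power_mult_distrib[of _ h] by (simp add: p_def c_def power_mult_distrib)
      finally show ?thesis by (simp only: power_card_Suc)
    qed
    moreover have "W -` B \<in> sets borel" unfolding B_def by (intro borel_orthogonal_vimage W) auto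
    ultimately show ?thesis by (auto simp: h_def)
  qed
  ultimately show ?thesis by (rule that)
qed

section \<open>Bergman distances between points of a sphere about the origin\<close>

lemma bergman_dist_less:
  fixes p w :: "complex ^ 'd"
  assumes "norm (ball_involution p w) < tanh \<delta>"
  shows "bergman_dist p w < \<delta>"
proof -
  have lt: "tanh \<delta> < (1 :: real)" by (rule tanh_real_lt_1)
  have "ball_involution p w \<in> bergman_ball 0 \<delta>" using assms by (simp add: bergman_ball_0)
  then have "artanh (norm (ball_involution p w)) < \<delta>"
    using assms lt by (auto simp: bergman_ball_def bergman_dist_0)
  then show ?thesis by (simp add: bergman_dist_def artanh_def)
qed

text \<open>Put \<open>m = cmod (1 - cinner \<eta> e)\<close>, \<open>h = 1 - r\<^sup>2\<close> and
  \<open>\<theta> = tanh \<delta>\<close>. The numerator of the involution has a component along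
  \<open>e\<close> of size at most \<open>m\<close> and an orthogonal one of size at most
  \<open>sqrt h * sqrt (2 * m)\<close>; the denominator is at least \<open>h\<close>. For
  \<open>m \<le> \<theta>\<^sup>2 / 8 * h\<close> the quotient is at most
  \<open>\<theta>\<^sup>2 / 8 + \<theta> / 2 < \<theta>\<close>, which explains the factor
  1/8.\<close>

lemma bergman_dist_sphere_less:
  fixes e \<eta> :: "complex ^ 'd"
  assumes r: "0 < r" "r < 1" and e: "norm e = 1" and \<eta>: "norm \<eta> = 1" and \<delta>: "\<delta> > 0"
    and near: "cmod (1 - cinner \<eta> e) \<le> (tanh \<delta>)\<^sup>2 / 8 * (1 - r)"
  shows "bergman_dist (r *\<^sub>R e) (r *\<^sub>R \<eta>) < \<delta>"
proof (rule bergman_dist_less)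
  define a where "a = cinner \<eta> e"
  define m where "m = cmod (1 - a)"
  have ca: "cmod a \<le> 1" using cmod_cinner_le[of \<eta> e] e \<eta> by (simp add: a_def)
  have ma: "1 - cmod a \<le> m" using norm_triangle_ineq2[of 1 a] by (simp add: m_def)
  have ee: "cinner e e = 1" using e by (simp add: cinner_self)
  have lp: "line_proj (r *\<^sub>R e) (r *\<^sub>R \<eta>) = of_real r * a *s e"
  proof -
    have "cinner (r *\<^sub>R \<eta>) (r *\<^sub>R e) / cinner (r *\<^sub>R e) (r *\<^sub>R e) = a"
      using r by (simp add: cinner_scaleR_left cinner_scaleR_right ee a_def)
    then show ?thesis
      by (simp add: line_proj_def scaleR_eq_scale vector_smult_assoc mult.commute)
  qed
  define D where "D = 1 - of_real (r\<^sup>2) * a"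
  have den: "1 - cinner (r *\<^sub>R \<eta>) (r *\<^sub>R e) = D"
    by (simp add: D_def cinner_scaleR_left cinner_scaleR_right a_def power2_eq_square)
  have r2: "r\<^sup>2 \<le> r" using r by (simp add: power2_eq_square mult_left_le)
  have "1 - r\<^sup>2 \<le> 1 - r\<^sup>2 * cmod a" using ca by (simp add: mult_left_le)
  also have "\<dots> \<le> cmod D"
    using norm_triangle_ineq2[of 1 "of_real (r\<^sup>2) * a"] by (simp add: D_def norm_mult norm_power)
  finally have D: "1 - r\<^sup>2 \<le> cmod D" .
  define h where "h = 1 - r\<^sup>2"
  have h: "0 < h" "1 - r \<le> h" using r r2 by (auto simp: h_def)
  define \<theta> where "\<theta> = tanh \<delta>"
  have \<theta>: "0 < \<theta>" "\<theta> < 1" using \<delta> tanh_real_lt_1 by (auto simp: \<theta>_def)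
  have m: "m \<le> \<theta>\<^sup>2 / 8 * h"
    using near h \<theta> by (auto simp: m_def a_def \<theta>_def intro: order_trans mult_left_mono)
  have Q: "norm (\<eta> - a *s e) \<le> sqrt (2 * m)"
  proof (rule real_le_rsqrt)
    have "(norm (\<eta> - a *s e))\<^sup>2 = 1 - (cmod a)\<^sup>2"
      using norm_diff_proj_sq[OF e, of \<eta>] \<eta> by (simp add: a_def)
    also have "\<dots> = (1 - cmod a) * (1 + cmod a)" by (simp add: power2_eq_square algebra_simps)
    also have "\<dots> \<le> m * 2" using ma ca by (intro mult_mono) (auto simp: m_def)
    finally show "(norm (\<eta> - a *s e))\<^sup>2 \<le> 2 * m" by simp
  qed
  have 1: "r *\<^sub>R e - of_real r * a *s e = (of_real r * (1 - a)) *s e"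
    by (simp add: scaleR_eq_scale vec_eq_iff algebra_simps)
  have 2: "r *\<^sub>R \<eta> - of_real r * a *s e = of_real r *s (\<eta> - a *s e)"
    by (simp add: scaleR_eq_scale vec_eq_iff algebra_simps)
  have "norm (r *\<^sub>R e - of_real r * a *s e - sqrt (1 - (norm (r *\<^sub>R e))\<^sup>2) *\<^sub>R (r *\<^sub>R \<eta> - of_real r * a *s e))
      \<le> norm (r *\<^sub>R e - of_real r * a *s e) +
        norm (sqrt (1 - (norm (r *\<^sub>R e))\<^sup>2) *\<^sub>R (r *\<^sub>R \<eta> - of_real r * a *s e))"
    by (rule norm_triangle_ineq4)
  also have "\<dots> = r * m + sqrt h * (r * norm (\<eta> - a *s e))"
  proof -
    have "norm (r *\<^sub>R e - of_real r * a *s e) = r * m"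
      unfolding 1 norm_vector_scale using r e by (simp add: norm_mult m_def)
    moreover have "norm (r *\<^sub>R \<eta> - of_real r * a *s e) = r * norm (\<eta> - a *s e)"
      unfolding 2 norm_vector_scale using r by simp
    ultimately show ?thesis using r h e by (simp add: h_def)
  qed
  also have "\<dots> \<le> 1 * m + sqrt h * (1 * sqrt (2 * m))"
    using r Q h by (intro add_mono mult_mono mult_left_mono) (auto simp: m_def)
  also have "\<dots> \<le> \<theta>\<^sup>2 / 8 * h + sqrt h * sqrt (\<theta>\<^sup>2 / 4 * h)"
    using m h by (intro add_mono mult_left_mono real_sqrt_le_mono) auto
  also have "\<dots> = (\<theta>\<^sup>2 / 8 + \<theta> / 2) * h"
    using h \<theta> by (simp add: real_sqrt_mult real_sqrt_divide algebra_simps)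
  finally have num: "norm (r *\<^sub>R e - of_real r * a *s e - sqrt (1 - (norm (r *\<^sub>R e))\<^sup>2) *\<^sub>R
      (r *\<^sub>R \<eta> - of_real r * a *s e)) \<le> (\<theta>\<^sup>2 / 8 + \<theta> / 2) * h" .
  have "norm (ball_involution (r *\<^sub>R e) (r *\<^sub>R \<eta>)) \<le> (\<theta>\<^sup>2 / 8 + \<theta> / 2) * h / cmod D"
    unfolding ball_involution_def lp den
    using num by (simp only: norm_vector_scale norm_divide) (simp add: divide_right_mono)
  also have "\<dots> \<le> (\<theta>\<^sup>2 / 8 + \<theta> / 2) * h / h"
    using D h \<theta> by (intro divide_left_mono mult_pos_pos) (auto simp: h_def)
  also have "\<dots> = \<theta>\<^sup>2 / 8 + \<theta> / 2" using h by simp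
  also have "\<theta>\<^sup>2 \<le> \<theta>" using \<theta> by (simp add: power2_eq_square mult_left_le)
  finally show "norm (ball_involution (r *\<^sub>R e) (r *\<^sub>R \<eta>)) < tanh \<delta>"
    using \<theta> unfolding \<theta>_def by linarith
qed

text \<open>Makes every shell thick relative to its distance from the unit sphere: the one from
  \<open>tanh (n * R)\<close> to \<open>tanh ((n + 1) * R)\<close> has width at least
  \<open>tanh R * (1 - tanh (n * R))\<close>. The addition formula reduces this to
  \<open>r * s * (1 - r) * (1 - s) \<ge> 0\<close>.\<close>

lemma tanh_add_ge:
  fixes x y :: real
  assumes "0 \<le> x" "0 \<le> y"
  shows "tanh x + tanh y * (1 - tanh x) \<le> tanh (x + y)"
proof -
  define r s where "r = tanh x" and "s = tanh y"
  have rs: "0 \<le> r" "r < 1" "0 \<le> s" "s < 1"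
    using assms tanh_real_lt_1 by (auto simp: r_def s_def)
  have "0 \<le> r * s" "0 \<le> r * s * s" using rs by simp_all
  then have "(r + s * (1 - r)) * (1 + r * s) \<le> r + s"
  proof -
    have "r + s - (r + s * (1 - r)) * (1 + r * s) = r * s * (1 - r) * (1 - s)" by algebra
    moreover have "0 \<le> r * s * (1 - r) * (1 - s)" using rs by simp
    ultimately show ?thesis by linarith
  qed
  then have "r + s * (1 - r) \<le> (r + s) / (1 + r * s)"
    using \<open>0 \<le> r * s\<close> by (subst pos_le_divide_eq) auto
  also have "\<dots> = tanh (x + y)"
    unfolding r_def s_def by (rule tanh_add[symmetric]) (auto simp: cosh_real_nonzero)
  finally show ?thesis by (simp add: r_def s_def)
qed

section \<open>Measurability and measure of the kubes\<close>

lemma bergman_treeD: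
  assumes "bergman_tree R \<delta> T" "(n, j) \<in> vertices T"
  shows "pt T n j \<in> bergman_sphere (real n * R)" "cell T n j \<in> sets borel"
    "bergman_ball (pt T n j) \<delta> \<inter> bergman_sphere (real n * R) \<subseteq> cell T n j"
    "cell T n j \<subseteq> bergman_sphere (real n * R)"
  using assms unfolding bergman_tree_def vertices_def mem_Collect_eq case_prod_conv by blast+

lemma cells_disjoint:
  assumes "bergman_tree R \<delta> T" "(n, i) \<in> vertices T" "(n, j) \<in> vertices T"
    "x \<in> cell T n i" "x \<in> cell T n j"
  shows "i = j"
  using assms unfolding bergman_tree_def vertices_def mem_Collect_eq case_prod_conv
  by (metis disjoint_family_onD disjoint_iff)

lemma borel_kube:
  assumes "bergman_tree R \<delta> T" "\<alpha> \<in> vertices T"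
  shows "kube R T \<alpha> \<in> sets borel"
proof -
  obtain n j where \<alpha>: "\<alpha> = (n, j)" by (cases \<alpha>)
  have [measurable]: "cell T n j \<in> sets borel"
    using bergman_treeD assms unfolding \<alpha> by blast
  have [measurable]: "(radial_proj s :: complex ^ 'a \<Rightarrow> _) \<in> borel_measurable borel" for s
    unfolding radial_proj_def by measurable
  show ?thesis
    by (cases "n = 0") (auto simp: \<alpha> kube_def bergman_ball_0)
qed

lemma kube_subset: "kube R T \<alpha> \<subseteq> ball 0 1"
  by (cases \<alpha>) (auto simp: kube_def bergman_ball_def)

text \<open>A kube contains the region of \<open>shell_region_measure\<close> around the direction
  of its point \<open>pt T n j\<close>: radially by \<open>tanh_add_ge\<close>, and in direction
  because the cell contains the part of the sphere within Bergman distance \<open>\<delta>\<close>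
  of that point. The constant precedes \<open>T\<close>, so one value serves all trees.\<close>

lemma measure_kube_ge:
  assumes R: "R > 0" and \<delta>: "\<delta> > 0"
  obtains c where "c > 0" "\<And>(T :: 'd::finite tree_data) n j. bergman_tree R \<delta> T \<Longrightarrow>
    (n, j) \<in> vertices T \<Longrightarrow>
    c * (1 - tanh (real n * R)) ^ (CARD('d) + 1) \<le> measure ball_measure (kube R T (n, j))"
proof -
  define \<tau> where "\<tau> = tanh R"
  have \<tau>: "0 < \<tau>" "\<tau> < 1" using R tanh_real_lt_1 by (auto simp: \<tau>_def)
  have \<kappa>: "0 < (tanh \<delta>)\<^sup>2 / 8" using \<delta> by simp
  obtain c where c: "c > 0" and region:
    "\<And>(e :: complex ^ 'd) r. norm e = 1 \<Longrightarrow> \<tau> \<le> r \<Longrightarrow> r < 1 \<Longrightarrow> \<exists>A \<in> sets borel.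
      A \<subseteq> {\<zeta>. r \<le> norm \<zeta> \<and> norm \<zeta> < r + \<tau> * (1 - r) \<and>
        cmod (1 - cinner \<zeta> e / norm \<zeta>) \<le> (tanh \<delta>)\<^sup>2 / 8 * (1 - r)} \<and>
      measure lborel A = c * (1 - r) ^ (CARD('d) + 1)"
    using shell_region_measure[OF \<tau> \<kappa>] by blast
  define V where "V = measure lborel (ball (0 :: complex ^ 'd) 1)"
  have V: "V > 0" unfolding V_def by (rule unit_ball_measure_pos)
  define c0 where "c0 = measure ball_measure (ball (0 :: complex ^ 'd) \<tau>)"
  have c0: "c0 > 0"
    unfolding c0_def using \<tau>
    by (subst measure_ball_measure) (auto simp: content_ball unit_ball_vol_pos[THEN less_imp_neq, symmetric])
  \<comment> \<open>\<open>c0\<close> is for the root, whose kube is a ball and for which the power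
    in the bound equals 1; \<open>c / V\<close> is for the later generations.\<close>
  define c1 where "c1 = min c0 (c / V)"
  have "c1 > 0" using c0 c V by (simp add: c1_def)
  moreover have "c1 * (1 - tanh (real n * R)) ^ (CARD('d) + 1) \<le> measure ball_measure (kube R T (n, j))"
    if T: "bergman_tree R \<delta> T" and v: "(n, j) \<in> vertices T" for T :: "'d tree_data" and n j
  proof (cases "n = 0")
    case True
    then show ?thesis by (simp add: kube_def bergman_ball_0 c1_def c0_def \<tau>_def)
  next
    case n: False
    define r where "r = tanh (real n * R)"
    have nR: "R \<le> real n * R" using n R by (simp add: mult_le_cancel_right1)
    have r: "\<tau> \<le> r" "r < 1" using nR tanh_real_lt_1 by (auto simp: r_def \<tau>_def)
    have r0: "0 < r" using r \<tau> by simp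
    define p where "p = pt T n j"
    have sph: "bergman_sphere (real n * R) = (sphere 0 r :: (complex ^ 'd) set)"
      using R by (subst bergman_sphere_eq) (auto simp: r_def)
    have p: "norm p = r" and cell: "bergman_ball p \<delta> \<inter> sphere 0 r \<subseteq> cell T n j"
      using bergman_treeD[OF T v] by (auto simp: p_def sph)
    define e where "e = (1 / r) *\<^sub>R p"
    have e: "norm e = 1" "p = r *\<^sub>R e" using p r0 by (auto simp: e_def)
    obtain A where A: "A \<in> sets borel" and mA: "measure lborel A = c * (1 - r) ^ (CARD('d) + 1)"
      and sub: "A \<subseteq> {\<zeta>. r \<le> norm \<zeta> \<and> norm \<zeta> < r + \<tau> * (1 - r) \<and>
        cmod (1 - cinner \<zeta> e / norm \<zeta>) \<le> (tanh \<delta>)\<^sup>2 / 8 * (1 - r)}"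
      using region[OF e(1) r] by blast
    have AK: "A \<subseteq> kube R T (n, j)"
    proof
      fix \<zeta> assume "\<zeta> \<in> A"
      then have z: "r \<le> norm \<zeta>" "norm \<zeta> < r + \<tau> * (1 - r)"
        "cmod (1 - cinner \<zeta> e / norm \<zeta>) \<le> (tanh \<delta>)\<^sup>2 / 8 * (1 - r)"
        using sub by auto
      have n0: "0 < norm \<zeta>" using z r0 by linarith
      define \<eta> where "\<eta> = (1 / norm \<zeta>) *\<^sub>R \<zeta>"
      have \<eta>: "norm \<eta> = 1" using n0 by (simp add: \<eta>_def)
      have "r + \<tau> * (1 - r) \<le> tanh (real (n + 1) * R)"
        using tanh_add_ge[of "real n * R" R] R by (simp add: r_def \<tau>_def algebra_simps)
      then have 1: "\<zeta> \<in> bergman_ball 0 (real (n + 1) * R) - bergman_ball 0 (real n * R)"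
        using z by (simp add: bergman_ball_0 r_def)
      have "bergman_dist p (r *\<^sub>R \<eta>) < \<delta>"
        unfolding e(2) using z(3)
        by (intro bergman_dist_sphere_less r0 r e \<eta> \<delta>) (simp add: \<eta>_def cinner_scaleR_left)
      moreover have "norm (r *\<^sub>R \<eta>) = r" using \<eta> r0 by simp
      ultimately have "r *\<^sub>R \<eta> \<in> cell T n j"
        using cell r by (auto simp: bergman_ball_def)
      moreover have "radial_proj (real n * R) \<zeta> = r *\<^sub>R \<eta>"
        by (simp add: radial_proj_def r_def \<eta>_def)
      ultimately show "\<zeta> \<in> kube R T (n, j)"
        using 1 n by (simp add: kube_def)
    qed
    interpret finite_measure "ball_measure :: (complex ^ 'd) measure"
      by (rule finite_measure_ball_measure)
    have Ab: "A \<subseteq> ball 0 1" using AK kube_subset by (rule subset_trans)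
    have "c1 * (1 - r) ^ (CARD('d) + 1) \<le> c / V * (1 - r) ^ (CARD('d) + 1)"
      using r by (intro mult_right_mono) (auto simp: c1_def)
    also have "\<dots> = measure ball_measure A"
      by (simp add: measure_ball_measure[OF A Ab] mA V_def)
    also have "\<dots> \<le> measure ball_measure (kube R T (n, j))"
      by (intro finite_measure_mono AK borel_sets_ball_measure borel_kube[OF T v] kube_subset)
    finally show ?thesis by (simp add: r_def)
  qed
  ultimately show ?thesis by (rule that)
qed


section \<open>The tree structure of dyadic tents\<close>

lemma kube_norm_bounds:
  assumes "x \<in> kube R T (n, j)"
  shows "tanh (real n * R) \<le> norm x" "norm x < tanh (real (n + 1) * R)"
  using assms by (auto simp: kube_def bergman_ball_0 split: if_splits)

text \<open>Different generations occupy disjoint shells; within a generation the cells separate the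
  kubes.\<close>

lemma kubes_disjoint:
  assumes R: "R > 0" and \<delta>: "\<delta> > 0" and T: "bergman_tree R \<delta> T"
    and v: "\<alpha> \<in> vertices T" "\<beta> \<in> vertices T" and x: "x \<in> kube R T \<alpha>" "x \<in> kube R T \<beta>"
  shows "\<alpha> = \<beta>"
proof -
  obtain n i m j where ab: "\<alpha> = (n, i)" "\<beta> = (m, j)" by (cases \<alpha>, cases \<beta>)
  have "tanh (real n * R) < tanh (real (m + 1) * R)" "tanh (real m * R) < tanh (real (n + 1) * R)"
    using kube_norm_bounds x unfolding ab by (blast intro: le_less_trans)+
  then have "real n < real (m + 1)" "real m < real (n + 1)"
    using R by (simp_all only: tanh_real_less_iff mult_less_cancel_right_pos)
  then have nm: "m = n" by simp
  have "i = j"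
  proof (cases "n = 0")
    case True
    \<comment> \<open>The kube of generation 0 ignores its cell. That this generation has a single
      vertex follows from its cells being disjoint and all containing 0, the centre of a ball of
      radius \<open>\<delta> > 0\<close>.\<close>
    have "0 \<in> cell T n k" if "(n, k) \<in> vertices T" for k
    proof -
      have "pt T n k = 0" using bergman_treeD(1)[OF T that] True by (simp add: bergman_sphere_def)
      then show ?thesis
        using bergman_treeD(3)[OF T that] True \<delta> by (simp add: bergman_ball_0 bergman_sphere_def)
    qed
    then show ?thesis using cells_disjoint[OF T] v unfolding ab nm by blast
  next
    case False
    then show ?thesis using cells_disjoint[OF T] v x unfolding ab nm by (auto simp: kube_def)
  qed
  then show ?thesis using ab nm by simp
qed

text \<open>Unique parents make the ancestors of a vertex a chain, which turns a common point of two
  tents into an inclusion.\<close>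

lemma single_valued_parent:
  assumes R: "R > 0" and \<delta>: "\<delta> > 0" and T: "bergman_tree R \<delta> T"
  shows "single_valued ((child_rel R T)\<inverse>)"
proof (rule single_valuedI, unfold converse_iff)
  fix \<gamma> \<alpha> \<beta> assume "(\<alpha>, \<gamma>) \<in> child_rel R T" "(\<beta>, \<gamma>) \<in> child_rel R T"
  then obtain n k m i where *: "\<alpha> = (n, k)" "\<beta> = (n, m)" "(n, k) \<in> vertices T" "(n, m) \<in> vertices T"
    "n = 0 \<or> radial_proj (real n * R) (center R T (Suc n, i)) \<in> cell T n k \<and>
       radial_proj (real n * R) (center R T (Suc n, i)) \<in> cell T n m"
    unfolding child_rel_def by auto
  show "\<alpha> = \<beta>"
  proof (cases "n = 0")
    case True
    \<comment> \<open>Below the root \<open>child_rel\<close> imposes no condition on cells;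
      disjointness of the kubes, tested at the point 0, replaces it.\<close>
    have "0 \<in> kube R T \<alpha>" "0 \<in> kube R T \<beta>"
      using True R by (simp_all add: * kube_def bergman_ball_0)
    then show ?thesis using kubes_disjoint[OF R \<delta> T] * by blast
  next
    case False
    then show ?thesis using * cells_disjoint[OF T] by blast
  qed
qed

lemma descendantD:
  assumes "(\<alpha>, \<beta>) \<in> (child_rel R T)\<^sup>*" "\<alpha> \<in> vertices T"
  shows "\<beta> \<in> vertices T \<and> fst \<alpha> \<le> fst \<beta>"
  using assms by (induction rule: rtrancl_induct) (auto simp: child_rel_def)

lemma dyadic_tent_antimono:
  assumes "(\<alpha>, \<beta>) \<in> (child_rel R T)\<^sup>*"
  shows "dyadic_tent R T \<beta> \<subseteq> dyadic_tent R T \<alpha>"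
  using rtrancl_trans[OF assms] unfolding dyadic_tent_def by blast

text \<open>A common point lies in exactly one kube, whose vertex descends from both
  \<open>\<alpha>\<close> and \<open>\<beta>\<close>; two ancestors of the same vertex are
  comparable.\<close>

lemma dyadic_tents_laminar:
  assumes R: "R > 0" and \<delta>: "\<delta> > 0" and T: "bergman_tree R \<delta> T"
    and v: "\<alpha> \<in> vertices T" "\<beta> \<in> vertices T"
  shows "dyadic_tent R T \<alpha> \<inter> dyadic_tent R T \<beta> = {} \<or>
    dyadic_tent R T \<alpha> \<subseteq> dyadic_tent R T \<beta> \<or> dyadic_tent R T \<beta> \<subseteq> dyadic_tent R T \<alpha>"
proof -
  have "dyadic_tent R T \<alpha> \<subseteq> dyadic_tent R T \<beta> \<or> dyadic_tent R T \<beta> \<subseteq> dyadic_tent R T \<alpha>"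
    if x: "x \<in> dyadic_tent R T \<alpha>" "x \<in> dyadic_tent R T \<beta>" for x
  proof -
    obtain \<gamma> where \<gamma>: "(\<alpha>, \<gamma>) \<in> (child_rel R T)\<^sup>*" "x \<in> kube R T \<gamma>"
      using x(1) unfolding dyadic_tent_def by blast
    obtain \<gamma>' where \<gamma>': "(\<beta>, \<gamma>') \<in> (child_rel R T)\<^sup>*" "x \<in> kube R T \<gamma>'"
      using x(2) unfolding dyadic_tent_def by blast
    have "\<gamma>' = \<gamma>"
      using kubes_disjoint[OF R \<delta> T _ _ \<gamma>'(2) \<gamma>(2)] descendantD[OF \<gamma>(1) v(1)] descendantD[OF \<gamma>'(1) v(2)]
      by simp
    with \<gamma> \<gamma>' have "(\<gamma>, \<alpha>) \<in> ((child_rel R T)\<inverse>)\<^sup>*" "(\<gamma>, \<beta>) \<in> ((child_rel R T)\<inverse>)\<^sup>*"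
      by (simp_all add: rtrancl_converse)
    from single_valued_confluent[OF single_valued_parent[OF R \<delta> T] this]
    have "(\<beta>, \<alpha>) \<in> (child_rel R T)\<^sup>* \<or> (\<alpha>, \<beta>) \<in> (child_rel R T)\<^sup>*"
      by (simp add: rtrancl_converse)
    then show ?thesis using dyadic_tent_antimono by blast
  qed
  then show ?thesis by blast
qed

lemma borel_dyadic_tent:
  assumes "bergman_tree R \<delta> T" "\<alpha> \<in> vertices T"
  shows "dyadic_tent R T \<alpha> \<in> sets borel"
proof -
  have "kube R T \<beta> \<in> sets borel" if "(\<alpha>, \<beta>) \<in> (child_rel R T)\<^sup>*" for \<beta>
    using borel_kube[OF assms(1)] descendantD[OF that assms(2)] by blast
  then show ?thesis
    unfolding dyadic_tent_def by (intro sets.countable_UN') (simp_all add: image_subset_iff)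
qed

lemma dyadic_tent_subset: "dyadic_tent R T \<alpha> \<subseteq> ball 0 1"
  unfolding dyadic_tent_def using kube_subset by blast

lemma kube_subset_dyadic_tent: "kube R T \<alpha> \<subseteq> dyadic_tent R T \<alpha>"
  unfolding dyadic_tent_def by blast

lemma norm_dyadic_tent_ge:
  assumes R: "R > 0" and v: "\<alpha> \<in> vertices T" and x: "x \<in> dyadic_tent R T \<alpha>"
  shows "tanh (real (fst \<alpha>) * R) \<le> norm x"
proof -
  obtain \<gamma> where \<gamma>: "(\<alpha>, \<gamma>) \<in> (child_rel R T)\<^sup>*" "x \<in> kube R T \<gamma>"
    using x by (auto simp: dyadic_tent_def)
  have "real (fst \<alpha>) * R \<le> real (fst \<gamma>) * R"
    using descendantD[OF \<gamma>(1) v] R by (intro mult_right_mono) auto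
  then have "tanh (real (fst \<alpha>) * R) \<le> tanh (real (fst \<gamma>) * R)" by simp
  also have "\<dots> \<le> norm x" using kube_norm_bounds(1)[of x R T "fst \<gamma>" "snd \<gamma>"] \<gamma> by simp
  finally show ?thesis .
qed

section \<open>Laminar and sparse families of tents\<close>

definition laminar :: "'a set set \<Rightarrow> bool" where
  "laminar \<K> \<longleftrightarrow> (\<forall>K\<in>\<K>. \<forall>L\<in>\<K>. K \<inter> L = {} \<or> K \<subseteq> L \<or> L \<subseteq> K)"

definition sparse_family :: "'a measure \<Rightarrow> real \<Rightarrow> 'a set set \<Rightarrow> bool" where
  "sparse_family M c \<K> \<longleftrightarrow> (\<exists>E. disjoint_family_on E \<K> \<and>
     (\<forall>K\<in>\<K>. E K \<in> sets M \<and> E K \<subseteq> K \<and> 0 < measure M (E K) \<and> measure M K \<le> c * measure M (E K)))"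

text \<open>Only tents comparable in measure to their top kube are kept. A tent covering a Carleson
  tent \<open>T\<^sub>u\<close> qualifies because \<open>u\<close> itself lies in it, which bounds its generation from above;
  so the geometry of the descendants never matters.\<close>

definition fat_tents :: "real \<Rightarrow> real \<Rightarrow> 'd::finite tree_data \<Rightarrow> (complex ^ 'd) set set" where
  "fat_tents c R T = {K. \<exists>\<alpha>\<in>vertices T. K = dyadic_tent R T \<alpha> \<and>
     measure ball_measure K \<le> c * measure ball_measure (kube R T \<alpha>)}"

lemma fat_tents_subset: "fat_tents c R T \<subseteq> dyadic_tent R T ` vertices T"
  by (auto simp: fat_tents_def)

lemma countable_fat_tents: "countable (fat_tents c R T)"
  using fat_tents_subset by (rule countable_subset) auto

lemma laminar_fat_tents:
  assumes "R > 0" "\<delta> > 0" "bergman_tree R \<delta> T"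
  shows "laminar (fat_tents c R T)"
  using dyadic_tents_laminar[OF assms] unfolding laminar_def fat_tents_def by blast

lemma sparse_fat_tents:
  assumes R: "R > 0" and \<delta>: "\<delta> > 0" and T: "bergman_tree R \<delta> T"
  shows "sparse_family ball_measure c (fat_tents c R T)"
proof -
  obtain b where b: "b > 0" "\<And>n j. (n, j) \<in> vertices T \<Longrightarrow>
      b * (1 - tanh (real n * R)) ^ (CARD('a) + 1) \<le> measure ball_measure (kube R T (n, j))"
    using measure_kube_ge[OF R \<delta>] T by metis
  have pos: "0 < measure ball_measure (kube R T \<alpha>)" if "\<alpha> \<in> vertices T" for \<alpha>
  proof -
    obtain n j where \<alpha>: "\<alpha> = (n, j)" by (cases \<alpha>)
    have "0 < b * (1 - tanh (real n * R)) ^ (CARD('a) + 1)"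
      using b(1) tanh_real_lt_1[of "real n * R"] by simp
    also have "\<dots> \<le> measure ball_measure (kube R T \<alpha>)" using b(2) that unfolding \<alpha> by blast
    finally show ?thesis .
  qed
  \<comment> \<open>The family consists of sets, so a top vertex has to be chosen for each of them.
    Equal top vertices give equal tents, hence distinct tents have disjoint top kubes.\<close>
  define top where "top K = (SOME \<alpha>. \<alpha> \<in> vertices T \<and> K = dyadic_tent R T \<alpha> \<and>
    measure ball_measure K \<le> c * measure ball_measure (kube R T \<alpha>))" for K
  have top: "top K \<in> vertices T \<and> K = dyadic_tent R T (top K) \<and>
    measure ball_measure K \<le> c * measure ball_measure (kube R T (top K))" if "K \<in> fat_tents c R T" for K
    unfolding top_def by (rule someI_ex) (use that in \<open>auto simp: fat_tents_def\<close>)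
  have "disjoint_family_on (\<lambda>K. kube R T (top K)) (fat_tents c R T)"
    unfolding disjoint_family_on_def using top kubes_disjoint[OF R \<delta> T] by (metis disjoint_iff)
  moreover have "kube R T (top K) \<in> sets ball_measure \<and> kube R T (top K) \<subseteq> K \<and>
      0 < measure ball_measure (kube R T (top K)) \<and>
      measure ball_measure K \<le> c * measure ball_measure (kube R T (top K))"
    if "K \<in> fat_tents c R T" for K
    using top[OF that] pos kube_subset_dyadic_tent
    by (metis borel_kube[OF T] borel_sets_ball_measure kube_subset)
  ultimately show ?thesis unfolding sparse_family_def by blast
qed

text \<open>Let \<open>s = 1 - norm u\<close> for a Carleson tent of \<open>u\<close> containing
  both points. The covering tent has measure at most \<open>b * C * s ^ (d + 1)\<close>, its top
  kube at least \<open>a * s ^ (d + 1)\<close>, and \<open>s\<close> is at most twice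
  \<open>cmod (1 - cinner z \<zeta>)\<close>.\<close>

lemma fat_tent_kernel_bound:
  fixes T :: "nat \<Rightarrow> 'd::finite tree_data"
  assumes R: "R > 0" and \<delta>: "\<delta> > 0"
    and T: "\<And>l. l \<in> {1..N} \<Longrightarrow> bergman_tree R \<delta> (T l)"
    and covers: "covers_carleson_tents (dyadic_tents R N T)"
  obtains c where "c > 0" "\<And>z \<zeta>. norm z < 1 \<Longrightarrow> norm \<zeta> < 1 \<Longrightarrow>
    \<exists>l\<in>{1..N}. \<exists>K\<in>fat_tents c R (T l). z \<in> K \<and> \<zeta> \<in> K \<and>
      cmod (bergman_kernel z \<zeta>) * measure ball_measure K \<le> c"
proof -
  let ?D = "CARD('d) + 1"
  obtain b where b: "b > 0" "\<And>u. norm u < 1 \<Longrightarrow> \<exists>K\<in>dyadic_tents R N T. carleson_tent u \<subseteq> K \<and>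
      measure ball_measure K \<le> b * measure ball_measure (carleson_tent u)"
    using covers unfolding covers_carleson_tents_def by (auto simp: Ball_def) blast
  obtain C where C: "C > 0" "\<And>u :: complex ^ 'd. norm u < 1 \<Longrightarrow>
      measure ball_measure (carleson_tent u) \<le> C * (1 - norm u) ^ ?D"
    using measure_carleson_tent_le by blast
  obtain a where a: "a > 0" "\<And>(T :: 'd tree_data) n j. bergman_tree R \<delta> T \<Longrightarrow> (n, j) \<in> vertices T \<Longrightarrow>
      a * (1 - tanh (real n * R)) ^ ?D \<le> measure ball_measure (kube R T (n, j))"
    using measure_kube_ge[OF R \<delta>] by blast
  \<comment> \<open>The first entry makes the covering tent fat, the second bounds the kernel times
    the measure of the tent. One constant serves both purposes.\<close>
  define c where "c = max (b * C / a) (b * C * 2 ^ ?D)"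
  have "c > 0" using a b C by (simp add: c_def less_max_iff_disj)
  moreover have "\<exists>l\<in>{1..N}. \<exists>K\<in>fat_tents c R (T l). z \<in> K \<and> \<zeta> \<in> K \<and>
      cmod (bergman_kernel z \<zeta>) * measure ball_measure K \<le> c"
    if z: "norm z < 1" "norm \<zeta> < 1" for z \<zeta>
  proof -
    obtain u where u: "norm u < 1" "z \<in> carleson_tent u" "\<zeta> \<in> carleson_tent u"
        "1 - norm u \<le> 2 * cmod (1 - cinner z \<zeta>)"
      using common_carleson_tent[OF z] by blast
    obtain K where K: "K \<in> dyadic_tents R N T" "carleson_tent u \<subseteq> K"
        "measure ball_measure K \<le> b * measure ball_measure (carleson_tent u)"
      using b(2)[OF u(1)] by blast
    have mK: "measure ball_measure K \<le> b * C * (1 - norm u) ^ ?D"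
      using order_trans[OF K(3) mult_left_mono[OF C(2)[OF u(1)]]] b(1) by (simp add: mult.assoc)
    obtain l n j where l: "l \<in> {1..N}" and v: "(n, j) \<in> vertices (T l)" and KT: "K = dyadic_tent R (T l) (n, j)"
      using K(1) by (auto simp: dyadic_tents_def)
    have "u \<in> carleson_tent u"
    proof (cases "u = 0")
      case False
      then have "cinner u ((1 / norm u) *\<^sub>R u) = of_real (norm u)"
        by (simp add: cinner_scaleR_right cinner_self power2_eq_square)
      then have "cmod (1 - cinner u ((1 / norm u) *\<^sub>R u)) = 1 - norm u"
        using u(1) by (metis norm_of_real of_real_1 of_real_diff abs_of_pos diff_gt_0_iff_gt)
      then show ?thesis using False u(1) by (simp add: carleson_tent_def)
    qed (simp add: carleson_tent_def)
    then have "u \<in> K" using K(2) by blast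
    then have "tanh (real n * R) \<le> norm u"
      using norm_dyadic_tent_ge[OF R v, of u] by (simp add: KT)
    then have "(1 - norm u) ^ ?D \<le> (1 - tanh (real n * R)) ^ ?D"
      using u(1) by (intro power_mono) auto
    then have "a * (1 - norm u) ^ ?D \<le> measure ball_measure (kube R (T l) (n, j))"
      using a(2)[OF T[OF l] v] a(1) by (meson mult_left_mono order_trans less_imp_le)
    then have "b * C / a * (a * (1 - norm u) ^ ?D) \<le> b * C / a * measure ball_measure (kube R (T l) (n, j))"
      using a b C by (intro mult_left_mono) auto
    then have "measure ball_measure K \<le> b * C / a * measure ball_measure (kube R (T l) (n, j))"
      using mK a(1) by simp
    also have "\<dots> \<le> c * measure ball_measure (kube R (T l) (n, j))"
      by (intro mult_right_mono) (auto simp: c_def)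
    finally have fat: "K \<in> fat_tents c R (T l)"
      unfolding fat_tents_def using v KT by blast
    define r where "r = cmod (1 - cinner z \<zeta>)"
    have r: "r > 0" using u(1,4) by (auto simp: r_def)
    have "(1 - norm u) ^ ?D \<le> (2 * r) ^ ?D"
      using u(1,4) by (intro power_mono) (auto simp: r_def)
    then have "b * C * (1 - norm u) ^ ?D \<le> b * C * (2 * r) ^ ?D"
      using b C by (intro mult_left_mono) auto
    then have "measure ball_measure K \<le> b * C * (2 * r) ^ ?D"
      using mK by (rule order_trans[rotated])
    then have "measure ball_measure K \<le> b * C * 2 ^ ?D * r ^ ?D"
      by (simp only: power_mult_distrib mult.assoc)
    moreover have "cmod (bergman_kernel z \<zeta>) = 1 / r ^ ?D"
      by (simp add: bergman_kernel_def norm_divide norm_power norm_mult r_def)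
    ultimately have "cmod (bergman_kernel z \<zeta>) * measure ball_measure K \<le>
        1 / r ^ ?D * (b * C * 2 ^ ?D * r ^ ?D)"
      using r by (metis mult_left_mono zero_le_divide_1_iff zero_le_power less_imp_le)
    also have "\<dots> = b * C * 2 ^ ?D" using r by simp
    finally have "cmod (bergman_kernel z \<zeta>) * measure ball_measure K \<le> b * C * 2 ^ ?D" .
    then have "cmod (bergman_kernel z \<zeta>) * measure ball_measure K \<le> c" by (simp add: c_def)
    with fat l u K(2) show ?thesis by blast
  qed
  ultimately show ?thesis by (rule that)
qed

text \<open>The Carleson tent of 0 can only be covered by the ball itself. A finite bump thereby
  controls both weights on the whole ball, which makes the weighted measures finite.\<close>

lemma unit_ball_in_tents:
  assumes "covers_carleson_tents (dyadic_tents R N T)"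
  shows "ball 0 1 \<in> dyadic_tents R N T"
proof -
  obtain K where K: "K \<in> dyadic_tents R N T" "carleson_tent 0 \<subseteq> K"
    using assms unfolding covers_carleson_tents_def by (meson centre_in_ball zero_less_one)
  moreover have "K \<subseteq> ball 0 1" using K(1) dyadic_tent_subset unfolding dyadic_tents_def by blast
  ultimately have "K = ball 0 1" by (auto simp: carleson_tent_def)
  with K show ?thesis by simp
qed


section \<open>The Carleson embedding theorem\<close>

lemma ennreal_mult_divide_cancel:
  fixes a b :: ennreal
  assumes "b \<noteq> 0" "b < \<infinity>"
  shows "a / b * b = a"
  using assms by (simp add: ennreal_divide_times ennreal_divide_self less_top[symmetric])

lemma sum_nn_integral_disjoint_le:
  assumes fin: "finite \<K>" and dis: "\<And>K L. K \<in> \<K> \<Longrightarrow> L \<in> \<K> \<Longrightarrow> K \<noteq> L \<Longrightarrow> K \<inter> L = {}"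
    and sets: "\<K> \<subseteq> sets M" and h: "h \<in> borel_measurable M"
  shows "(\<Sum>K\<in>\<K>. \<integral>\<^sup>+x\<in>K. h x \<partial>M) \<le> (\<integral>\<^sup>+x. h x \<partial>M)"
proof -
  have "(\<Sum>K\<in>\<K>. \<integral>\<^sup>+x\<in>K. h x \<partial>M) = (\<integral>\<^sup>+x. (\<Sum>K\<in>\<K>. h x * indicator K x) \<partial>M)"
    using sets h by (intro nn_integral_sum[symmetric] borel_measurable_times_ennreal) auto
  also have "\<dots> \<le> (\<integral>\<^sup>+x. h x \<partial>M)"
  proof (rule nn_integral_mono)
    fix x
    have "(\<Sum>K\<in>\<K>. indicator K x) = (indicator (\<Union>K\<in>\<K>. K) x :: ennreal)"
      by (rule indicator_UN_disjoint[symmetric]) (use fin dis in \<open>auto simp: disjoint_family_on_def\<close>)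
    then show "(\<Sum>K\<in>\<K>. h x * indicator K x) \<le> h x"
      by (simp add: sum_distrib_left[symmetric] mult_left_le[of _ "h x"] indicator_def)
  qed
  finally show ?thesis .
qed

text \<open>Layer cake over the level \<open>t\<close> of the averages: the sets with average at least \<open>t\<close> are
  collected under the maximal ones, which are disjoint, and on these the part of \<open>f\<close> below \<open>t / 2\<close>
  contributes at most half of the average.\<close>

lemma carleson_level_bound:
  fixes f :: "'a \<Rightarrow> real" and a :: "'a set \<Rightarrow> ennreal"
  assumes f[measurable]: "f \<in> borel_measurable M" and f0: "\<And>x. 0 \<le> f x"
    and fin: "finite \<K>" and lam: "laminar \<K>" and sets: "\<K> \<subseteq> sets M"
    and mK: "\<And>K. K \<in> \<K> \<Longrightarrow> emeasure M K < \<infinity>"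
    and car: "\<And>K. K \<in> \<K> \<Longrightarrow> (\<Sum>L\<in>{L\<in>\<K>. L \<subseteq> K}. a L) \<le> A * emeasure M K"
    and fK: "\<And>K. K \<in> \<K> \<Longrightarrow> (\<integral>\<^sup>+x\<in>K. f x \<partial>M) < \<infinity>"
    and t: "0 < t"
  shows "t * (\<Sum>K\<in>{K\<in>\<K>. ennreal t * emeasure M K \<le> (\<integral>\<^sup>+x\<in>K. f x \<partial>M)}. a K)
    \<le> 2 * A * (\<integral>\<^sup>+x. ennreal (f x) * indicator {x. t \<le> 2 * f x} x \<partial>M)"
proof -
  define G where "G = {K\<in>\<K>. ennreal t * emeasure M K \<le> (\<integral>\<^sup>+x\<in>K. f x \<partial>M)}"
  define X where "X = {L\<in>G. \<forall>K\<in>G. L \<subseteq> K \<longrightarrow> L = K}"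
  define h where "h x = ennreal (f x) * indicator {x. t \<le> 2 * f x} x" for x
  have [measurable]: "h \<in> borel_measurable M"
  proof -
    have "h = (\<lambda>x. if t \<le> 2 * f x then ennreal (f x) else 0)" by (auto simp: h_def)
    then show ?thesis by simp
  qed
  have finG: "finite G" "finite X" using fin by (auto simp: G_def X_def)
  have sub: "G \<subseteq> \<K>" "X \<subseteq> G" by (auto simp: G_def X_def)
  have max: "\<exists>L\<in>X. K \<subseteq> L" if K: "K \<in> G" for K
  proof -
    obtain L where "L \<in> G" "K \<subseteq> L" "\<forall>b\<in>G. L \<subseteq> b \<longrightarrow> L = b"
      using finite_has_maximal2[OF finG(1) K] by auto
    then show ?thesis by (auto simp: X_def)
  qed
  \<comment> \<open>Each \<open>K\<close> in \<open>G\<close> is charged to every maximal set above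
    it; finiteness of the family guarantees at least one.\<close>
  have "(\<Sum>K\<in>G. a K) \<le> (\<Sum>K\<in>G. \<Sum>L\<in>X. if K \<subseteq> L then a K else 0)"
  proof (rule sum_mono)
    fix K assume "K \<in> G"
    then obtain L where L: "L \<in> X" "K \<subseteq> L" using max by blast
    have "a K = (if K \<subseteq> L then a K else 0)" using L by simp
    also have "\<dots> \<le> (\<Sum>L\<in>X. if K \<subseteq> L then a K else 0)"
      using L finG by (intro member_le_sum) auto
    finally show "a K \<le> (\<Sum>L\<in>X. if K \<subseteq> L then a K else 0)" .
  qed
  also have "\<dots> = (\<Sum>L\<in>X. \<Sum>K\<in>G. if K \<subseteq> L then a K else 0)" by (rule sum.swap)
  also have "\<dots> \<le> (\<Sum>L\<in>X. A * emeasure M L)"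
  proof (rule sum_mono)
    fix L assume "L \<in> X"
    have "(\<Sum>K\<in>G. if K \<subseteq> L then a K else 0) \<le> (\<Sum>K\<in>\<K>. if K \<subseteq> L then a K else 0)"
      using fin sub by (intro sum_mono2) auto
    also have "\<dots> = (\<Sum>K\<in>{K\<in>\<K>. K \<subseteq> L}. a K)"
      using fin by (simp add: sum.inter_filter)
    also have "\<dots> \<le> A * emeasure M L" using \<open>L \<in> X\<close> sub by (intro car) auto
    finally show "(\<Sum>K\<in>G. if K \<subseteq> L then a K else 0) \<le> A * emeasure M L" .
  qed
  finally have 1: "(\<Sum>K\<in>G. a K) \<le> (\<Sum>L\<in>X. A * emeasure M L)" .
  have half: "ennreal t * emeasure M L \<le> 2 * (\<integral>\<^sup>+x\<in>L. h x \<partial>M)" if "L \<in> X" for L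
  proof -
    have L: "L \<in> \<K>" "ennreal t * emeasure M L \<le> (\<integral>\<^sup>+x\<in>L. f x \<partial>M)"
      using that by (auto simp: X_def G_def)
    have Ls[measurable]: "L \<in> sets M" using L sets by auto
    have "(\<integral>\<^sup>+x\<in>L. f x \<partial>M) \<le> (\<integral>\<^sup>+x. h x * indicator L x + ennreal (t / 2) * indicator L x \<partial>M)"
      using f0 t by (intro nn_integral_mono) (auto simp: h_def indicator_def ennreal_leI)
    also have "\<dots> = (\<integral>\<^sup>+x\<in>L. h x \<partial>M) + ennreal (t / 2) * emeasure M L"
      by (subst nn_integral_add) (auto simp: nn_integral_cmult_indicator)
    finally have "ennreal t * emeasure M L \<le> (\<integral>\<^sup>+x\<in>L. h x \<partial>M) + ennreal (t / 2) * emeasure M L"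
      using L by simp
    \<comment> \<open>Absorbing \<open>t / 2\<close> times the measure of \<open>L\<close> into the
      left-hand side is legitimate only for finite values, hence the passage to real
      numbers.\<close>
    moreover have "(\<integral>\<^sup>+x\<in>L. h x \<partial>M) < \<infinity>"
      by (rule le_less_trans[OF _ fK[OF L(1)]]) (auto intro!: nn_integral_mono simp: h_def indicator_def)
    ultimately obtain i where i: "0 \<le> i" "(\<integral>\<^sup>+x\<in>L. h x \<partial>M) = ennreal i"
      and le: "ennreal t * emeasure M L \<le> ennreal i + ennreal (t / 2) * emeasure M L"
      by (metis ennreal_cases infinity_ennreal_def less_irrefl)
    obtain m where m: "0 \<le> m" "emeasure M L = ennreal m"
      using mK[OF L(1)] by (metis ennreal_cases infinity_ennreal_def less_irrefl)
    have "ennreal (t * m) \<le> ennreal (i + t / 2 * m)"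
      using le t i m
      by (simp add: ennreal_mult[symmetric] ennreal_plus[symmetric] del: ennreal_plus)
    then have "t * m \<le> i + t / 2 * m" using t i m by (subst (asm) ennreal_le_iff) auto
    then have "t * m \<le> 2 * i" by simp
    then have "ennreal (t * m) \<le> ennreal (2 * i)" by (rule ennreal_leI)
    then show ?thesis using t i m by (simp add: ennreal_mult)
  qed
  have "ennreal t * (\<Sum>K\<in>G. a K) \<le> ennreal t * (\<Sum>L\<in>X. A * emeasure M L)"
    using 1 by (rule mult_left_mono) simp
  also have "\<dots> = A * (\<Sum>L\<in>X. ennreal t * emeasure M L)"
    by (simp add: sum_distrib_left mult_ac)
  also have "\<dots> \<le> A * (\<Sum>L\<in>X. 2 * (\<integral>\<^sup>+x\<in>L. h x \<partial>M))"
    using half by (intro mult_left_mono sum_mono) auto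
  also have "\<dots> = 2 * A * (\<Sum>L\<in>X. (\<integral>\<^sup>+x\<in>L. h x \<partial>M))"
    by (simp add: sum_distrib_left mult_ac)
  also have "\<dots> \<le> 2 * A * (\<integral>\<^sup>+x. h x \<partial>M)"
  proof (intro mult_left_mono sum_nn_integral_disjoint_le)
    show "K \<inter> L = {}" if "K \<in> X" "L \<in> X" "K \<noteq> L" for K L
    proof -
      have KL: "K \<in> G" "L \<in> G" and max: "K \<subseteq> L \<Longrightarrow> K = L" "L \<subseteq> K \<Longrightarrow> L = K"
        using that(1,2) unfolding X_def by simp_all
      from KL sub have "K \<in> \<K>" "L \<in> \<K>" by auto
      then have "K \<inter> L = {} \<or> K \<subseteq> L \<or> L \<subseteq> K"
        using lam unfolding laminar_def by simp
      then show ?thesis using max that(3) by auto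
    qed
  qed (use finG sub sets in auto)
  finally show ?thesis by (simp add: G_def h_def)
qed

text \<open>Write the square of the average \<open>E K\<close> as the integral of
  \<open>2 * t\<close> over \<open>0 \<le> t \<le> E K\<close>, apply
  \<open>carleson_level_bound\<close> at each level \<open>t\<close>, and exchange the integrals.
  The constant 8 is the product of three factors 2: from \<open>2 * t\<close>, from the level bound,
  and from the length \<open>2 * f x\<close> of the interval of levels at which the point
  \<open>x\<close> counts.\<close>

lemma carleson_embedding:
  fixes f :: "'a \<Rightarrow> real" and a :: "'a set \<Rightarrow> ennreal"
  assumes M: "sigma_finite_measure M"
    and f[measurable]: "f \<in> borel_measurable M" and f0: "\<And>x. 0 \<le> f x"
    and fin: "finite \<K>" and lam: "laminar \<K>" and sets: "\<K> \<subseteq> sets M"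
    and mK: "\<And>K. K \<in> \<K> \<Longrightarrow> 0 < emeasure M K" "\<And>K. K \<in> \<K> \<Longrightarrow> emeasure M K < \<infinity>"
    and car: "\<And>K. K \<in> \<K> \<Longrightarrow> (\<Sum>L\<in>{L\<in>\<K>. L \<subseteq> K}. a L) \<le> A * emeasure M K"
    and fK: "\<And>K. K \<in> \<K> \<Longrightarrow> (\<integral>\<^sup>+x\<in>K. f x \<partial>M) < \<infinity>"
  shows "(\<Sum>K\<in>\<K>. ((\<integral>\<^sup>+x\<in>K. f x \<partial>M) / emeasure M K)\<^sup>2 * a K) \<le> 8 * A * (\<integral>\<^sup>+x. (f x)\<^sup>2 \<partial>M)"
proof -
  interpret sigma_finite_measure M by (rule M)
  interpret pair_sigma_finite M lborel ..
  \<comment> \<open>Real-valued because the levels are real; nothing is lost, since all averages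
    over members of the family are finite.\<close>
  define E where "E K = enn2real ((\<integral>\<^sup>+x\<in>K. f x \<partial>M) / emeasure M K)" for K
  have fin_div: "(\<integral>\<^sup>+x\<in>K. f x \<partial>M) / emeasure M K < \<infinity>" if "K \<in> \<K>" for K
    using fK[OF that] mK(1)[OF that]
    by (simp add: ennreal_divide_eq_top_iff less_top[symmetric] zero_less_iff_neq_zero)
  have E: "ennreal (E K) = (\<integral>\<^sup>+x\<in>K. f x \<partial>M) / emeasure M K" if "K \<in> \<K>" for K
    using fin_div[OF that] by (simp add: E_def)
  have E0: "0 \<le> E K" for K by (simp add: E_def)
  have tE: "ennreal t * emeasure M K \<le> (\<integral>\<^sup>+x\<in>K. f x \<partial>M)" if "K \<in> \<K>" "t \<le> E K" for t K
  proof -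
    have "ennreal t * emeasure M K \<le> ennreal (E K) * emeasure M K"
      using that by (intro mult_right_mono ennreal_leI) auto
    also have "\<dots> = (\<integral>\<^sup>+x\<in>K. f x \<partial>M)"
      using mK[OF that(1)] by (simp add: E[OF that(1)] ennreal_mult_divide_cancel)
    finally show ?thesis .
  qed
  have sq: "(\<integral>\<^sup>+t. ennreal (2 * t) * indicator {0..E K} t \<partial>lborel) = (ennreal (E K))\<^sup>2" for K
  proof -
    have "(\<integral>\<^sup>+t. ennreal (2 * t) * indicator {0..E K} t \<partial>lborel) = ennreal ((E K)\<^sup>2 - 0\<^sup>2)"
      using E0 by (intro nn_integral_FTC_Icc) (auto intro!: derivative_eq_intros)
    then show ?thesis using E0 by (simp add: ennreal_power)
  qed
  have level: "(\<Sum>K\<in>\<K>. (ennreal (2 * t) * indicator {0..E K} t) * a K)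
      \<le> 4 * A * (\<integral>\<^sup>+x. ennreal (f x) * indicator {0..2 * f x} t \<partial>M)" for t
  proof (cases "0 < t")
    case False
    then have 0: "ennreal (2 * t) * indicator {0..E K} t = 0" for K
      by (auto simp: indicator_def ennreal_neg)
    show ?thesis unfolding 0 by simp
  next
    case True
    let ?G = "{K\<in>\<K>. ennreal t * emeasure M K \<le> (\<integral>\<^sup>+x\<in>K. f x \<partial>M)}"
    have "(\<Sum>K\<in>\<K>. (ennreal (2 * t) * indicator {0..E K} t) * a K)
        = (\<Sum>K\<in>\<K>. if t \<le> E K then ennreal (2 * t) * a K else 0)"
      using True by (intro sum.cong) (auto simp: indicator_def)
    also have "\<dots> = (\<Sum>K\<in>{K\<in>\<K>. t \<le> E K}. ennreal (2 * t) * a K)"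
      using fin by (simp add: sum.inter_filter)
    also have "\<dots> \<le> (\<Sum>K\<in>?G. ennreal (2 * t) * a K)"
      using fin tE by (intro sum_mono2) auto
    also have "\<dots> = 2 * (ennreal t * (\<Sum>K\<in>?G. a K))"
      using True by (simp add: sum_distrib_left ennreal_mult mult_ac)
    also have "\<dots> \<le> 2 * (2 * A * (\<integral>\<^sup>+x. ennreal (f x) * indicator {x. t \<le> 2 * f x} x \<partial>M))"
      using True by (intro mult_left_mono carleson_level_bound f f0 fin lam sets mK car fK) auto
    also have "\<dots> = 4 * A * (\<integral>\<^sup>+x. ennreal (f x) * indicator {0..2 * f x} t \<partial>M)"
      using True by (simp add: mult.assoc[symmetric] indicator_def)
    finally show ?thesis .
  qed
  have m: "(\<lambda>(x, t). ennreal (f x) * indicator {0..2 * f x} t) \<in> borel_measurable (M \<Otimes>\<^sub>M lborel)"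
  proof -
    have "(\<lambda>(x, t). ennreal (f x) * indicator {0..2 * f x} t) =
        (\<lambda>p. if 0 \<le> snd p \<and> snd p \<le> 2 * f (fst p) then ennreal (f (fst p)) else 0)"
      by (simp add: fun_eq_iff indicator_def)
    also have "\<dots> \<in> borel_measurable (M \<Otimes>\<^sub>M lborel)" by measurable
    finally show ?thesis .
  qed
  have m': "(\<lambda>t. \<integral>\<^sup>+x. ennreal (f x) * indicator {0..2 * f x} t \<partial>M) \<in> borel_measurable lborel"
    using sigma_finite_measure.borel_measurable_nn_integral[OF M, of "\<lambda>t x. ennreal (f x) * indicator {0..2 * f x} t" lborel]
      measurable_pair_swap[OF m] by (simp add: case_prod_beta')
  have "(\<Sum>K\<in>\<K>. ((\<integral>\<^sup>+x\<in>K. f x \<partial>M) / emeasure M K)\<^sup>2 * a K) =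
      (\<Sum>K\<in>\<K>. (\<integral>\<^sup>+t. (ennreal (2 * t) * indicator {0..E K} t) * a K \<partial>lborel))"
    by (intro sum.cong refl) (simp add: nn_integral_multc sq E)
  also have "\<dots> = (\<integral>\<^sup>+t. (\<Sum>K\<in>\<K>. (ennreal (2 * t) * indicator {0..E K} t) * a K) \<partial>lborel)"
    by (rule nn_integral_sum[symmetric]) simp
  also have "\<dots> \<le> (\<integral>\<^sup>+t. 4 * A * (\<integral>\<^sup>+x. ennreal (f x) * indicator {0..2 * f x} t \<partial>M) \<partial>lborel)"
    by (intro nn_integral_mono level)
  also have "\<dots> = 4 * A * (\<integral>\<^sup>+t. (\<integral>\<^sup>+x. ennreal (f x) * indicator {0..2 * f x} t \<partial>M) \<partial>lborel)"
    by (rule nn_integral_cmult[OF m'])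
  also have "(\<integral>\<^sup>+t. (\<integral>\<^sup>+x. ennreal (f x) * indicator {0..2 * f x} t \<partial>M) \<partial>lborel)
      = (\<integral>\<^sup>+x. (\<integral>\<^sup>+t. ennreal (f x) * indicator {0..2 * f x} t \<partial>lborel) \<partial>M)"
    using Fubini'[of "\<lambda>x t. ennreal (f x) * indicator {0..2 * f x} t"] m by simp
  also have "\<dots> = (\<integral>\<^sup>+x. 2 * ennreal ((f x)\<^sup>2) \<partial>M)"
  proof (rule nn_integral_cong)
    fix x
    have "(\<integral>\<^sup>+t. ennreal (f x) * indicator {0..2 * f x} t \<partial>lborel) = ennreal (f x) * ennreal (2 * f x)"
      using f0[of x] by (simp add: nn_integral_cmult_indicator)
    also have "\<dots> = ennreal (2 * (f x)\<^sup>2)"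
      using f0[of x] by (simp add: ennreal_mult[symmetric] power2_eq_square mult_ac)
    also have "\<dots> = 2 * ennreal ((f x)\<^sup>2)" by (simp add: ennreal_mult)
    finally show "(\<integral>\<^sup>+t. ennreal (f x) * indicator {0..2 * f x} t \<partial>lborel) = 2 * ennreal ((f x)\<^sup>2)" .
  qed
  also have "\<dots> = 2 * (\<integral>\<^sup>+x. (f x)\<^sup>2 \<partial>M)" by (rule nn_integral_cmult) simp
  also have "4 * A * (2 * (\<integral>\<^sup>+x. (f x)\<^sup>2 \<partial>M)) = 8 * A * (\<integral>\<^sup>+x. (f x)\<^sup>2 \<partial>M)"
  proof -
    have "4 * A * (2 * y) = 4 * 2 * (A * y)" for y :: ennreal
      by (simp only: mult_ac)
    then show ?thesis by (simp add: mult.assoc)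
  qed
  finally show ?thesis .
qed

text \<open>Lets the embedding theorem stay with finite families, where every set lies below a
  maximal one.\<close>

lemma nn_integral_count_space_le:
  fixes g :: "'a \<Rightarrow> ennreal"
  assumes "countable I" and le: "\<And>J. finite J \<Longrightarrow> J \<subseteq> I \<Longrightarrow> sum g J \<le> c"
  shows "(\<integral>\<^sup>+i. g i \<partial>count_space I) \<le> c"
proof (cases "finite I")
  case True
  then show ?thesis using le by (simp add: nn_integral_count_space_finite)
next
  case False
  have bij: "bij_betw (from_nat_into I) UNIV I"
    using assms(1) False by (rule bij_betw_from_nat_into)
  have "(\<integral>\<^sup>+i. g i \<partial>count_space I) = (\<Sum>n. g (from_nat_into I n))"
    by (simp add: nn_integral_bij_count_space[OF bij, symmetric] nn_integral_count_space_nat)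
  also have "\<dots> \<le> c"
  proof (rule suminf_le_const)
    fix n
    have "(\<Sum>i<n. g (from_nat_into I i)) = sum g (from_nat_into I ` {..<n})"
      using bij by (subst sum.reindex) (auto simp: bij_betw_def inj_on_def)
    also have "\<dots> \<le> c" using bij by (intro le) (auto simp: bij_betw_def)
    finally show "(\<Sum>i<n. g (from_nat_into I i)) \<le> c" .
  qed simp
  finally show ?thesis .
qed

text \<open>The inequality for integrals, applied to the counting measure with density
  \<open>c\<close>.\<close>

lemma sum_Cauchy_Schwarz_ennreal:
  fixes u v c :: "'a \<Rightarrow> ennreal"
  assumes "finite J"
  shows "(\<Sum>i\<in>J. u i * v i * c i)\<^sup>2 \<le> (\<Sum>i\<in>J. (u i)\<^sup>2 * c i) * (\<Sum>i\<in>J. (v i)\<^sup>2 * c i)"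
proof -
  have eq: "(\<integral>\<^sup>+i. g i \<partial>density (count_space J) c) = (\<Sum>i\<in>J. g i * c i)" for g :: "'a \<Rightarrow> ennreal"
    using assms by (subst nn_integral_density) (simp_all add: nn_integral_count_space_finite mult.commute)
  show ?thesis
    using Cauchy_Schwarz_nn_integral[of u "density (count_space J) c" v] unfolding eq by simp
qed


section \<open>Sparse bilinear forms\<close>

lemma ennreal_sqrt_power2: "(ennreal_sqrt x)\<^sup>2 = x"
proof (cases x)
  case (real r)
  then show ?thesis by (simp add: ennreal_sqrt_def ennreal_power)
qed (simp add: ennreal_sqrt_def power2_eq_square)

lemma ennreal_sqrt_of_power2: "ennreal_sqrt (x\<^sup>2) = x"
proof (cases x)
  case (real r)
  then show ?thesis by (simp add: ennreal_sqrt_def ennreal_power)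
qed (simp add: ennreal_sqrt_def power2_eq_square)

lemma ennreal_sqrt_mono: "x \<le> y \<Longrightarrow> ennreal_sqrt x \<le> ennreal_sqrt y"
  by (cases x; cases y) (auto simp: ennreal_sqrt_def top_unique)

lemma ennreal_power2_le_imp_le:
  fixes x y :: ennreal
  assumes "x\<^sup>2 \<le> y\<^sup>2"
  shows "x \<le> y"
  using ennreal_sqrt_mono[OF assms] by (simp add: ennreal_sqrt_of_power2)

lemma ennreal_sqrt_less_top_iff: "ennreal_sqrt x < \<infinity> \<longleftrightarrow> x < \<infinity>"
  by (simp add: ennreal_sqrt_def less_top[symmetric])

lemma nn_integral_finite_if_square:
  fixes f :: "'a \<Rightarrow> real"
  assumes "finite_measure M" and f[measurable]: "f \<in> borel_measurable M" and f0: "\<And>x. 0 \<le> f x"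
    and "(\<integral>\<^sup>+x. (f x)\<^sup>2 \<partial>M) < \<infinity>"
  shows "(\<integral>\<^sup>+x. f x \<partial>M) < \<infinity>"
proof -
  have "f x \<le> 1 + (f x)\<^sup>2" for x
    using zero_le_power2[of "f x - 1 / 2"] by (simp add: power2_eq_square algebra_simps)
  then have "(\<integral>\<^sup>+x. f x \<partial>M) \<le> (\<integral>\<^sup>+x. ennreal 1 + ennreal ((f x)\<^sup>2) \<partial>M)"
    by (intro nn_integral_mono) (simp add: ennreal_leI ennreal_plus[symmetric] del: ennreal_plus ennreal_1)
  also have "\<dots> = emeasure M (space M) + (\<integral>\<^sup>+x. (f x)\<^sup>2 \<partial>M)"
    by (subst nn_integral_add) auto
  also have "\<dots> < \<infinity>"
    using assms finite_measure.emeasure_finite[OF assms(1)] by (simp add: less_top[symmetric])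
  finally show ?thesis .
qed

text \<open>\<open>a K\<close> and \<open>b K\<close> stand for the two Orlicz averages. Writing
  each integral over \<open>K\<close> as an average times \<open>emeasure S K\<close> or
  \<open>emeasure W K\<close>, the bump inequality leaves a sum of
  \<open>EF K * a K * (EG K * b K) * emeasure M K\<close>. Cauchy-Schwarz with weight
  \<open>emeasure M K\<close> separates \<open>f\<close> from \<open>g\<close>, and each factor is
  an embedding with coefficients \<open>(a K)\<^sup>2 * emeasure M K\<close> or
  \<open>(b K)\<^sup>2 * emeasure M K\<close>.\<close>

lemma sparse_bilinear_bound:
  fixes f g :: "'a \<Rightarrow> real" and a b :: "'a set \<Rightarrow> ennreal"
  assumes S: "finite_measure S" "sets S = sets M" and W: "finite_measure W" "sets W = sets M"
    and f[measurable]: "f \<in> borel_measurable M" and f0: "\<And>x. 0 \<le> f x"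
    and g[measurable]: "g \<in> borel_measurable M" and g0: "\<And>x. 0 \<le> g x"
    and \<K>: "countable \<K>" "laminar \<K>" "\<K> \<subseteq> sets M"
    and pos: "\<And>K. K \<in> \<K> \<Longrightarrow> 0 < emeasure S K" "\<And>K. K \<in> \<K> \<Longrightarrow> 0 < emeasure W K"
      "\<And>K. K \<in> \<K> \<Longrightarrow> 0 < emeasure M K" "\<And>K. K \<in> \<K> \<Longrightarrow> emeasure M K < \<infinity>"
    and carS: "\<And>J K. finite J \<Longrightarrow> J \<subseteq> \<K> \<Longrightarrow> K \<in> J \<Longrightarrow>
      (\<Sum>L\<in>{L\<in>J. L \<subseteq> K}. (a L)\<^sup>2 * emeasure M L) \<le> A * emeasure S K"
    and carW: "\<And>J K. finite J \<Longrightarrow> J \<subseteq> \<K> \<Longrightarrow> K \<in> J \<Longrightarrow>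
      (\<Sum>L\<in>{L\<in>J. L \<subseteq> K}. (b L)\<^sup>2 * emeasure M L) \<le> A * emeasure W K"
    and bump: "\<And>K. K \<in> \<K> \<Longrightarrow> emeasure S K * emeasure W K \<le> B * (a K * b K) * (emeasure M K)\<^sup>2"
    and fin: "(\<integral>\<^sup>+x. (f x)\<^sup>2 \<partial>S) < \<infinity>" "(\<integral>\<^sup>+x. (g x)\<^sup>2 \<partial>W) < \<infinity>"
  shows "(\<integral>\<^sup>+K. (\<integral>\<^sup>+x\<in>K. f x \<partial>S) * (\<integral>\<^sup>+x\<in>K. g x \<partial>W) / emeasure M K \<partial>count_space \<K>)
    \<le> B * (8 * A) * (ennreal_sqrt (\<integral>\<^sup>+x. (f x)\<^sup>2 \<partial>S) * ennreal_sqrt (\<integral>\<^sup>+x. (g x)\<^sup>2 \<partial>W))"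
proof (rule nn_integral_count_space_le[OF \<K>(1)])
  interpret S: finite_measure S by (rule S)
  interpret W: finite_measure W by (rule W)
  have [measurable]: "f \<in> borel_measurable S" "g \<in> borel_measurable W"
    using f g S W by (simp_all cong: measurable_cong_sets)
  fix J assume J: "finite J" "J \<subseteq> \<K>"
  define EF where "EF K = (\<integral>\<^sup>+x\<in>K. f x \<partial>S) / emeasure S K" for K
  define EG where "EG K = (\<integral>\<^sup>+x\<in>K. g x \<partial>W) / emeasure W K" for K
  have sub: "J \<subseteq> sets S" "J \<subseteq> sets W" using J \<K> S W by auto
  have lam: "laminar J" using \<K>(2) J(2) unfolding laminar_def by blast
  have finS: "(\<integral>\<^sup>+x\<in>K. f x \<partial>S) < \<infinity>" for K
    by (rule le_less_trans[OF nn_integral_mono nn_integral_finite_if_square[OF S(1) _ f0 fin(1)]])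
      (auto simp: indicator_def)
  have finW: "(\<integral>\<^sup>+x\<in>K. g x \<partial>W) < \<infinity>" for K
    by (rule le_less_trans[OF nn_integral_mono nn_integral_finite_if_square[OF W(1) _ g0 fin(2)]])
      (auto simp: indicator_def)
  have fm: "emeasure S K < \<infinity>" "emeasure W K < \<infinity>" for K
    by (simp_all add: less_top[symmetric])
  have summand: "(\<integral>\<^sup>+x\<in>K. f x \<partial>S) * (\<integral>\<^sup>+x\<in>K. g x \<partial>W) / emeasure M K
      \<le> B * ((EF K * a K) * (EG K * b K) * emeasure M K)" if K: "K \<in> J" for K
  proof -
    have K': "K \<in> \<K>" using K J by auto
    have M0: "emeasure M K \<noteq> 0" "emeasure M K < \<infinity>" using pos K' by (auto simp: zero_less_iff_neq_zero)
    have "(\<integral>\<^sup>+x\<in>K. f x \<partial>S) = EF K * emeasure S K" "(\<integral>\<^sup>+x\<in>K. g x \<partial>W) = EG K * emeasure W K"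
      using pos[OF K'] fm by (auto simp: EF_def EG_def ennreal_mult_divide_cancel zero_less_iff_neq_zero)
    then have "(\<integral>\<^sup>+x\<in>K. f x \<partial>S) * (\<integral>\<^sup>+x\<in>K. g x \<partial>W)
        = EF K * EG K * (emeasure S K * emeasure W K)" by (simp add: mult_ac)
    also have "\<dots> \<le> EF K * EG K * (B * (a K * b K) * (emeasure M K)\<^sup>2)"
      by (intro mult_left_mono bump K') auto
    also have "\<dots> = B * ((EF K * a K) * (EG K * b K) * emeasure M K) * emeasure M K"
      by (simp add: power2_eq_square mult_ac)
    finally have "(\<integral>\<^sup>+x\<in>K. f x \<partial>S) * (\<integral>\<^sup>+x\<in>K. g x \<partial>W) / emeasure M K
        \<le> B * ((EF K * a K) * (EG K * b K) * emeasure M K) * emeasure M K / emeasure M K"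
      by (rule divide_right_mono_ennreal)
    also have "\<dots> = B * ((EF K * a K) * (EG K * b K) * emeasure M K)"
      using M0 by (simp add: ennreal_times_divide[symmetric] ennreal_divide_self)
    finally show ?thesis .
  qed
  have "(\<Sum>K\<in>J. (EF K)\<^sup>2 * ((a K)\<^sup>2 * emeasure M K)) \<le> 8 * A * (\<integral>\<^sup>+x. (f x)\<^sup>2 \<partial>S)"
    unfolding EF_def using J pos fm finS
    by (intro carleson_embedding S.sigma_finite_measure_axioms f0 lam sub carS) auto
  moreover have "(\<Sum>K\<in>J. (EG K)\<^sup>2 * ((b K)\<^sup>2 * emeasure M K)) \<le> 8 * A * (\<integral>\<^sup>+x. (g x)\<^sup>2 \<partial>W)"
    unfolding EG_def using J pos fm finW
    by (intro carleson_embedding W.sigma_finite_measure_axioms g0 lam sub carW) auto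
  ultimately have "(\<Sum>K\<in>J. (EF K * a K)\<^sup>2 * emeasure M K) * (\<Sum>K\<in>J. (EG K * b K)\<^sup>2 * emeasure M K)
      \<le> (8 * A * (\<integral>\<^sup>+x. (f x)\<^sup>2 \<partial>S)) * (8 * A * (\<integral>\<^sup>+x. (g x)\<^sup>2 \<partial>W))"
    unfolding power_mult_distrib mult.assoc[of _ _ "emeasure M _"] by (rule mult_mono) auto
  with sum_Cauchy_Schwarz_ennreal[OF J(1), of "\<lambda>K. EF K * a K" "\<lambda>K. EG K * b K" "emeasure M"]
  have "(\<Sum>K\<in>J. (EF K * a K) * (EG K * b K) * emeasure M K)\<^sup>2
      \<le> (8 * A * (\<integral>\<^sup>+x. (f x)\<^sup>2 \<partial>S)) * (8 * A * (\<integral>\<^sup>+x. (g x)\<^sup>2 \<partial>W))"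
    by (rule order_trans)
  also have "\<dots> = (8 * A * (ennreal_sqrt (\<integral>\<^sup>+x. (f x)\<^sup>2 \<partial>S) * ennreal_sqrt (\<integral>\<^sup>+x. (g x)\<^sup>2 \<partial>W)))\<^sup>2"
    unfolding power_mult_distrib ennreal_sqrt_power2 by (simp only: power2_eq_square mult_ac)
  finally have CS: "(\<Sum>K\<in>J. (EF K * a K) * (EG K * b K) * emeasure M K)
      \<le> 8 * A * (ennreal_sqrt (\<integral>\<^sup>+x. (f x)\<^sup>2 \<partial>S) * ennreal_sqrt (\<integral>\<^sup>+x. (g x)\<^sup>2 \<partial>W))"
    by (rule ennreal_power2_le_imp_le)
  have "(\<Sum>K\<in>J. (\<integral>\<^sup>+x\<in>K. f x \<partial>S) * (\<integral>\<^sup>+x\<in>K. g x \<partial>W) / emeasure M K)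
      \<le> (\<Sum>K\<in>J. B * ((EF K * a K) * (EG K * b K) * emeasure M K))"
    by (intro sum_mono summand)
  also have "\<dots> = B * (\<Sum>K\<in>J. (EF K * a K) * (EG K * b K) * emeasure M K)"
    by (simp only: sum_distrib_left)
  also have "\<dots> \<le> B * (8 * A * (ennreal_sqrt (\<integral>\<^sup>+x. (f x)\<^sup>2 \<partial>S) * ennreal_sqrt (\<integral>\<^sup>+x. (g x)\<^sup>2 \<partial>W)))"
    using CS by (rule mult_left_mono) simp
  finally show "(\<Sum>K\<in>J. (\<integral>\<^sup>+x\<in>K. f x \<partial>S) * (\<integral>\<^sup>+x\<in>K. g x \<partial>W) / emeasure M K)
      \<le> B * (8 * A) * (ennreal_sqrt (\<integral>\<^sup>+x. (f x)\<^sup>2 \<partial>S) * ennreal_sqrt (\<integral>\<^sup>+x. (g x)\<^sup>2 \<partial>W))"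
    by (simp only: mult.assoc)
qed

section \<open>Dominated kernels and truncation\<close>

lemma borel_measurable_nn_integral_count_space:
  fixes f :: "'i \<Rightarrow> 'a \<Rightarrow> ennreal"
  assumes I: "countable I" and f: "\<And>i. i \<in> I \<Longrightarrow> f i \<in> borel_measurable M"
  shows "(\<lambda>x. \<integral>\<^sup>+i. f i x \<partial>count_space I) \<in> borel_measurable M"
proof (rule sigma_finite_measure.borel_measurable_nn_integral)
  show "sigma_finite_measure (count_space I)"
    using I by (rule sigma_finite_measure_count_space_countable)
  have "(\<lambda>(i, x). f i x) \<in> borel_measurable (count_space I \<Otimes>\<^sub>M M)"
    using f by (intro measurable_pair_measure_countable1[OF I]) simp
  from measurable_pair_swap[OF this]
  show "(\<lambda>(x, i). f i x) \<in> borel_measurable (M \<Otimes>\<^sub>M count_space I)"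
    by (simp add: case_prod_beta')
qed

text \<open>The dominating set depends on the pair of points. Summing over all sets decouples the
  two variables, so that Tonelli's theorem produces a product of two integrals over each
  \<open>K\<close>.\<close>

lemma kernel_form_le:
  fixes k :: "'a \<Rightarrow> 'a \<Rightarrow> real" and h g :: "'a \<Rightarrow> ennreal"
  assumes S: "sets S = sets M" and W: "sets W = sets M"
    and h[measurable]: "h \<in> borel_measurable M" and g[measurable]: "g \<in> borel_measurable M"
    and \<K>: "\<And>l. l \<in> I \<Longrightarrow> countable (\<K> l)" "\<And>l. l \<in> I \<Longrightarrow> \<K> l \<subseteq> sets M" and I: "finite I"
    and dom: "\<And>z \<zeta>. z \<in> space M \<Longrightarrow> \<zeta> \<in> space M \<Longrightarrow>
      \<exists>l\<in>I. \<exists>K\<in>\<K> l. z \<in> K \<and> \<zeta> \<in> K \<and> ennreal (k z \<zeta>) \<le> c / emeasure M K"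
  shows "(\<integral>\<^sup>+z. (\<integral>\<^sup>+\<zeta>. h \<zeta> * ennreal (k z \<zeta>) \<partial>S) * g z \<partial>W)
    \<le> c * (\<Sum>l\<in>I. \<integral>\<^sup>+K. (\<integral>\<^sup>+x\<in>K. h x \<partial>S) * (\<integral>\<^sup>+x\<in>K. g x \<partial>W) / emeasure M K \<partial>count_space (\<K> l))"
proof -
  have [measurable]: "h \<in> borel_measurable S" "g \<in> borel_measurable W"
    using h g S W by (simp_all cong: measurable_cong_sets)
  have [measurable]: "indicator K \<in> borel_measurable S" "indicator K \<in> borel_measurable W"
    if "l \<in> I" "K \<in> \<K> l" for l K
    using \<K>(2)[OF that(1)] that(2) S W by auto
  have sp: "space S = space M" "space W = space M" using S W by (auto dest: sets_eq_imp_space_eq)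
  have kb: "ennreal (k z \<zeta>) \<le> (\<Sum>l\<in>I. \<integral>\<^sup>+K. c / emeasure M K * indicator K z * indicator K \<zeta> \<partial>count_space (\<K> l))"
    if z: "z \<in> space M" "\<zeta> \<in> space M" for z \<zeta>
  proof -
    obtain l K where l: "l \<in> I" "K \<in> \<K> l" "z \<in> K" "\<zeta> \<in> K" "ennreal (k z \<zeta>) \<le> c / emeasure M K"
      using dom[OF z] by blast
    have "ennreal (k z \<zeta>) \<le> c / emeasure M K * indicator K z * indicator K \<zeta>" using l by simp
    also have "\<dots> \<le> (\<integral>\<^sup>+K. c / emeasure M K * indicator K z * indicator K \<zeta> \<partial>count_space (\<K> l))"
      using l(2) by (rule nn_integral_ge_point)
    also have "\<dots> \<le> (\<Sum>l\<in>I. \<integral>\<^sup>+K. c / emeasure M K * indicator K z * indicator K \<zeta> \<partial>count_space (\<K> l))"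
      using l I by (intro member_le_sum[of l I]) auto
    finally show ?thesis .
  qed
  define H where "H K = (\<integral>\<^sup>+x\<in>K. h x \<partial>S)" for K
  have inner: "(\<integral>\<^sup>+\<zeta>. h \<zeta> * ennreal (k z \<zeta>) \<partial>S)
      \<le> (\<Sum>l\<in>I. \<integral>\<^sup>+K. c / emeasure M K * indicator K z * H K \<partial>count_space (\<K> l))"
    if z: "z \<in> space M" for z
  proof -
    have "(\<integral>\<^sup>+\<zeta>. h \<zeta> * ennreal (k z \<zeta>) \<partial>S) \<le>
       (\<integral>\<^sup>+\<zeta>. (\<Sum>l\<in>I. \<integral>\<^sup>+K. c / emeasure M K * indicator K z * (h \<zeta> * indicator K \<zeta>) \<partial>count_space (\<K> l)) \<partial>S)"
    proof (rule nn_integral_mono)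
      fix \<zeta> assume "\<zeta> \<in> space S"
      then have "h \<zeta> * ennreal (k z \<zeta>) \<le>
          h \<zeta> * (\<Sum>l\<in>I. \<integral>\<^sup>+K. c / emeasure M K * indicator K z * indicator K \<zeta> \<partial>count_space (\<K> l))"
        using z sp by (intro mult_left_mono kb) auto
      also have "\<dots> = (\<Sum>l\<in>I. \<integral>\<^sup>+K. c / emeasure M K * indicator K z * (h \<zeta> * indicator K \<zeta>) \<partial>count_space (\<K> l))"
        by (simp add: sum_distrib_left nn_integral_cmult[symmetric] mult_ac)
      finally show "h \<zeta> * ennreal (k z \<zeta>) \<le>
          (\<Sum>l\<in>I. \<integral>\<^sup>+K. c / emeasure M K * indicator K z * (h \<zeta> * indicator K \<zeta>) \<partial>count_space (\<K> l))" .
    qed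
    also have "\<dots> = (\<Sum>l\<in>I. \<integral>\<^sup>+\<zeta>. \<integral>\<^sup>+K. c / emeasure M K * indicator K z * (h \<zeta> * indicator K \<zeta>) \<partial>count_space (\<K> l) \<partial>S)"
      by (intro nn_integral_sum borel_measurable_nn_integral_count_space) (auto intro: \<K>)
    also have "\<dots> = (\<Sum>l\<in>I. \<integral>\<^sup>+K. \<integral>\<^sup>+\<zeta>. c / emeasure M K * indicator K z * (h \<zeta> * indicator K \<zeta>) \<partial>S \<partial>count_space (\<K> l))"
      by (intro sum.cong refl nn_integral_count_space_nn_integral \<K>) auto
    also have "\<dots> = (\<Sum>l\<in>I. \<integral>\<^sup>+K. c / emeasure M K * indicator K z * H K \<partial>count_space (\<K> l))"
      unfolding H_def by (intro sum.cong refl nn_integral_cong nn_integral_cmult) auto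
    finally show ?thesis .
  qed
  have "(\<integral>\<^sup>+z. (\<integral>\<^sup>+\<zeta>. h \<zeta> * ennreal (k z \<zeta>) \<partial>S) * g z \<partial>W)
      \<le> (\<integral>\<^sup>+z. (\<Sum>l\<in>I. \<integral>\<^sup>+K. c / emeasure M K * H K * (g z * indicator K z) \<partial>count_space (\<K> l)) \<partial>W)"
  proof (rule nn_integral_mono)
    fix z assume "z \<in> space W"
    then have "(\<integral>\<^sup>+\<zeta>. h \<zeta> * ennreal (k z \<zeta>) \<partial>S) * g z \<le>
        (\<Sum>l\<in>I. \<integral>\<^sup>+K. c / emeasure M K * indicator K z * H K \<partial>count_space (\<K> l)) * g z"
      using sp by (intro mult_right_mono inner) auto
    also have "\<dots> = (\<Sum>l\<in>I. \<integral>\<^sup>+K. c / emeasure M K * H K * (g z * indicator K z) \<partial>count_space (\<K> l))"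
      by (simp add: sum_distrib_left nn_integral_cmult[symmetric] mult_ac)
    finally show "(\<integral>\<^sup>+\<zeta>. h \<zeta> * ennreal (k z \<zeta>) \<partial>S) * g z \<le>
        (\<Sum>l\<in>I. \<integral>\<^sup>+K. c / emeasure M K * H K * (g z * indicator K z) \<partial>count_space (\<K> l))" .
  qed
  also have "\<dots> = (\<Sum>l\<in>I. \<integral>\<^sup>+z. \<integral>\<^sup>+K. c / emeasure M K * H K * (g z * indicator K z) \<partial>count_space (\<K> l) \<partial>W)"
    by (intro nn_integral_sum borel_measurable_nn_integral_count_space) (auto intro: \<K>)
  also have "\<dots> = (\<Sum>l\<in>I. \<integral>\<^sup>+K. \<integral>\<^sup>+z. c / emeasure M K * H K * (g z * indicator K z) \<partial>W \<partial>count_space (\<K> l))"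
    by (intro sum.cong refl nn_integral_count_space_nn_integral \<K>) auto
  also have "\<dots> = (\<Sum>l\<in>I. \<integral>\<^sup>+K. c / emeasure M K * H K * (\<integral>\<^sup>+x\<in>K. g x \<partial>W) \<partial>count_space (\<K> l))"
    by (intro sum.cong refl nn_integral_cong nn_integral_cmult) auto
  also have "\<dots> = (\<Sum>l\<in>I. \<integral>\<^sup>+K. c * (H K * (\<integral>\<^sup>+x\<in>K. g x \<partial>W) / emeasure M K) \<partial>count_space (\<K> l))"
    by (intro sum.cong refl nn_integral_cong) (simp add: divide_ennreal_def mult_ac)
  also have "\<dots> = c * (\<Sum>l\<in>I. \<integral>\<^sup>+K. H K * (\<integral>\<^sup>+x\<in>K. g x \<partial>W) / emeasure M K \<partial>count_space (\<K> l))"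
    by (simp add: sum_distrib_left nn_integral_cmult)
  finally show ?thesis unfolding H_def .
qed

text \<open>Duality without prior knowledge that \<open>F\<close> is square integrable: test with
  \<open>min (F x) n\<close>, whose norm \<open>X\<close> is finite because \<open>W\<close> is. In
  \<open>X\<^sup>2 \<le> D * X\<close> a factor \<open>X\<close> can then be cancelled, and monotone
  convergence removes the truncation.\<close>

lemma L2_bound_by_truncation:
  fixes F :: "'a \<Rightarrow> real"
  assumes W: "finite_measure W" and F[measurable]: "F \<in> borel_measurable W" and F0: "\<And>x. 0 \<le> F x"
    and D: "\<And>n :: nat. (\<integral>\<^sup>+x. ennreal (F x) * ennreal (min (F x) n) \<partial>W)
      \<le> D * ennreal_sqrt (\<integral>\<^sup>+x. (min (F x) n)\<^sup>2 \<partial>W)"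
  shows "ennreal_sqrt (\<integral>\<^sup>+x. (F x)\<^sup>2 \<partial>W) \<le> D"
proof -
  interpret finite_measure W by (rule W)
  have n: "(\<integral>\<^sup>+x. (min (F x) n)\<^sup>2 \<partial>W) \<le> D\<^sup>2" for n :: nat
  proof -
    define X where "X = ennreal_sqrt (\<integral>\<^sup>+x. (min (F x) n)\<^sup>2 \<partial>W)"
    have X2: "X\<^sup>2 = (\<integral>\<^sup>+x. (min (F x) n)\<^sup>2 \<partial>W)" by (simp add: X_def ennreal_sqrt_power2)
    have "(\<integral>\<^sup>+x. (min (F x) n)\<^sup>2 \<partial>W) \<le> (\<integral>\<^sup>+x. ennreal ((real n)\<^sup>2) \<partial>W)"
      using F0 by (intro nn_integral_mono ennreal_leI power_mono) auto
    also have "\<dots> < \<infinity>"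
      by (simp add: ennreal_mult_less_top less_top[symmetric] ennreal_mult_eq_top_iff)
    finally have "X < \<infinity>" unfolding X_def ennreal_sqrt_less_top_iff .
    have "X\<^sup>2 \<le> (\<integral>\<^sup>+x. ennreal (F x) * ennreal (min (F x) n) \<partial>W)"
      unfolding X2 using F0
      by (intro nn_integral_mono) (simp add: ennreal_mult[symmetric] power2_eq_square ennreal_leI mult_right_mono)
    also have "\<dots> \<le> D * X" unfolding X_def by (rule D)
    finally have "X * X \<le> D * X" by (simp add: power2_eq_square)
    then have "X \<le> D"
    proof (cases "X = 0")
      case False
      then have "X * X / X \<le> D * X / X" using \<open>X * X \<le> D * X\<close> by (intro divide_right_mono_ennreal)
      then show ?thesis
        using False \<open>X < \<infinity>\<close> by (simp add: ennreal_times_divide[symmetric] ennreal_divide_self)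
    qed simp
    then show ?thesis unfolding X2[symmetric] by (intro power_mono) auto
  qed
  have "(\<integral>\<^sup>+x. (F x)\<^sup>2 \<partial>W) \<le> (\<integral>\<^sup>+x. (SUP n. ennreal ((min (F x) (real n))\<^sup>2)) \<partial>W)"
  proof (rule nn_integral_mono)
    fix x
    obtain n where "F x \<le> real n" using real_arch_simple by blast
    then have "ennreal ((F x)\<^sup>2) = ennreal ((min (F x) (real n))\<^sup>2)" by simp
    also have "\<dots> \<le> (SUP n. ennreal ((min (F x) (real n))\<^sup>2))" by (rule SUP_upper) simp
    finally show "ennreal ((F x)\<^sup>2) \<le> (SUP n. ennreal ((min (F x) (real n))\<^sup>2))" .
  qed
  also have "\<dots> = (SUP n. (\<integral>\<^sup>+x. ennreal ((min (F x) (real n))\<^sup>2) \<partial>W))"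
    using F0 by (intro nn_integral_monotone_convergence_SUP)
      (auto simp: incseq_def le_fun_def intro!: ennreal_leI power_mono min.mono)
  also have "\<dots> \<le> D\<^sup>2" by (intro SUP_least n)
  finally have "ennreal_sqrt (\<integral>\<^sup>+x. (F x)\<^sup>2 \<partial>W) \<le> ennreal_sqrt (D\<^sup>2)" by (rule ennreal_sqrt_mono)
  then show ?thesis by (simp add: ennreal_sqrt_of_power2)
qed


section \<open>Orlicz averages and the bump condition\<close>

lemma sets_weighted [simp]: "sets (weighted w) = sets ball_measure"
  by (simp add: weighted_def)

lemma space_weighted [simp]: "space (weighted w) = ball 0 1"
  by (simp add: weighted_def)

lemma borel_measurable_weighted_iff:
  "f \<in> borel_measurable (weighted w) \<longleftrightarrow> f \<in> borel_measurable ball_measure"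
  by (simp cong: measurable_cong_sets)

lemma nn_integral_weighted:
  assumes "weight w" "f \<in> borel_measurable ball_measure"
  shows "(\<integral>\<^sup>+x. f x \<partial>weighted w) = (\<integral>\<^sup>+x. ennreal (w x) * f x \<partial>ball_measure)"
  using assms unfolding weighted_def weight_def by (intro nn_integral_density) auto

lemma emeasure_weighted:
  assumes "weight w" "K \<in> sets ball_measure"
  shows "emeasure (weighted w) K = (\<integral>\<^sup>+x\<in>K. ennreal (w x) \<partial>ball_measure)"
  using assms unfolding weighted_def weight_def by (intro emeasure_density) auto

lemma emeasure_weighted_pos:
  assumes w: "weight w" and K: "K \<in> sets ball_measure" "0 < emeasure ball_measure K"
  shows "0 < emeasure (weighted w) K"
proof (rule ccontr)
  have [measurable]: "w \<in> borel_measurable ball_measure" "K \<in> sets ball_measure"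
    and pos: "AE x in ball_measure. 0 < w x"
    using w K by (auto simp: weight_def)
  assume "\<not> 0 < emeasure (weighted w) K"
  then have "(\<integral>\<^sup>+x\<in>K. ennreal (w x) \<partial>ball_measure) = 0"
    using emeasure_weighted[OF w K(1)] by (simp add: zero_less_iff_neq_zero)
  then have "AE x in ball_measure. ennreal (w x) * indicator K x = 0"
    by (subst (asm) nn_integral_0_iff_AE) measurable
  with pos have "AE x in ball_measure. x \<notin> K"
    by eventually_elim (auto simp: indicator_def split: if_splits)
  moreover have *: "{x \<in> space ball_measure. \<not> x \<notin> K} = K"
    using sets.sets_into_space[OF K(1)] by auto
  ultimately have "emeasure ball_measure K = 0"
    by (simp only: AE_iff_measurable[OF K(1) *])
  then show False using K(2) by simp
qed

lemma average_weight:
  assumes "weight w" "K \<in> sets ball_measure"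
  shows "average K (\<lambda>z. ennreal (w z)) = emeasure (weighted w) K / emeasure ball_measure K"
  by (simp add: average_def emeasure_weighted[OF assms])

text \<open>Apply the maximal operator to \<open>sqrt w\<close> cut off to \<open>K\<close>, whose
  squared norm is the weighted measure of \<open>K\<close>. On \<open>E L\<close> the maximal
  function is at least the Orlicz average over \<open>L\<close>, and the sets \<open>E L\<close> are
  disjoint. Besides top kubes, the case of a single tent with \<open>E K = K\<close> is used later,
  to see that Orlicz averages are finite.\<close>

lemma orlicz_carleson:
  fixes \<T> :: "(complex ^ 'd) set set"
  assumes "maximal_bounded_L2 \<T> \<Phi>"
  obtains A :: real where "A > 0"
    "\<And>w J E K. weight w \<Longrightarrow> finite J \<Longrightarrow> J \<subseteq> \<T> \<Longrightarrow> disjoint_family_on E J \<Longrightarrow> K \<in> sets ball_measure \<Longrightarrow>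
      (\<And>L. L \<in> J \<Longrightarrow> E L \<in> sets ball_measure \<and> E L \<subseteq> L \<and> L \<subseteq> K) \<Longrightarrow>
      (\<Sum>L\<in>J. (orlicz_average \<Phi> L (\<lambda>z. sqrt (w z)))\<^sup>2 * emeasure ball_measure (E L))
        \<le> ennreal A * emeasure (weighted w) K"
proof -
  obtain a where a: "\<And>f. f \<in> L2_space ball_measure \<Longrightarrow>
      L2_norm ball_measure (orlicz_maximal \<T> \<Phi> f) \<le> ennreal a * L2_norm ball_measure (\<lambda>z. ennreal (cmod (f z)))"
    using assms unfolding maximal_bounded_L2_def by blast
  \<comment> \<open>The maximum makes \<open>A\<close> positive, so that the bound is infinite when
    the weighted measure of \<open>K\<close> is.\<close>
  define A where "A = (max 1 a)\<^sup>2"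
  have "A > 0" by (simp add: A_def)
  moreover have "(\<Sum>L\<in>J. (orlicz_average \<Phi> L (\<lambda>z. sqrt (w z)))\<^sup>2 * emeasure ball_measure (E L))
        \<le> ennreal A * emeasure (weighted w) K"
    if w: "weight w" and J: "finite J" "J \<subseteq> \<T>" "disjoint_family_on E J" and K: "K \<in> sets ball_measure"
      and E: "\<And>L. L \<in> J \<Longrightarrow> E L \<in> sets ball_measure \<and> E L \<subseteq> L \<and> L \<subseteq> K" for w J E K
  proof (cases "emeasure (weighted w) K = \<infinity>")
    case True
    then show ?thesis using \<open>A > 0\<close> by (simp add: ennreal_mult_top)
  next
    case False
    have wm[measurable]: "w \<in> borel_measurable ball_measure" "K \<in> sets ball_measure"
      and pos: "AE x in ball_measure. 0 < w x"
      using w K by (auto simp: weight_def)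
    define f where "f z = complex_of_real (sqrt (w z) * indicator K z)" for z
    have fm: "f \<in> borel_measurable ball_measure" unfolding f_def by measurable
    define o' where "o' L = orlicz_average \<Phi> L (\<lambda>z. sqrt (w z))" for L
    have "(\<integral>\<^sup>+z. (ennreal (cmod (f z)))\<^sup>2 \<partial>ball_measure) = (\<integral>\<^sup>+x\<in>K. ennreal (w x) \<partial>ball_measure)"
    proof (rule nn_integral_cong_AE)
      show "AE z in ball_measure. (ennreal (cmod (f z)))\<^sup>2 = ennreal (w z) * indicator K z"
        using pos by eventually_elim (auto simp: f_def indicator_def ennreal_power)
    qed
    then have f2: "(\<integral>\<^sup>+z. (ennreal (cmod (f z)))\<^sup>2 \<partial>ball_measure) = emeasure (weighted w) K"
      using emeasure_weighted[OF w K] by simp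
    have "L2_norm ball_measure (\<lambda>z. ennreal (cmod (f z))) < \<infinity>"
      unfolding L2_norm_def f2 ennreal_sqrt_less_top_iff using False by (simp add: less_top)
    then have "f \<in> L2_space ball_measure" using fm by (simp add: L2_space_def)
    then have "L2_norm ball_measure (orlicz_maximal \<T> \<Phi> f) \<le> ennreal a * ennreal_sqrt (emeasure (weighted w) K)"
      using a[of f] by (simp add: L2_norm_def f2)
    also have "\<dots> \<le> ennreal (max 1 a) * ennreal_sqrt (emeasure (weighted w) K)"
      by (intro mult_right_mono ennreal_leI) auto
    finally have "(L2_norm ball_measure (orlicz_maximal \<T> \<Phi> f))\<^sup>2
        \<le> (ennreal (max 1 a) * ennreal_sqrt (emeasure (weighted w) K))\<^sup>2"
      by (intro power_mono) auto
    then have bound: "(\<integral>\<^sup>+x. (orlicz_maximal \<T> \<Phi> f x)\<^sup>2 \<partial>ball_measure) \<le> ennreal A * emeasure (weighted w) K"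
      by (simp add: L2_norm_def power_mult_distrib ennreal_sqrt_power2 A_def ennreal_power)
    \<comment> \<open>The cut-off is invisible on \<open>L \<subseteq> K\<close>, and
      \<open>sqrt (w z)\<close> is its own modulus where \<open>w z > 0\<close>, that is almost
      everywhere.\<close>
    have oeq: "orlicz_average \<Phi> L (\<lambda>\<zeta>. cmod (f \<zeta>)) = o' L" if "L \<in> J" for L
    proof -
      have "average L (\<lambda>z. ennreal (\<Phi> (cmod (f z) / s))) = average L (\<lambda>z. ennreal (\<Phi> (sqrt (w z) / s)))" for s
        unfolding average_def
      proof (intro arg_cong2[where f = "(/)"] refl nn_integral_cong_AE)
        show "AE z in ball_measure. ennreal (\<Phi> (cmod (f z) / s)) * indicator L z =
            ennreal (\<Phi> (sqrt (w z) / s)) * indicator L z"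
          using pos
        proof eventually_elim
          case (elim z)
          show ?case
            using elim E[OF that] by (cases "z \<in> L") (auto simp: f_def indicator_def)
        qed
      qed
      then show ?thesis by (simp add: orlicz_average_def o'_def)
    qed
    have "(\<Sum>L\<in>J. (o' L)\<^sup>2 * emeasure ball_measure (E L))
        = (\<Sum>L\<in>J. \<integral>\<^sup>+x. (o' L)\<^sup>2 * indicator (E L) x \<partial>ball_measure)"
      using E by (intro sum.cong refl) (simp add: nn_integral_cmult_indicator)
    also have "\<dots> = (\<integral>\<^sup>+x. (\<Sum>L\<in>J. (o' L)\<^sup>2 * indicator (E L) x) \<partial>ball_measure)"
      using E by (intro nn_integral_sum[symmetric] borel_measurable_times_ennreal
          borel_measurable_const borel_measurable_indicator) auto
    also have "\<dots> \<le> (\<integral>\<^sup>+x. (orlicz_maximal \<T> \<Phi> f x)\<^sup>2 \<partial>ball_measure)"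
    proof (rule nn_integral_mono)
      fix x
      show "(\<Sum>L\<in>J. (o' L)\<^sup>2 * indicator (E L) x) \<le> (orlicz_maximal \<T> \<Phi> f x)\<^sup>2"
      proof (cases "\<exists>L\<in>J. x \<in> E L")
        case False
        then have "(\<Sum>L\<in>J. (o' L)\<^sup>2 * indicator (E L) x) = 0" by (intro sum.neutral) auto
        then show ?thesis by simp
      next
        case True
        then obtain L where L: "L \<in> J" "x \<in> E L" by blast
        have "(\<Sum>L\<in>J. (o' L)\<^sup>2 * indicator (E L) x) = (o' L)\<^sup>2"
          using J L by (intro sum_indicator_disjoint_family)
        moreover have "o' L \<le> orlicz_maximal \<T> \<Phi> f x"
        proof -
          have "o' L = orlicz_average \<Phi> L (\<lambda>\<zeta>. cmod (f \<zeta>)) * indicator L x"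
            using oeq[OF L(1)] E[OF L(1)] L(2) by (simp add: indicator_def subset_iff)
          also have "\<dots> \<le> orlicz_maximal \<T> \<Phi> f x"
            unfolding orlicz_maximal_def using L J by (intro SUP_upper) auto
          finally show ?thesis .
        qed
        ultimately show ?thesis by (simp add: power_mono)
      qed
    qed
    also note bound
    finally show ?thesis by (simp add: o'_def)
  qed
  ultimately show ?thesis by (rule that)
qed

text \<open>The second assumption excludes a finite \<open>a\<close> over an infinite
  \<open>b\<close>, which would give 0. In \<open>orlicz_bump_bound\<close> positivity prevents a
  product of 0 and \<infinity> from hiding an infinite quotient.\<close>

lemma bump_quotient_pos:
  assumes "0 < a" "a < \<infinity> \<Longrightarrow> b < \<infinity>"
  shows "0 < bump_quotient a b"
  using assms
  by (auto simp: bump_quotient_def zero_less_iff_neq_zero ennreal_divide_eq_0_iff less_top[symmetric])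

text \<open>\<open>a = \<infinity>\<close> would give an infinite quotient, by convention even for
  \<open>b = \<infinity>\<close>, and \<open>b = 0\<close> would give one because
  \<open>a > 0\<close>. So the division can be undone.\<close>

lemma bump_quotient_finiteD:
  assumes "bump_quotient a b < \<infinity>" "0 < a" "a < \<infinity> \<Longrightarrow> b < \<infinity>"
  shows "a < \<infinity>" "a = bump_quotient a b * b"
proof -
  show a: "a < \<infinity>"
    using assms(1) by (auto simp: bump_quotient_def less_top[symmetric] ennreal_top_divide split: if_splits)
  have "b \<noteq> 0" using assms(1,2) a by (auto simp: bump_quotient_def zero_less_iff_neq_zero)
  then show "a = bump_quotient a b * b"
    using a assms(3) by (simp add: bump_quotient_def ennreal_mult_divide_cancel)
qed

text \<open>The assumptions \<open>ow\<close> and \<open>os\<close> make each Orlicz average finite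
  whenever the corresponding average is. Both quotients are then positive, so finiteness of their
  product passes to each of them, and each average equals its quotient times its Orlicz
  average.\<close>

lemma orlicz_bump_bound:
  assumes w: "weight w" and \<sigma>: "weight \<sigma>" and K: "K \<in> \<T>" "K \<in> sets ball_measure"
    "0 < emeasure ball_measure K" "emeasure ball_measure K < \<infinity>"
    and ow: "(orlicz_average \<Phi> K (\<lambda>z. sqrt (w z)))\<^sup>2 * emeasure ball_measure K \<le> ennreal A * emeasure (weighted w) K"
    and os: "(orlicz_average \<Psi> K (\<lambda>z. sqrt (\<sigma> z)))\<^sup>2 * emeasure ball_measure K \<le> ennreal A' * emeasure (weighted \<sigma>) K"
    and B: "orlicz_bump \<T> \<Phi> \<Psi> w \<sigma> < \<infinity>"
  shows "emeasure (weighted w) K < \<infinity>" "emeasure (weighted \<sigma>) K < \<infinity>"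
    "emeasure (weighted \<sigma>) K * emeasure (weighted w) K \<le> orlicz_bump \<T> \<Phi> \<Psi> w \<sigma> *
      (orlicz_average \<Psi> K (\<lambda>z. sqrt (\<sigma> z)) * orlicz_average \<Phi> K (\<lambda>z. sqrt (w z))) *
      (emeasure ball_measure K)\<^sup>2"
proof -
  define m where "m = emeasure ball_measure K"
  have m: "m \<noteq> 0" "m < \<infinity>" using K by (auto simp: m_def)
  define a where "a = average K (\<lambda>z. ennreal (w z))"
  define a' where "a' = average K (\<lambda>z. ennreal (\<sigma> z))"
  define b where "b = orlicz_average \<Phi> K (\<lambda>z. sqrt (w z))"
  define b' where "b' = orlicz_average \<Psi> K (\<lambda>z. sqrt (\<sigma> z))"
  have aw: "emeasure (weighted w) K = a * m" "emeasure (weighted \<sigma>) K = a' * m"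
    using m by (simp_all add: a_def a'_def average_weight w \<sigma> K m_def[symmetric] ennreal_mult_divide_cancel)
  have pos: "0 < a" "0 < a'"
    using emeasure_weighted_pos[OF w K(2,3)] emeasure_weighted_pos[OF \<sigma> K(2,3)] unfolding aw
    by (auto simp: zero_less_iff_neq_zero)
  have fin: "x < \<infinity>" if "x\<^sup>2 * m \<le> ennreal c * (y * m)" "y < \<infinity>" for x y :: ennreal and c
  proof -
    have "x\<^sup>2 * m < \<infinity>"
      using m that by (intro le_less_trans[OF that(1)]) (simp add: ennreal_mult_less_top less_top[symmetric] ennreal_mult_eq_top_iff)
    then show ?thesis
      using m(1) by (cases "x = \<infinity>") (auto simp: less_top[symmetric] power2_eq_square ennreal_mult_eq_top_iff)
  qed
  have b: "a < \<infinity> \<Longrightarrow> b < \<infinity>" using fin[of b A a] ow by (simp add: aw b_def m_def)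
  have b': "a' < \<infinity> \<Longrightarrow> b' < \<infinity>" using fin[of b' A' a'] os by (simp add: aw b'_def m_def)
  define q where "q = bump_quotient a b"
  define q' where "q' = bump_quotient a' b'"
  have qpos: "0 < q" "0 < q'"
    unfolding q_def q'_def using bump_quotient_pos pos b b' by blast+
  have qq: "q * q' \<le> orlicz_bump \<T> \<Phi> \<Psi> w \<sigma>"
    unfolding orlicz_bump_def q_def q'_def a_def b_def a'_def b'_def using K(1) by (rule SUP_upper)
  then have "q * q' < \<infinity>" using B by (rule le_less_trans)
  then have qfin: "q < \<infinity>" "q' < \<infinity>"
    using qpos by (auto simp: ennreal_mult_less_top zero_less_iff_neq_zero)
  have D: "a < \<infinity>" "a = q * b"
    using bump_quotient_finiteD[of a b] qfin(1) pos(1) b unfolding q_def by blast+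
  have D': "a' < \<infinity>" "a' = q' * b'"
    using bump_quotient_finiteD[of a' b'] qfin(2) pos(2) b' unfolding q'_def by blast+
  show "emeasure (weighted w) K < \<infinity>" "emeasure (weighted \<sigma>) K < \<infinity>"
    unfolding aw using D(1) D'(1) m by (simp_all add: ennreal_mult_less_top)
  have "(a' * m) * (a * m) = ((q' * b') * m) * ((q * b) * m)"
    using D(2) D'(2) by (rule arg_cong2[where f = "\<lambda>x y. (y * m) * (x * m)"])
  also have "\<dots> = (q * q') * (b' * b) * m\<^sup>2"
    by (simp only: power2_eq_square mult_ac)
  also have "\<dots> \<le> orlicz_bump \<T> \<Phi> \<Psi> w \<sigma> * (b' * b) * m\<^sup>2"
    using qq by (intro mult_right_mono) auto
  finally show "emeasure (weighted \<sigma>) K * emeasure (weighted w) K \<le> orlicz_bump \<T> \<Phi> \<Psi> w \<sigma> *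
      (orlicz_average \<Psi> K (\<lambda>z. sqrt (\<sigma> z)) * orlicz_average \<Phi> K (\<lambda>z. sqrt (w z))) *
      (emeasure ball_measure K)\<^sup>2"
    unfolding aw b_def b'_def m_def .
qed

section \<open>Measurability and size of the Bergman kernel\<close>

lemma borel_measurable_ball_measure:
  assumes "f \<in> borel_measurable borel"
  shows "f \<in> borel_measurable ball_measure"
proof -
  have "f \<in> borel_measurable (lebesgue_on (ball 0 1))"
    using assms by (intro measurable_restrict_space1 measurable_completion) simp
  then show ?thesis by (simp add: sets_ball_measure cong: measurable_cong_sets)
qed

lemma measurable_bergman_kernel:
  "(\<lambda>p. bergman_kernel (fst p) (snd p)) \<in> borel_measurable (ball_measure \<Otimes>\<^sub>M (ball_measure :: (complex ^ 'd) measure))"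
proof -
  have [measurable]: "(\<lambda>z. z $ j) \<in> borel_measurable (ball_measure :: (complex ^ 'd) measure)"
    "(\<lambda>z. cnj (z $ j)) \<in> borel_measurable (ball_measure :: (complex ^ 'd) measure)" for j
    by (intro borel_measurable_ball_measure borel_measurable_continuous_onI continuous_intros)+
  show ?thesis unfolding bergman_kernel_def cinner_def by measurable
qed

lemma measurable_bergman_projection:
  assumes g[measurable]: "g \<in> borel_measurable ball_measure"
  shows "bergman_projection g \<in> borel_measurable ball_measure"
proof -
  interpret finite_measure ball_measure by (rule finite_measure_ball_measure)
  note [measurable] = measurable_bergman_kernel
  have "(\<lambda>p. g (snd p) * bergman_kernel (fst p) (snd p)) \<in> borel_measurable (ball_measure \<Otimes>\<^sub>M ball_measure)"
    by measurable
  then show ?thesis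
    unfolding bergman_projection_def
    by (intro borel_measurable_lebesgue_integral) (simp add: case_prod_beta')
qed

lemma cmod_bergman_kernel_le:
  fixes z \<zeta> :: "complex ^ 'd"
  assumes "norm z < 1" "norm \<zeta> < 1"
  shows "cmod (bergman_kernel z \<zeta>) \<le> 1 / (1 - norm z) ^ (CARD('d) + 1)"
proof -
  have "norm z * norm \<zeta> \<le> norm z" using assms by (simp add: mult_left_le)
  then have "1 - norm z \<le> cmod (1 - cinner z \<zeta>)"
    using norm_triangle_ineq2[of 1 "cinner z \<zeta>"] cmod_cinner_le[of z \<zeta>] by simp
  then show ?thesis
    unfolding bergman_kernel_def norm_divide norm_power norm_one using assms
    by (intro divide_left_mono power_mono mult_pos_pos zero_less_power) auto
qed


section \<open>The Bergman projection\<close>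

text \<open>Sparseness replaces the measure of \<open>L\<close> by \<open>c\<close> times that of
  \<open>E L\<close>, to which the hypothesis on disjoint parts applies. \<open>A'\<close> leaves
  room for a constant common to both Young functions.\<close>

lemma sparse_carleson:
  assumes orlicz: "\<And>J E K. finite J \<Longrightarrow> J \<subseteq> \<T> \<Longrightarrow> disjoint_family_on E J \<Longrightarrow> K \<in> sets ball_measure \<Longrightarrow>
      (\<And>L. L \<in> J \<Longrightarrow> E L \<in> sets ball_measure \<and> E L \<subseteq> L \<and> L \<subseteq> K) \<Longrightarrow>
      (\<Sum>L\<in>J. (oa L)\<^sup>2 * emeasure ball_measure (E L)) \<le> ennreal A * emeasure S K"
    and c: "0 \<le> c" and A: "A \<le> A'"
    and \<K>: "sparse_family ball_measure c \<K>" "\<K> \<subseteq> \<T>" "\<K> \<subseteq> sets ball_measure"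
    and J: "finite J" "J \<subseteq> \<K>" "K \<in> J"
  shows "(\<Sum>L\<in>{L\<in>J. L \<subseteq> K}. (oa L)\<^sup>2 * emeasure ball_measure L) \<le> ennreal (c * A') * emeasure S K"
proof -
  interpret finite_measure ball_measure by (rule finite_measure_ball_measure)
  obtain E where E: "disjoint_family_on E \<K>" "\<And>K. K \<in> \<K> \<Longrightarrow> E K \<in> sets ball_measure \<and> E K \<subseteq> K"
      "\<And>K. K \<in> \<K> \<Longrightarrow> measure ball_measure K \<le> c * measure ball_measure (E K)"
    using \<K>(1) unfolding sparse_family_def by blast
  have "emeasure ball_measure L \<le> ennreal c * emeasure ball_measure (E L)" if "L \<in> \<K>" for L
    using E(3)[OF that] c by (simp add: emeasure_eq_measure ennreal_mult[symmetric] ennreal_leI)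
  then have "(\<Sum>L\<in>{L\<in>J. L \<subseteq> K}. (oa L)\<^sup>2 * emeasure ball_measure L)
      \<le> (\<Sum>L\<in>{L\<in>J. L \<subseteq> K}. (oa L)\<^sup>2 * (ennreal c * emeasure ball_measure (E L)))"
    using J by (intro sum_mono mult_left_mono) auto
  also have "\<dots> = ennreal c * (\<Sum>L\<in>{L\<in>J. L \<subseteq> K}. (oa L)\<^sup>2 * emeasure ball_measure (E L))"
    by (simp add: sum_distrib_left mult_ac)
  also have "\<dots> \<le> ennreal c * (ennreal A * emeasure S K)"
  proof (intro mult_left_mono orlicz)
    show "disjoint_family_on E {L\<in>J. L \<subseteq> K}"
      by (rule disjoint_family_on_mono[OF _ E(1)]) (use J in auto)
    show "E L \<in> sets ball_measure \<and> E L \<subseteq> L \<and> L \<subseteq> K" if "L \<in> {L\<in>J. L \<subseteq> K}" for L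
      using E(2)[of L] J(2) that by auto
  qed (use J \<K> in auto)
  also have "\<dots> \<le> ennreal c * (ennreal A' * emeasure S K)"
    using A by (intro mult_left_mono mult_right_mono ennreal_leI) auto
  also have "\<dots> = ennreal (c * A') * emeasure S K"
    using c by (simp add: ennreal_mult' mult.assoc)
  finally show ?thesis .
qed

lemma L2_norm_cmod: "L2_norm M (\<lambda>z. ennreal (cmod (f z))) = ennreal_sqrt (\<integral>\<^sup>+z. ennreal ((cmod (f z))\<^sup>2) \<partial>M)"
  by (simp add: L2_norm_def ennreal_power)

text \<open>For fixed \<open>z\<close> the kernel is bounded in \<open>\<zeta>\<close>, so
  integrability of \<open>f\<close> against \<open>\<sigma>\<close> gives absolute convergence at
  every point of the ball.\<close>

lemma bergman_projection_bound:
  fixes f :: "complex ^ 'd \<Rightarrow> complex"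
  assumes \<sigma>: "weight \<sigma>" and f: "f \<in> borel_measurable ball_measure"
    and z: "norm z < 1"
    and fin: "(\<integral>\<^sup>+\<zeta>. cmod (f \<zeta>) \<partial>weighted \<sigma>) < \<infinity>"
  shows "integrable ball_measure (\<lambda>\<zeta>. \<sigma> \<zeta> * f \<zeta> * bergman_kernel z \<zeta>)"
    and "ennreal (cmod (bergman_projection (\<lambda>\<zeta>. \<sigma> \<zeta> * f \<zeta>) z))
      \<le> (\<integral>\<^sup>+\<zeta>. ennreal (cmod (f \<zeta>)) * ennreal (cmod (bergman_kernel z \<zeta>)) \<partial>weighted \<sigma>)"
proof -
  have \<sigma>m[measurable]: "\<sigma> \<in> borel_measurable ball_measure" and pos: "AE z in ball_measure. 0 < \<sigma> z"
    using \<sigma> by (auto simp: weight_def)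
  note [measurable] = f
  have "(\<lambda>\<zeta>. bergman_kernel (fst (z, \<zeta>)) (snd (z, \<zeta>))) \<in> borel_measurable ball_measure"
    by (rule measurable_compose[OF measurable_Pair1' measurable_bergman_kernel]) (use z in simp)
  then have [measurable]: "bergman_kernel z \<in> borel_measurable ball_measure" by simp
  let ?c = "1 / (1 - norm z) ^ (CARD('d) + 1)"
  have eq: "(\<integral>\<^sup>+\<zeta>. norm (\<sigma> \<zeta> * f \<zeta> * bergman_kernel z \<zeta>) \<partial>ball_measure)
      = (\<integral>\<^sup>+\<zeta>. ennreal (cmod (f \<zeta>)) * ennreal (cmod (bergman_kernel z \<zeta>)) \<partial>weighted \<sigma>)"
  proof -
    have "(\<integral>\<^sup>+\<zeta>. norm (\<sigma> \<zeta> * f \<zeta> * bergman_kernel z \<zeta>) \<partial>ball_measure) =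
        (\<integral>\<^sup>+\<zeta>. ennreal (\<sigma> \<zeta>) * (ennreal (cmod (f \<zeta>)) * ennreal (cmod (bergman_kernel z \<zeta>))) \<partial>ball_measure)"
    proof (rule nn_integral_cong_AE)
      show "AE \<zeta> in ball_measure. ennreal (norm (\<sigma> \<zeta> * f \<zeta> * bergman_kernel z \<zeta>)) =
          ennreal (\<sigma> \<zeta>) * (ennreal (cmod (f \<zeta>)) * ennreal (cmod (bergman_kernel z \<zeta>)))"
        using pos by eventually_elim (simp add: norm_mult ennreal_mult mult.assoc)
    qed
    also have "\<dots> = (\<integral>\<^sup>+\<zeta>. ennreal (cmod (f \<zeta>)) * ennreal (cmod (bergman_kernel z \<zeta>)) \<partial>weighted \<sigma>)"
      by (rule nn_integral_weighted[OF \<sigma>, symmetric]) measurable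
    finally show ?thesis .
  qed
  have "(\<integral>\<^sup>+\<zeta>. ennreal (cmod (f \<zeta>)) * ennreal (cmod (bergman_kernel z \<zeta>)) \<partial>weighted \<sigma>)
      \<le> (\<integral>\<^sup>+\<zeta>. ennreal (cmod (f \<zeta>)) * ennreal ?c \<partial>weighted \<sigma>)"
    by (intro nn_integral_mono mult_left_mono ennreal_leI cmod_bergman_kernel_le z) auto
  also have "\<dots> = (\<integral>\<^sup>+\<zeta>. cmod (f \<zeta>) \<partial>weighted \<sigma>) * ennreal ?c"
    by (rule nn_integral_multc) (simp add: borel_measurable_weighted_iff)
  also have "\<dots> < \<infinity>" using fin by (simp add: ennreal_mult_less_top)
  finally show int: "integrable ball_measure (\<lambda>\<zeta>. \<sigma> \<zeta> * f \<zeta> * bergman_kernel z \<zeta>)"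
    unfolding eq[symmetric] by (intro integrableI_bounded) measurable
  show "ennreal (cmod (bergman_projection (\<lambda>\<zeta>. \<sigma> \<zeta> * f \<zeta>) z))
      \<le> (\<integral>\<^sup>+\<zeta>. ennreal (cmod (f \<zeta>)) * ennreal (cmod (bergman_kernel z \<zeta>)) \<partial>weighted \<sigma>)"
    unfolding eq[symmetric] bergman_projection_def by (rule integral_norm_bound_ennreal[OF int])
qed

theorem theorem2:
  fixes \<Phi> \<Psi> :: "real \<Rightarrow> real" and R \<delta> :: real and N :: nat
    and T :: "nat \<Rightarrow> 'd::finite tree_data" and \<T> :: "(complex ^ 'd) set set"
  assumes "R > 0" and "\<delta> > 0"
    and "\<And>l. l \<in> {1..N} \<Longrightarrow> bergman_tree R \<delta> (T l)"
    and "\<T> = dyadic_tents R N T"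
    and "covers_carleson_tents \<T>"
    and "young_function \<Phi>" and "young_function \<Psi>"
    and "maximal_bounded_L2 \<T> \<Phi>" and "maximal_bounded_L2 \<T> \<Psi>"
  shows "\<exists>C::real. C > 0 \<and>
    (\<forall>\<sigma> w. weight \<sigma> \<and> weight w \<longrightarrow>
      (\<forall>f \<in> L2_space (weighted \<sigma>).
        (orlicz_bump \<T> \<Phi> \<Psi> w \<sigma> < \<infinity> \<longrightarrow>
          (\<forall>z\<in>ball 0 1. integrable ball_measure (\<lambda>\<zeta>. \<sigma> \<zeta> * f \<zeta> * bergman_kernel z \<zeta>)) \<and>
          bergman_projection (\<lambda>\<zeta>. \<sigma> \<zeta> * f \<zeta>) \<in> L2_space (weighted w)) \<and>
        L2_norm (weighted w) (\<lambda>z. ennreal (cmod (bergman_projection (\<lambda>\<zeta>. \<sigma> \<zeta> * f \<zeta>) z)))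
          \<le> ennreal C * orlicz_bump \<T> \<Phi> \<Psi> w \<sigma>
              * L2_norm (weighted \<sigma>) (\<lambda>z. ennreal (cmod (f z)))))"
proof -
  interpret M: finite_measure "ball_measure :: (complex ^ 'd) measure"
    by (rule finite_measure_ball_measure)
  note trees = assms(3)
  obtain c where c: "c > 0" and kernel: "\<And>z \<zeta>. norm z < 1 \<Longrightarrow> norm \<zeta> < 1 \<Longrightarrow>
    \<exists>l\<in>{1..N}. \<exists>K\<in>fat_tents c R (T l). z \<in> K \<and> \<zeta> \<in> K \<and>
      cmod (bergman_kernel z \<zeta>) * measure ball_measure K \<le> c"
    using fat_tent_kernel_bound[OF assms(1,2) trees assms(5)[unfolded assms(4)]] by blast
  obtain A1 where A1: "A1 > 0" and orlicz1: "\<And>w J E K. weight w \<Longrightarrow> finite J \<Longrightarrow> J \<subseteq> \<T> \<Longrightarrow>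
      disjoint_family_on E J \<Longrightarrow> K \<in> sets ball_measure \<Longrightarrow>
      (\<And>L. L \<in> J \<Longrightarrow> E L \<in> sets ball_measure \<and> E L \<subseteq> L \<and> L \<subseteq> K) \<Longrightarrow>
      (\<Sum>L\<in>J. (orlicz_average \<Phi> L (\<lambda>z. sqrt (w z)))\<^sup>2 * emeasure ball_measure (E L))
        \<le> ennreal A1 * emeasure (weighted w) K"
    using orlicz_carleson[OF assms(8)] by blast
  obtain A2 where A2: "A2 > 0" and orlicz2: "\<And>w J E K. weight w \<Longrightarrow> finite J \<Longrightarrow> J \<subseteq> \<T> \<Longrightarrow>
      disjoint_family_on E J \<Longrightarrow> K \<in> sets ball_measure \<Longrightarrow>
      (\<And>L. L \<in> J \<Longrightarrow> E L \<in> sets ball_measure \<and> E L \<subseteq> L \<and> L \<subseteq> K) \<Longrightarrow>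
      (\<Sum>L\<in>J. (orlicz_average \<Psi> L (\<lambda>z. sqrt (w z)))\<^sup>2 * emeasure ball_measure (E L))
        \<le> ennreal A2 * emeasure (weighted w) K"
    using orlicz_carleson[OF assms(9)] by blast
  define A where "A = c * max A1 A2"
  \<comment> \<open>Each of the \<open>N\<close> trees contributes \<open>8 * A\<close>, and
    \<open>c\<close> is the kernel constant; adding 1 makes \<open>C\<close> positive for every
    \<open>N\<close>.\<close>
  define C where "C = c * (real N * (8 * A)) + 1"
  have A: "A > 0" using c A1 by (simp add: A_def)
  have C: "C > 0" using A c by (simp add: C_def add_nonneg_pos)
  have tents: "K \<in> sets ball_measure" if K: "K \<in> \<T>" for K
  proof -
    obtain l \<alpha> where l: "l \<in> {1..N}" "\<alpha> \<in> vertices (T l)" "K = dyadic_tent R (T l) \<alpha>"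
      using K unfolding assms(4) dyadic_tents_def by auto
    show ?thesis
      unfolding l(3) by (intro borel_sets_ball_measure borel_dyadic_tent[OF trees[OF l(1)] l(2)] dyadic_tent_subset)
  qed
  have fat: "fat_tents c R (T l) \<subseteq> \<T>" if "l \<in> {1..N}" for l
    unfolding assms(4) dyadic_tents_def by (rule UN_upper[OF that, THEN subset_trans[OF fat_tents_subset]])
  have fat_pos: "0 < measure ball_measure K" if l: "l \<in> {1..N}" and K: "K \<in> fat_tents c R (T l)" for l K
  proof -
    obtain E where E: "E \<in> sets ball_measure" "E \<subseteq> K" "0 < measure ball_measure E"
      using sparse_fat_tents[OF assms(1,2) trees[OF l], of c] K unfolding sparse_family_def by blast
    have "K \<in> sets ball_measure" using tents fat[OF l] K by blast
    then show ?thesis using E by (meson M.finite_measure_mono less_le_trans)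
  qed
  have finite_bump: "(\<forall>z\<in>ball 0 1. integrable ball_measure (\<lambda>\<zeta>. \<sigma> \<zeta> * f \<zeta> * bergman_kernel z \<zeta>)) \<and>
      bergman_projection (\<lambda>\<zeta>. \<sigma> \<zeta> * f \<zeta>) \<in> L2_space (weighted w) \<and>
      L2_norm (weighted w) (\<lambda>z. ennreal (cmod (bergman_projection (\<lambda>\<zeta>. \<sigma> \<zeta> * f \<zeta>) z)))
        \<le> ennreal C * orlicz_bump \<T> \<Phi> \<Psi> w \<sigma> * L2_norm (weighted \<sigma>) (\<lambda>z. ennreal (cmod (f z)))"
    if \<sigma>: "weight \<sigma>" and w: "weight w" and f: "f \<in> L2_space (weighted \<sigma>)"
      and B: "orlicz_bump \<T> \<Phi> \<Psi> w \<sigma> < \<infinity>" for \<sigma> w f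
  proof -
    define B where "B = orlicz_bump \<T> \<Phi> \<Psi> w \<sigma>"
    define X where "X = L2_norm (weighted \<sigma>) (\<lambda>z. ennreal (cmod (f z)))"
    have fm[measurable]: "f \<in> borel_measurable ball_measure" and Xfin: "X < \<infinity>"
      using f by (auto simp: L2_space_def borel_measurable_weighted_iff X_def)
    have [measurable]: "\<sigma> \<in> borel_measurable ball_measure" using \<sigma> by (simp add: weight_def)
    have bump: "emeasure (weighted w) K < \<infinity>" "emeasure (weighted \<sigma>) K < \<infinity>"
      "emeasure (weighted \<sigma>) K * emeasure (weighted w) K \<le> B *
      (orlicz_average \<Psi> K (\<lambda>z. sqrt (\<sigma> z)) * orlicz_average \<Phi> K (\<lambda>z. sqrt (w z))) *
      (emeasure ball_measure K)\<^sup>2" if K: "K \<in> \<T>" "0 < emeasure ball_measure K" for K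
    proof -
      \<comment> \<open>The Carleson inequality for the one-element family \<open>{K}\<close> with
        \<open>E K = K\<close>.\<close>
      have "(orlicz_average \<Phi> K (\<lambda>z. sqrt (w z)))\<^sup>2 * emeasure ball_measure K \<le> ennreal A1 * emeasure (weighted w) K"
        using orlicz1[OF w, of "{K}" "\<lambda>L. L" K] K tents[OF K(1)] by (simp add: disjoint_family_on_def)
      moreover have "(orlicz_average \<Psi> K (\<lambda>z. sqrt (\<sigma> z)))\<^sup>2 * emeasure ball_measure K \<le> ennreal A2 * emeasure (weighted \<sigma>) K"
        using orlicz2[OF \<sigma>, of "{K}" "\<lambda>L. L" K] K tents[OF K(1)] by (simp add: disjoint_family_on_def)
      moreover have "emeasure ball_measure K < \<infinity>" by (simp add: less_top[symmetric])
      ultimately show "emeasure (weighted w) K < \<infinity>" "emeasure (weighted \<sigma>) K < \<infinity>"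
        "emeasure (weighted \<sigma>) K * emeasure (weighted w) K \<le> B *
        (orlicz_average \<Psi> K (\<lambda>z. sqrt (\<sigma> z)) * orlicz_average \<Phi> K (\<lambda>z. sqrt (w z))) *
        (emeasure ball_measure K)\<^sup>2"
        using orlicz_bump_bound[OF w \<sigma> K(1) tents[OF K(1)] K(2) _ _ _ B] unfolding B_def by blast+
    qed
    \<comment> \<open>Taking the whole ball for \<open>K\<close> in \<open>bump\<close> shows that
      both weighted measures are finite.\<close>
    have ball: "ball 0 1 \<in> \<T>" using unit_ball_in_tents assms(4,5) by simp
    have S: "finite_measure (weighted \<sigma>)" and W: "finite_measure (weighted w)"
      using bump(1,2)[OF ball] by (auto intro!: finite_measureI simp: less_top)
    have f2: "(\<integral>\<^sup>+x. ennreal ((cmod (f x))\<^sup>2) \<partial>weighted \<sigma>) < \<infinity>"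
      using Xfin unfolding X_def L2_norm_cmod ennreal_sqrt_less_top_iff .
    have f1: "(\<integral>\<^sup>+x. cmod (f x) \<partial>weighted \<sigma>) < \<infinity>"
      by (rule nn_integral_finite_if_square[OF S _ _ f2]) (simp_all add: borel_measurable_weighted_iff)
    note P = bergman_projection_bound[OF \<sigma> fm _ f1]
    define F where "F z = cmod (bergman_projection (\<lambda>\<zeta>. \<sigma> \<zeta> * f \<zeta>) z)" for z
    have Pm[measurable]: "bergman_projection (\<lambda>\<zeta>. \<sigma> \<zeta> * f \<zeta>) \<in> borel_measurable ball_measure"
      by (intro measurable_bergman_projection) measurable
    have Fm[measurable]: "F \<in> borel_measurable ball_measure" unfolding F_def by measurable
    define D where "D = ennreal C * B * X"
    have bilinear: "(\<integral>\<^sup>+z. ennreal (F z) * ennreal (g z) \<partial>weighted w)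
        \<le> D * ennreal_sqrt (\<integral>\<^sup>+z. ennreal ((g z)\<^sup>2) \<partial>weighted w)"
      if gm[measurable]: "g \<in> borel_measurable ball_measure" and g0: "\<And>z. 0 \<le> g z"
        and g2: "(\<integral>\<^sup>+z. ennreal ((g z)\<^sup>2) \<partial>weighted w) < \<infinity>" for g
    proof -
      define Y where "Y = ennreal_sqrt (\<integral>\<^sup>+z. ennreal ((g z)\<^sup>2) \<partial>weighted w)"
      have "(\<integral>\<^sup>+z. ennreal (F z) * ennreal (g z) \<partial>weighted w) \<le>
          (\<integral>\<^sup>+z. (\<integral>\<^sup>+\<zeta>. ennreal (cmod (f \<zeta>)) * ennreal (cmod (bergman_kernel z \<zeta>)) \<partial>weighted \<sigma>)
            * ennreal (g z) \<partial>weighted w)"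
        unfolding F_def by (intro nn_integral_mono mult_right_mono P(2)) auto
      also have "\<dots> \<le> ennreal c * (\<Sum>l\<in>{1..N}. \<integral>\<^sup>+K. (\<integral>\<^sup>+x\<in>K. cmod (f x) \<partial>weighted \<sigma>) *
          (\<integral>\<^sup>+x\<in>K. g x \<partial>weighted w) / emeasure ball_measure K \<partial>count_space (fat_tents c R (T l)))"
      proof (rule kernel_form_le)
        show "countable (fat_tents c R (T l))" for l by (rule countable_fat_tents)
        show "fat_tents c R (T l) \<subseteq> sets ball_measure" if "l \<in> {1..N}" for l
          using fat[OF that] tents by blast
        fix z \<zeta> :: "complex ^ 'd" assume "z \<in> space ball_measure" "\<zeta> \<in> space ball_measure"
        then obtain l K where l: "l \<in> {1..N}" "K \<in> fat_tents c R (T l)" "z \<in> K" "\<zeta> \<in> K"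
          and le: "cmod (bergman_kernel z \<zeta>) * measure ball_measure K \<le> c"
          using kernel[of z \<zeta>] by auto
        have m: "0 < measure ball_measure K" using fat_pos l by blast
        then have "cmod (bergman_kernel z \<zeta>) \<le> c / measure ball_measure K"
          using le by (simp add: pos_le_divide_eq)
        then have "ennreal (cmod (bergman_kernel z \<zeta>)) \<le> ennreal c / emeasure ball_measure K"
          using m c by (simp add: M.emeasure_eq_measure divide_ennreal ennreal_leI)
        with l show "\<exists>l\<in>{1..N}. \<exists>K\<in>fat_tents c R (T l). z \<in> K \<and> \<zeta> \<in> K \<and>
            ennreal (cmod (bergman_kernel z \<zeta>)) \<le> ennreal c / emeasure ball_measure K" by blast
      qed auto
      also have "\<dots> \<le> ennreal c * (\<Sum>l\<in>{1..N}. B * (8 * ennreal A) * (X * Y))"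
      proof (intro mult_left_mono sum_mono)
        fix l assume l: "l \<in> {1..N}"
        show "(\<integral>\<^sup>+K. (\<integral>\<^sup>+x\<in>K. cmod (f x) \<partial>weighted \<sigma>) * (\<integral>\<^sup>+x\<in>K. g x \<partial>weighted w)
            / emeasure ball_measure K \<partial>count_space (fat_tents c R (T l))) \<le> B * (8 * ennreal A) * (X * Y)"
          unfolding X_def Y_def L2_norm_cmod
        \<comment> \<open>Here \<open>a\<close> is the Orlicz average of the square root of
          \<open>\<sigma>\<close> for \<open>\<Psi>\<close>, \<open>b\<close> that of the square
          root of \<open>w\<close> for \<open>\<Phi>\<close>, and \<open>M\<close> is
          \<open>ball_measure\<close>.\<close>
        proof (rule sparse_bilinear_bound[OF S _ W _ _ _ gm g0 countable_fat_tents laminar_fat_tents[OF assms(1,2) trees[OF l]]])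
          show fs: "fat_tents c R (T l) \<subseteq> sets ball_measure" using fat[OF l] tents by blast
          fix K assume K: "K \<in> fat_tents c R (T l)"
          show MK: "0 < emeasure ball_measure K"
            using fat_pos[OF l K] by (simp add: M.emeasure_eq_measure)
          show "0 < emeasure (weighted \<sigma>) K" "0 < emeasure (weighted w) K"
            using emeasure_weighted_pos \<sigma> w MK fs K by blast+
          show "emeasure ball_measure K < \<infinity>" by (simp add: less_top[symmetric])
          show "emeasure (weighted \<sigma>) K * emeasure (weighted w) K \<le> B *
            (orlicz_average \<Psi> K (\<lambda>z. sqrt (\<sigma> z)) * orlicz_average \<Phi> K (\<lambda>z. sqrt (w z))) *
            (emeasure ball_measure K)\<^sup>2" using bump(3) fat[OF l] K MK by blast
        next
          fix J K assume J: "finite J" "J \<subseteq> fat_tents c R (T l)" "K \<in> J"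
          have fs: "fat_tents c R (T l) \<subseteq> sets ball_measure" using fat[OF l] tents by blast
          have sp: "sparse_family ball_measure c (fat_tents c R (T l))"
            by (rule sparse_fat_tents[OF assms(1,2) trees[OF l]])
          show "(\<Sum>L\<in>{L\<in>J. L \<subseteq> K}. (orlicz_average \<Psi> L (\<lambda>z. sqrt (\<sigma> z)))\<^sup>2 * emeasure ball_measure L)
              \<le> ennreal A * emeasure (weighted \<sigma>) K"
            unfolding A_def using c
            by (intro sparse_carleson[OF orlicz2[OF \<sigma>] _ _ sp fat[OF l] fs J]) auto
          show "(\<Sum>L\<in>{L\<in>J. L \<subseteq> K}. (orlicz_average \<Phi> L (\<lambda>z. sqrt (w z)))\<^sup>2 * emeasure ball_measure L)
              \<le> ennreal A * emeasure (weighted w) K"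
            unfolding A_def using c
            by (intro sparse_carleson[OF orlicz1[OF w] _ _ sp fat[OF l] fs J]) auto
        qed (use f2 g2 in auto)
      qed auto
      also have "\<dots> = ennreal (c * (real N * (8 * A))) * B * X * Y"
        using c A by (simp add: ennreal_mult ennreal_of_nat_eq_real_of_nat mult_ac)
      also have "\<dots> \<le> ennreal C * B * X * Y"
        by (intro mult_right_mono ennreal_leI) (auto simp: C_def)
      finally show ?thesis by (simp add: D_def Y_def)
    qed
    \<comment> \<open>The truncations are bounded and the weighted measure of the ball is finite, so
      \<open>bilinear\<close> applies to them.\<close>
    have "ennreal_sqrt (\<integral>\<^sup>+z. ennreal ((F z)\<^sup>2) \<partial>weighted w) \<le> D"
    proof (rule L2_bound_by_truncation[OF W])
      fix n :: nat
      show "(\<integral>\<^sup>+z. ennreal (F z) * ennreal (min (F z) n) \<partial>weighted w)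
          \<le> D * ennreal_sqrt (\<integral>\<^sup>+z. ennreal ((min (F z) n)\<^sup>2) \<partial>weighted w)"
      proof (rule bilinear)
        have "(\<integral>\<^sup>+z. ennreal ((min (F z) n)\<^sup>2) \<partial>weighted w) \<le> (\<integral>\<^sup>+z. ennreal ((real n)\<^sup>2) \<partial>weighted w)"
          by (intro nn_integral_mono ennreal_leI power_mono) (auto simp: F_def)
        also have "\<dots> < \<infinity>"
          using bump(1)[OF ball] by (simp add: ennreal_mult_less_top)
        finally show "(\<integral>\<^sup>+z. ennreal ((min (F z) n)\<^sup>2) \<partial>weighted w) < \<infinity>" .
      qed (auto simp: F_def)
    qed (auto simp: F_def borel_measurable_weighted_iff)
    then have le: "L2_norm (weighted w) (\<lambda>z. ennreal (cmod (bergman_projection (\<lambda>\<zeta>. \<sigma> \<zeta> * f \<zeta>) z))) \<le> D"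
      by (simp add: L2_norm_cmod F_def)
    also have "D < \<infinity>"
      using B Xfin by (simp add: D_def B_def ennreal_mult_less_top)
    finally have "bergman_projection (\<lambda>\<zeta>. \<sigma> \<zeta> * f \<zeta>) \<in> L2_space (weighted w)"
      by (simp add: L2_space_def borel_measurable_weighted_iff Pm)
    with le P(1) show ?thesis by (auto simp: D_def B_def X_def)
  qed
  have infinite_bump: "L2_norm (weighted w) (\<lambda>z. ennreal (cmod (bergman_projection (\<lambda>\<zeta>. \<sigma> \<zeta> * f \<zeta>) z)))
        \<le> ennreal C * orlicz_bump \<T> \<Phi> \<Psi> w \<sigma> * L2_norm (weighted \<sigma>) (\<lambda>z. ennreal (cmod (f z)))"
    if \<sigma>: "weight \<sigma>" and f: "f \<in> L2_space (weighted \<sigma>)"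
      and B: "orlicz_bump \<T> \<Phi> \<Psi> w \<sigma> = \<infinity>" for \<sigma> w f
  \<comment> \<open>The right-hand side is \<infinity> times the norm of \<open>f\<close>, which in
    \<open>ennreal\<close> is 0 if the norm is 0. In that case \<open>f\<close> vanishes almost
    everywhere, by positivity of \<open>\<sigma>\<close> also for \<open>ball_measure\<close>, and
    its projection is 0.\<close>
  proof (cases "L2_norm (weighted \<sigma>) (\<lambda>z. ennreal (cmod (f z))) = 0")
    case False
    then show ?thesis using C by (simp add: B ennreal_mult_top ennreal_top_mult)
  next
    case True
    have [measurable]: "f \<in> borel_measurable ball_measure" "\<sigma> \<in> borel_measurable ball_measure"
      and pos: "AE z in ball_measure. 0 < \<sigma> z"
      using f \<sigma> by (auto simp: L2_space_def borel_measurable_weighted_iff weight_def)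
    have "(\<integral>\<^sup>+z. ennreal ((cmod (f z))\<^sup>2) \<partial>weighted \<sigma>) = 0"
      using True ennreal_sqrt_power2[of "\<integral>\<^sup>+z. ennreal ((cmod (f z))\<^sup>2) \<partial>weighted \<sigma>"] by (simp add: L2_norm_cmod)
    then have "AE z in weighted \<sigma>. f z = 0"
      by (subst (asm) nn_integral_0_iff_AE) (auto simp: borel_measurable_weighted_iff)
    then have "AE z in ball_measure. 0 < \<sigma> z \<longrightarrow> f z = 0"
      unfolding weighted_def by (subst (asm) AE_density) auto
    then have "AE z in ball_measure. f z = 0" using pos by eventually_elim auto
    then have "bergman_projection (\<lambda>\<zeta>. \<sigma> \<zeta> * f \<zeta>) z = 0" for z
      unfolding bergman_projection_def by (intro integral_eq_zero_AE, eventually_elim) simp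
    then show ?thesis by (simp add: L2_norm_def ennreal_sqrt_def)
  qed
  show ?thesis
  proof (intro exI[of _ C] conjI[OF C] allI impI ballI, goal_cases)
    case (1 \<sigma> w f)
    then show ?case
      using finite_bump[of \<sigma> w f] infinite_bump[of \<sigma> f w]
      by (cases "orlicz_bump \<T> \<Phi> \<Psi> w \<sigma> = \<infinity>") (simp_all add: less_top)
  qed
qed

end
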